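(* Let $L>0$, $I_L=(0,L)$, let $\theta,\phi\in BV(I_L)$ be continuous functions of bounded variation with $\theta$ strictly increasing, and let $$\Omega(s)=\begin{pmatrix}0&\theta(s)&0\\-\theta(s)&0&\phi(s)\\0&-\phi(s)&0\end{pmatrix}.$$ Let $G\in BV(I_L,SO(3))$ be the unique continuous solution of $DG=-(G^\top)^{-1}D\Omega$, $G(0)=\mathbb I_3$, let $\mathbf t(s)=G(s)\mathbf e_1$, $\mathbf b(s)=G(s)\mathbf e_3$, and let $\mathbf c:[0,L]\to\mathbb R^3$ be the (unique up to rigid motions) arc-length parameterized $C^1$ curve with $\mathbf c'(s)=\mathbf t(s)$ for every $s\in I_L$. Then $\mathbf c$ has finite total absolute torsion given by $$\mathrm{TAT}(\mathbf c)=|D\mathbf b|(I_L)=|D\phi|(I_L)<\infty .$$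
   Context: $(\mathbf e_1,\mathbf e_2,\mathbf e_3)$ is the canonical basis of $\mathbb R^3$, $\mathbb I_3$ the identity. $BV(I_L,X)$ denotes functions of bounded variation with values in $X$ a.e.; $|Du|(I_L)$ is the total variation of the derivative measure; $u(0)=u(0^+)$; $u$ is continuous if $Du$ has no atomic part. The differential equation is an equality of matrix-valued Borel measures on $I_L$, with $G$ on the right-hand side the precise representative $\frac12(G(s^+)+G(s^-))$, invertible for every $s$. Total absolute torsion. Let $\mathbf p$ be a (non-closed) polygonal curve in $\mathbb R^3$ with consecutive vertices $v_0,\dots,v_n$, $n\ge3$, with segments $\sigma_i=[v_{i-1},v_i]$ of positive length and consecutive segments not aligned (which is assumed without loss of generality). Let $t_i=(v_i-v_{i-1})/\|v_i-v_{i-1}\|\in\mathbb S^2$, and let $\gamma_i$ be the geodesic arc of $\mathbb S^2$ joining $t_i$ to $t_{i+1}$. Set $\widetilde{\mathrm{TAT}}(\mathbf p)=\sum_{i=2}^{n-1}\widetilde\tau_i$, where $\widetilde\tau_i\in[0,\pi/2]$ is the shortest angle in $\mathbb S^2$ between the unoriented geodesic arcs $\gamma_{i-1}$ and $\gamma_i$ meeting at $t_i$ (the angle between the unoriented lines spanned by $\sigma_{i-1}\times\sigma_i$ and $\sigma_i\times\sigma_{i+1}$). For a rectifiable curve $\mathbf c$, $\mathrm{TAT}(\mathbf c)=\lim_{\varepsilon\to0^+}\sup\{\widetilde{\mathrm{TAT}}(\mathbf p): \mathbf p \text{ inscribed in }\mathbf c,\ \mu_{\mathbf c}(\mathbf p)<\varepsilon\}$,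 where $\mu_{\mathbf c}(\mathbf p)$ is the maximum of the diameters of the arcs of $\mathbf c$ determined by the consecutive vertices of $\mathbf p$. *)

theory Defs
  imports "HOL-Analysis.Analysis"
begin

section \<open>Vector measures and functions of bounded variation\<close>

text \<open>
  A vector measure on the Borel subsets of \<open>I\<close> is a countably additive set function.  Summability
  of \<open>\<mu> \<circ> B\<close> for every disjoint \<open>B\<close> forces \<open>\<mu> {} = 0\<close>.  The value \<open>0\<close> outside the sigma-algebra
  is a normalisation that makes equality of measures equality of set functions.
\<close>

definition vector_measure_on :: "real set \<Rightarrow> (real set \<Rightarrow> 'a::real_normed_vector) \<Rightarrow> bool" where
  "vector_measure_on I \<mu> \<longleftrightarrow>
     (\<forall>B :: nat \<Rightarrow> real set. range B \<subseteq> sets (restrict_space borel I) \<longrightarrow> disjoint_family B \<longrightarrow>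
        (\<lambda>n. \<mu> (B n)) sums \<mu> (\<Union>n. B n)) \<and>
     (\<forall>B. B \<notin> sets (restrict_space borel I) \<longrightarrow> \<mu> B = 0)"

definition variation :: "(real set \<Rightarrow> 'a::real_normed_vector) \<Rightarrow> real set \<Rightarrow> ennreal" where
  "variation \<mu> B =
     (SUP A \<in> {A :: nat \<Rightarrow> real set. range A \<subseteq> sets borel \<and> disjoint_family A \<and> (\<Union>n. A n) = B}.
        (\<Sum>n. ennreal (norm (\<mu> (A n)))))"

text \<open>
  The integral of \<open>f\<close> over \<open>B\<close> against a real signed measure is computed from any decomposition of
  the measure into a difference of finite positive measures, such as its Jordan decomposition;
  the value does not depend on the decomposition.
\<close>

definition has_signed_integral ::
  "real set \<Rightarrow> (real set \<Rightarrow> real) \<Rightarrow> real set \<Rightarrow> (real \<Rightarrow> real) \<Rightarrow> real \<Rightarrow> bool" where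
  "has_signed_integral I \<mu> B f v \<longleftrightarrow>
     (\<exists>P N. finite_measure P \<and> sets P = sets (restrict_space borel I) \<and>
            finite_measure N \<and> sets N = sets (restrict_space borel I) \<and>
            (\<forall>A \<in> sets (restrict_space borel I). \<mu> A = measure P A - measure N A) \<and>
            set_integrable P B f \<and> set_integrable N B f \<and>
            v = (LINT x:B|P. f x) - (LINT x:B|N. f x))"

definition test_function :: "real set \<Rightarrow> (real \<Rightarrow> real) \<Rightarrow> bool" where
  "test_function I \<psi> \<longleftrightarrow> \<psi> C1_differentiable_on UNIV \<and>
     compact (closure {x. \<psi> x \<noteq> 0}) \<and> closure {x. \<psi> x \<noteq> 0} \<subseteq> I"

text \<open>
  \<open>\<mu>\<close> is the distributional derivative of \<open>u\<close> on \<open>I\<close>: componentwise, the integral of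
  \<open>u \<cdot> deriv \<psi>\<close> is minus the integral of \<open>\<psi>\<close> against \<open>\<mu>\<close>.
\<close>

definition is_deriv_measure ::
  "real set \<Rightarrow> (real \<Rightarrow> 'a::euclidean_space) \<Rightarrow> (real set \<Rightarrow> 'a) \<Rightarrow> bool" where
  "is_deriv_measure I u \<mu> \<longleftrightarrow> vector_measure_on I \<mu> \<and>
     (\<forall>e \<in> Basis. \<forall>\<psi>. test_function I \<psi> \<longrightarrow>
        has_signed_integral I (\<lambda>B. \<mu> B \<bullet> e) I \<psi> (- (LINT x:I|lborel. (u x \<bullet> e) * deriv \<psi> x)))"

definition BV :: "real set \<Rightarrow> 'a::euclidean_space set \<Rightarrow> (real \<Rightarrow> 'a) set" where
  "BV I X = {u. set_integrable lborel I u \<and> (AE x in lborel. x \<in> I \<longrightarrow> u x \<in> X) \<and>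
                (\<exists>\<mu>. is_deriv_measure I u \<mu>)}"

definition deriv_measure :: "real set \<Rightarrow> (real \<Rightarrow> 'a::euclidean_space) \<Rightarrow> real set \<Rightarrow> 'a" where
  "deriv_measure I u = (THE \<mu>. is_deriv_measure I u \<mu>)"

definition precise_rep :: "(real \<Rightarrow> 'a::real_normed_vector) \<Rightarrow> real \<Rightarrow> 'a" where
  "precise_rep u s = (1/2) *\<^sub>R (Lim (at_right s) u + Lim (at_left s) u)"


section \<open>The frame equation\<close>

text \<open>The equality \<open>\<nu> = M \<mu>\<close> of matrix-valued measures, entrywise \<open>\<nu> i j = (\<Sum>k. M i k \<mu> k j)\<close>.\<close>

definition is_matrix_times_measure ::
  "real set \<Rightarrow> (real \<Rightarrow> real^3^3) \<Rightarrow> (real set \<Rightarrow> real^3^3) \<Rightarrow> (real set \<Rightarrow> real^3^3) \<Rightarrow> bool" where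
  "is_matrix_times_measure I M \<mu> \<nu> \<longleftrightarrow>
     (\<forall>B \<in> sets (restrict_space borel I). \<forall>i j. \<exists>v :: 3 \<Rightarrow> real.
        (\<forall>k. has_signed_integral I (\<lambda>A. \<mu> A $ k $ j) B (\<lambda>s. M s $ i $ k) (v k)) \<and>
        \<nu> B $ i $ j = (\<Sum>k\<in>UNIV. v k))"

definition Omega :: "(real \<Rightarrow> real) \<Rightarrow> (real \<Rightarrow> real) \<Rightarrow> real \<Rightarrow> real^3^3" where
  "Omega \<theta> \<phi> s = vector [vector [0, \<theta> s, 0],
                         vector [- \<theta> s, 0, \<phi> s],
                         vector [0, - \<phi> s, 0]]"

definition solves_frame_equation ::
  "real set \<Rightarrow> (real \<Rightarrow> real^3^3) \<Rightarrow> (real \<Rightarrow> real^3^3) \<Rightarrow> bool" where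
  "solves_frame_equation I \<Omega> G \<longleftrightarrow>
     (\<forall>s \<in> I. invertible (precise_rep G s)) \<and>
     is_matrix_times_measure I (\<lambda>s. - matrix_inv (transpose (precise_rep G s)))
       (deriv_measure I \<Omega>) (deriv_measure I G)"


section \<open>Total absolute torsion\<close>

text \<open>A \<open>C\<^sup>1\<close> curve on the closed interval, parameterized by arc length.\<close>

definition unit_speed_C1 :: "real \<Rightarrow> real \<Rightarrow> (real \<Rightarrow> 'a::real_normed_vector) \<Rightarrow> bool" where
  "unit_speed_C1 a b c \<longleftrightarrow>
     (\<exists>c'. continuous_on {a..b} c' \<and>
        (\<forall>s\<in>{a..b}. (c has_vector_derivative c' s) (at s within {a..b}) \<and> norm (c' s) = 1))"

definition line_angle :: "'a::real_inner \<Rightarrow> 'a \<Rightarrow> real" where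
  "line_angle x y = arccos (\<bar>x \<bullet> y\<bar> / (norm x * norm y))"

text \<open>
  Polygonal curves are given by their list of vertices \<open>v\<^sub>0, \<dots>, v\<^sub>n\<close>; so \<open>n = length vs - 1\<close>, and
  \<open>seg vs i\<close> with \<open>1 \<le> i \<le> n\<close> is the \<open>i\<close>-th segment vector.
\<close>

definition seg :: "'a::real_vector list \<Rightarrow> nat \<Rightarrow> 'a" where
  "seg vs i = vs ! i - vs ! (i - 1)"

definition admissible_polygon :: "(real^3) list \<Rightarrow> bool" where
  "admissible_polygon vs \<longleftrightarrow>
     (\<forall>i\<in>{1..length vs - 1}. seg vs i \<noteq> 0) \<and>
     (\<forall>i\<in>{1..length vs - 2}. cross3 (seg vs i) (seg vs (i + 1)) \<noteq> 0)"

text \<open>For \<open>n < 3\<close> the sum is empty.\<close>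

definition TAT_polygon :: "(real^3) list \<Rightarrow> real" where
  "TAT_polygon vs =
     (\<Sum>i = 2..length vs - 2.
        line_angle (cross3 (seg vs (i - 1)) (seg vs i)) (cross3 (seg vs i) (seg vs (i + 1))))"

text \<open>
  Removes the vertices at which the polygonal curve passes straight through (or does not move).
  The curve traced is unchanged; this is the usual normalisation under which consecutive segments
  may be assumed not to be aligned.
\<close>

fun straighten :: "'a::real_vector list \<Rightarrow> 'a list" where
  "straighten (u # v # w # vs) =
     (if v \<in> closed_segment u w then straighten (u # w # vs) else u # straighten (v # w # vs))"
| "straighten vs = vs"

definition subdivision :: "real \<Rightarrow> real \<Rightarrow> real list \<Rightarrow> bool" where
  "subdivision a b ss \<longleftrightarrow> ss \<noteq> [] \<and> hd ss = a \<and> last ss = b \<and> sorted_wrt (<) ss"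

definition mesh :: "(real \<Rightarrow> 'a::metric_space) \<Rightarrow> real list \<Rightarrow> real" where
  "mesh c ss = Max {diameter (c ` {ss ! i..ss ! Suc i}) | i. Suc i < length ss}"

text \<open>
  A polygonal curve inscribed in \<open>c\<close> has vertices \<open>map c ss\<close> for a subdivision \<open>ss\<close> of the parameter
  interval (so the end points of \<open>c\<close> are vertices).  Polygons with a backtracking pair of
  segments are excluded, as the geodesic arc between antipodal directions is undefined.
  The supremum is nondecreasing in \<open>\<epsilon>\<close>, so the limit always exists.
\<close>

definition TAT :: "real \<Rightarrow> real \<Rightarrow> (real \<Rightarrow> real^3) \<Rightarrow> ennreal" where
  "TAT a b c =
     Lim (at_right 0) (\<lambda>\<epsilon>::real.
       SUP ss \<in> {ss. subdivision a b ss \<and> admissible_polygon (straighten (map c ss)) \<and>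
                     mesh c ss < \<epsilon>}.
         ennreal (TAT_polygon (straighten (map c ss))))"

end

theory Submission
  imports Defs "HOL-Probability.Distribution_Functions"
begin

text \<open>
  Write \<open>t\<close>, \<open>n\<close>, \<open>b\<close> for the columns of \<open>G\<close>.  The frame equation says \<open>Dt = n D\<theta>\<close>,
  \<open>Dn = - t D\<theta> + b D\<phi>\<close> and \<open>Db = - n D\<phi>\<close>, so \<open>|Db| = |D\<phi>|\<close> because \<open>n\<close> has length one.
  Integrating by parts, the cross product of two consecutive chords of the curve, with end points at
  \<open>x < y < z\<close>, is the integral of \<open>b\<close> against \<open>D\<theta>\<close> with a piecewise linear hat weight on
  \<open>[x, z]\<close>, up to an error of higher order; in particular it does not vanish on fine polygons.
  The hat averages of consecutive triples are stochastically ordered, so the average of \<open>b\<close> moves by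
  at most the increase of the average of the distribution function of \<open>|D\<phi>|\<close>.  This telescopes and
  bounds the sum of the torsion angles by \<open>|D\<phi>|(I)\<close> without counting overlapping triples repeatedly.
  Conversely the unit normals of the osculating planes of a fine polygon are uniformly close to \<open>b\<close>, so
  they see the variation of \<open>b\<close> over any fixed coarse grid.
\<close>

text \<open>The measure D theta may be singular, so the area spanned by two consecutive chords has
  no lower bound by a power of the parameter gaps. The error of the cross product is therefore
  bounded by a multiple of the hat mass itself, with a factor (curvature) * (rotation) over the
  triple. Strict monotonicity of \<open>\<theta>\<close> makes this mass positive, and dividing by
  it leaves a nearly unit vector. The remaining factor is at most a small \<open>e\<close> times an
  additive interval function, so the errors add up to a multiple of \<open>e\<close>. Comparing each
  normal with b at a vertex instead would lose an amount of the order of |D phi| over every triple,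
  and the sum would give only a multiple of |D phi|(I). Such a comparison does suffice for the lower
  bound, where the number of coarse grid points is fixed before the polygon is refined. The torsion
  angle is one between unoriented lines.\<close>

section \<open>Signed measures and their integrals\<close>

text \<open>Only the difference of \<open>P\<close> and \<open>N\<close> is constrained outside \<open>I\<close>, where it vanishes.\<close>

definition decomposes :: "real set \<Rightarrow> (real set \<Rightarrow> real) \<Rightarrow> real measure \<Rightarrow> real measure \<Rightarrow> bool" where
  "decomposes I \<mu> P N \<longleftrightarrow>
     finite_borel_measure P \<and> finite_borel_measure N \<and>
     (\<forall>A\<in>sets borel. \<mu> (A \<inter> I) = measure P A - measure N A)"

lemma finite_borel_measureI:
  "finite_measure M \<Longrightarrow> sets M = sets borel \<Longrightarrow> finite_borel_measure M"
  by (simp add: finite_borel_measure_axioms_def finite_borel_measure_def)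

lemma finite_borel_measureD:
  assumes "finite_borel_measure M"
  shows "finite_measure M" "sets M = sets borel" "space M = UNIV"
  using assms by (simp_all add: finite_borel_measure_def finite_borel_measure_axioms_def
      finite_borel_measure.borel_UNIV)

text \<open>Writing P - N = P' - N' as P + N' = P' + N avoids subtraction, so the identity passes
  from indicators to all nonnegative measurable functions by the usual induction.\<close>

lemma nn_integral_sum_measures_eq:
  assumes S: "sets P = sets M" "sets N = sets M" "sets P' = sets M" "sets N' = sets M"
    and eq: "\<And>A. A \<in> sets M \<Longrightarrow> emeasure P A + emeasure N' A = emeasure P' A + emeasure N A"
    and f: "f \<in> borel_measurable M"
  shows "(\<integral>\<^sup>+x. f x \<partial>P) + (\<integral>\<^sup>+x. f x \<partial>N') = (\<integral>\<^sup>+x. f x \<partial>P') + (\<integral>\<^sup>+x. f x \<partial>N)"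
  using f
proof (induction rule: borel_measurable_induct)
  case (cong f g)
  have "space P = space M" "space N = space M" "space P' = space M" "space N' = space M"
    by (simp_all only: S[THEN sets_eq_imp_space_eq])
  with cong show ?case
    by (metis (mono_tags, lifting) nn_integral_cong)
next
  case (set A)
  then show ?case using eq S by simp
next
  case (mult u c)
  have "u \<in> borel_measurable P" "u \<in> borel_measurable N" "u \<in> borel_measurable P'" "u \<in> borel_measurable N'"
    using mult S by (auto cong: measurable_cong_sets)
  with mult show ?case
    by (simp add: nn_integral_cmult flip: distrib_left)
next
  case (add u v)
  have "u \<in> borel_measurable P" "u \<in> borel_measurable N" "u \<in> borel_measurable P'" "u \<in> borel_measurable N'"
    "v \<in> borel_measurable P" "v \<in> borel_measurable N" "v \<in> borel_measurable P'" "v \<in> borel_measurable N'"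
    using add S by (auto cong: measurable_cong_sets)
  with add show ?case
    by (simp add: nn_integral_add) (metis ab_semigroup_add_class.add_ac(1) add.commute)
next
  case (seq U)
  have m: "U i \<in> borel_measurable P" "U i \<in> borel_measurable N" "U i \<in> borel_measurable P'" "U i \<in> borel_measurable N'" for i
    using seq S by (auto cong: measurable_cong_sets)
  have inc: "incseq (\<lambda>i. \<integral>\<^sup>+x. U i x \<partial>Q)" for Q
    using \<open>incseq U\<close> by (auto simp: incseq_def le_fun_def intro!: nn_integral_mono)
  have *: "(\<integral>\<^sup>+x. (SUP i. U i x) \<partial>Q) = (SUP i. \<integral>\<^sup>+x. U i x \<partial>Q)" if "\<And>i. U i \<in> borel_measurable Q" for Q
    using nn_integral_monotone_convergence_SUP[OF \<open>incseq U\<close>, of Q] that by simp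
  have sup: "(SUP i. U i) = (\<lambda>x. SUP i. U i x)"
    by (rule ext) (simp add: image_comp)
  show ?case
    unfolding sup using m seq.IH by (simp add: * inc flip: ennreal_SUP_add)
qed

text \<open>This makes the signed integral independent of the chosen decomposition. The positive and
  negative parts of \<open>f\<close> are treated separately in the nonnegative extended
  reals.\<close>

lemma integral_diff_measures_eq:
  fixes f :: "real \<Rightarrow> real"
  assumes fin: "finite_borel_measure P" "finite_borel_measure N" "finite_borel_measure P'" "finite_borel_measure N'"
    and eq: "\<And>A. A \<in> sets borel \<Longrightarrow> measure P A - measure N A = measure P' A - measure N' A"
    and f: "integrable P f" "integrable N f" "integrable P' f" "integrable N' f"
  shows "(LINT x|P. f x) - (LINT x|N. f x) = (LINT x|P'. f x) - (LINT x|N'. f x)"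
proof -
  note F = fin[THEN finite_borel_measureD(1)] and S = fin[THEN finite_borel_measureD(2)]
  have e: "emeasure P A + emeasure N' A = emeasure P' A + emeasure N A" if "A \<in> sets borel" for A
    using eq[OF that] F
    by (simp add: finite_measure.emeasure_eq_measure flip: ennreal_plus)
  have fm: "f \<in> borel_measurable borel"
    using f(1) S(1) by (auto dest!: borel_measurable_integrable cong: measurable_cong_sets)
  have m: "(\<lambda>x. ennreal (f x)) \<in> borel_measurable borel" "(\<lambda>x. ennreal (- f x)) \<in> borel_measurable borel"
    using fm by measurable
  note E = nn_integral_sum_measures_eq[OF S(1,2,3,4) e m(1), simplified] nn_integral_sum_measures_eq[OF S(1,2,3,4) e m(2), simplified]
  have top: "(\<integral>\<^sup>+x. ennreal (f x) \<partial>Q) < top \<and> (\<integral>\<^sup>+x. ennreal (- f x) \<partial>Q) < top" if "integrable Q f" for Q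
    using that by (auto simp: real_integrable_def top.not_eq_extremum)
  \<comment> \<open>Finiteness matters here, since \<open>enn2real\<close> sends the top element to
    0 and is not additive there.\<close>
  have X: "enn2real a - enn2real b' - (enn2real a' - enn2real b) = 0"
    if "a + b = b' + a'" "a < top" "b < top" "a' < top" "b' < top" for a b a' b'
  proof -
    have "enn2real a + enn2real b = enn2real b' + enn2real a'"
      using that enn2real_plus by metis
    then show ?thesis by simp
  qed
  show ?thesis
    unfolding real_lebesgue_integral_def[OF f(1)] real_lebesgue_integral_def[OF f(2)]
      real_lebesgue_integral_def[OF f(3)] real_lebesgue_integral_def[OF f(4)]
    using X[OF E(1)] X[OF E(2)] top[OF f(1)] top[OF f(2)] top[OF f(3)] top[OF f(4)] by simp
qed

text \<open>Pushing both measures forward along the inclusion of \<open>I\<close> moves them to the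
  Borel sets of the whole line, where distribution functions and regularity are at hand.\<close>

lemma has_signed_integral_decomposes:
  assumes I: "I \<in> sets borel" and B: "B \<in> sets (restrict_space borel I)"
    and h: "has_signed_integral I \<mu> B f v"
  obtains P N where "decomposes I \<mu> P N" "set_integrable P B f" "set_integrable N B f"
    "v = (LINT x:B|P. f x) - (LINT x:B|N. f x)"
proof -
  from h obtain P N where PN: "finite_measure P" "sets P = sets (restrict_space borel I)"
    "finite_measure N" "sets N = sets (restrict_space borel I)"
    "\<forall>A \<in> sets (restrict_space borel I). \<mu> A = measure P A - measure N A"
    "set_integrable P B f" "set_integrable N B f"
    "v = (LINT x:B|P. f x) - (LINT x:B|N. f x)"
    unfolding has_signed_integral_def by blast
  have BI: "B \<subseteq> I" using B I by (auto simp: sets_restrict_space_iff)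
  define E where "E Q = distr Q borel (\<lambda>x::real. x)" for Q
  have sp: "space Q = I" if "sets Q = sets (restrict_space borel I)" for Q :: "real measure"
    using sets_eq_imp_space_eq[OF that] by (simp add: space_restrict_space)
  have E: "finite_borel_measure (E Q) \<and> (\<forall>A\<in>sets borel. measure (E Q) A = measure Q (A \<inter> I)) \<and>
       (set_integrable (E Q) B f) \<and> (LINT x:B|E Q. f x) = (LINT x:B|Q. f x)"
    if Q: "sets Q = sets (restrict_space borel I)" "finite_measure Q" "set_integrable Q B f" for Q
  proof -
    have idm: "(\<lambda>x. x) \<in> Q \<rightarrow>\<^sub>M borel"
      using Q(1) by (simp cong: measurable_cong_sets add: measurable_restrict_space1)
    have fm: "(\<lambda>x. indicator B x *\<^sub>R f x) \<in> borel_measurable borel"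
    proof -
      have "(\<lambda>x. indicator B x *\<^sub>R f x) \<in> borel_measurable (restrict_space borel I)"
        using Q unfolding set_integrable_def
        by (auto dest!: borel_measurable_integrable cong: measurable_cong_sets)
      then have "(\<lambda>x. indicator I x *\<^sub>R (indicator B x *\<^sub>R f x)) \<in> borel_measurable borel"
        using I by (subst (asm) borel_measurable_restrict_space_iff) auto
      also have "(\<lambda>x. indicator I x *\<^sub>R (indicator B x *\<^sub>R f x)) = (\<lambda>x. indicator B x *\<^sub>R f x)"
        using BI by (intro ext) (auto split: split_indicator)
      finally show ?thesis .
    qed
    have "finite_measure (E Q)"
      unfolding E_def using Q(2) idm by (rule finite_measure.finite_measure_distr)
    moreover have "sets (E Q) = sets borel" by (simp add: E_def)
    moreover have "measure (E Q) A = measure Q (A \<inter> I)" if "A \<in> sets borel" for A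
      unfolding E_def using measure_distr[OF idm that] sp[OF Q(1)] by simp
    moreover have "set_integrable (E Q) B f"
      using Q(3) fm unfolding set_integrable_def E_def by (subst integrable_distr_eq[OF idm]) auto
    moreover have "(LINT x:B|E Q. f x) = (LINT x:B|Q. f x)"
      unfolding set_lebesgue_integral_def E_def using fm by (subst integral_distr[OF idm]) auto
    ultimately show ?thesis by (auto intro: finite_borel_measureI)
  qed
  note EP = E[OF PN(2,1,6)] and EN = E[OF PN(4,3,7)]
  have "decomposes I \<mu> (E P) (E N)"
    unfolding decomposes_def using EP EN PN(5) I by (auto simp: sets_restrict_space_iff)
  with EP EN PN(8) show ?thesis by (intro that[of "E P" "E N"]) auto
qed

lemma has_signed_integral_eq:
  assumes I: "I \<in> sets borel" and B: "B \<in> sets (restrict_space borel I)"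
    and d: "decomposes I \<mu> P N" and h: "has_signed_integral I \<mu> B f v"
    and f: "set_integrable P B f" "set_integrable N B f"
  shows "v = (LINT x:B|P. f x) - (LINT x:B|N. f x)"
proof -
  obtain P' N' where *: "decomposes I \<mu> P' N'" "set_integrable P' B f" "set_integrable N' B f"
    "v = (LINT x:B|P'. f x) - (LINT x:B|N'. f x)"
    using has_signed_integral_decomposes[OF I B h] .
  show ?thesis
    unfolding *(4) set_lebesgue_integral_def
    using * d f unfolding decomposes_def set_integrable_def
    by (intro integral_diff_measures_eq) auto
qed

lemma set_integrable_bounded_continuous:
  fixes f :: "real \<Rightarrow> 'a::{banach, second_countable_topology}"
  assumes "finite_borel_measure P" and I: "I \<in> sets borel" and B: "B \<in> sets borel" "B \<subseteq> I"
    and "continuous_on I f" and bd: "\<And>x. x \<in> I \<Longrightarrow> norm (f x) \<le> C"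
  shows "set_integrable P B f"
proof -
  interpret finite_borel_measure P by fact
  have "(\<lambda>x. indicator I x *\<^sub>R f x) \<in> borel_measurable borel"
    using assms by (intro borel_measurable_continuous_on_indicator) auto
  then have "(\<lambda>x. indicator B x *\<^sub>R (indicator I x *\<^sub>R f x)) \<in> borel_measurable borel"
    using B by measurable
  moreover have "(\<lambda>x. indicator B x *\<^sub>R (indicator I x *\<^sub>R f x)) = (\<lambda>x. indicator B x *\<^sub>R f x)"
    using B by (intro ext) (auto split: split_indicator)
  ultimately have "(\<lambda>x. indicator B x *\<^sub>R f x) \<in> borel_measurable P"
    by (subst measurable_cong_sets[OF M_is_borel refl]) simp
  then show ?thesis unfolding set_integrable_def
  proof (rule integrable_const_bound[where B="\<bar>C\<bar>", rotated])
    show "AE x in P. norm (indicator B x *\<^sub>R f x) \<le> \<bar>C\<bar>"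
      using bd B by (intro AE_I2) (force simp: indicator_def)
  qed
qed

section \<open>Increments of a derivative measure from test functions\<close>

text \<open>
  A \<open>C\<^sup>1\<close> step from \<open>0\<close> to \<open>1\<close> on \<open>[0, 1]\<close>: differences of rescaled translates are test functions that
  converge pointwise to the indicator of a half-open interval.
\<close>

definition hat_ramp :: "real \<Rightarrow> real" where
  "hat_ramp z = 2 * (z * max 0 z) - 4 * ((z - 1/2) * max 0 (z - 1/2)) + 2 * ((z - 1) * max 0 (z - 1))"

text \<open>The tent on [0, 1] with height 2 and integral 1, the derivative of the step
  above.\<close>

definition hat_bump :: "real \<Rightarrow> real" where
  "hat_bump z = 4 * max 0 z - 8 * max 0 (z - 1/2) + 4 * max 0 (z - 1)"

lemma has_real_derivative_mult_max_0:
  "((\<lambda>z::real. z * max 0 z) has_real_derivative 2 * max 0 z) (at z)"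
proof -
  consider "z < 0" | "z = 0" | "z > 0" by linarith
  then show ?thesis
  proof cases
    case 1
    show ?thesis
      by (rule has_field_derivative_transform_within_open[where f="\<lambda>_. 0" and S="{..<0}"])
         (use 1 in \<open>auto intro!: derivative_eq_intros\<close>)
  next
    case 3
    show ?thesis
      by (rule has_field_derivative_transform_within_open[where f="\<lambda>z. z * z" and S="{0<..}"])
         (use 3 in \<open>auto intro!: derivative_eq_intros\<close>)
  next
    case 2
    have "((\<lambda>h::real. max 0 h) \<longlongrightarrow> max 0 0) (at 0)"
      by (intro tendsto_intros)
    moreover have "eventually (\<lambda>h. max 0 h = (h * max 0 h - 0 * max 0 0) / (h - 0)) (at (0::real))"
      by (auto simp: eventually_at intro!: exI[of _ 1])
    ultimately have "((\<lambda>h::real. (h * max 0 h - 0 * max 0 0) / (h - 0)) \<longlongrightarrow> max 0 0) (at 0)"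
      by (rule Lim_transform_eventually)
    with 2 show ?thesis by (simp add: has_field_derivative_iff)
  qed
qed

lemma hat_ramp_deriv: "(hat_ramp has_real_derivative hat_bump z) (at z)"
proof -
  note d = has_real_derivative_mult_max_0
  have "((\<lambda>z. (z - c) * max 0 (z - c)) has_real_derivative 2 * max 0 (z - c)) (at z)" for c :: real
  proof -
    have "((\<lambda>z. z - c) has_real_derivative 1) (at z)" by (auto intro!: derivative_eq_intros)
    from DERIV_chain2[where f="\<lambda>z. z * max 0 z" and g="\<lambda>z. z - c", OF d this] show ?thesis by simp
  qed
  note DERIV_add[OF DERIV_diff[OF DERIV_cmult[OF this[of 0]] DERIV_cmult[OF this[of "1/2"]]] DERIV_cmult[OF this[of 1]], of 2 4 2]
  then show ?thesis
    by (simp add: hat_ramp_def[abs_def] hat_bump_def algebra_simps)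
qed

lemma hat_ramp_simps: "z \<le> 0 \<Longrightarrow> hat_ramp z = 0" "1 \<le> z \<Longrightarrow> hat_ramp z = 1"
  by (auto simp: hat_ramp_def max_def algebra_simps power2_eq_square)

lemma hat_ramp_bounds: "0 \<le> hat_ramp z" "hat_ramp z \<le> 1"
proof -
  consider "z \<le> 0" | "0 \<le> z" "z \<le> 1/2" | "1/2 \<le> z" "z \<le> 1" | "1 \<le> z" by linarith
  then have "0 \<le> hat_ramp z \<and> hat_ramp z \<le> 1"
  proof cases
    case 2
    then have "hat_ramp z = 2 * z\<^sup>2" "z\<^sup>2 \<le> (1/2)\<^sup>2"
      using power_mono[of z "1/2" 2] by (auto simp: hat_ramp_def power2_eq_square)
    then show ?thesis by (simp add: power2_eq_square)
  next
    case 3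
    then have "hat_ramp z = 1 - 2 * (1 - z)\<^sup>2" "(1 - z)\<^sup>2 \<le> (1/2)\<^sup>2"
      by (simp add: hat_ramp_def power2_eq_square algebra_simps, intro power_mono) (use 3 in auto)
    then show ?thesis by (simp add: power2_eq_square)
  qed (auto simp: hat_ramp_simps)
  then show "0 \<le> hat_ramp z" "hat_ramp z \<le> 1" by auto
qed

lemma hat_bump_simps: "z \<le> 0 \<Longrightarrow> hat_bump z = 0" "1 \<le> z \<Longrightarrow> hat_bump z = 0"
  by (auto simp: hat_bump_def max_def)

lemma hat_bump_nonneg: "0 \<le> hat_bump z"
  by (auto simp: hat_bump_def max_def)

lemma continuous_on_hat_bump: "continuous_on S hat_bump"
  unfolding hat_bump_def[abs_def] by (intro continuous_intros)

text \<open>The rescaled bump is a one-sided approximate identity: it lives on [x, x + h] and has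
  integral 1 because its primitive rises from 0 to 1 there. The average thus deviates from
  \<open>f x\<close> by at most the oscillation of \<open>f\<close> on this interval.\<close>

lemma mollified_value:
  fixes f :: "real \<Rightarrow> real"
  assumes "h > 0" and I: "{x..x+h} \<subseteq> I"
    and f: "continuous_on {x..x+h} f" and e: "\<And>s. s \<in> {x..x+h} \<Longrightarrow> \<bar>f s - f x\<bar> \<le> e"
  shows "set_integrable lborel I (\<lambda>s. f s * (hat_bump ((s - x) / h) / h))"
    and "\<bar>(LINT s:I|lborel. f s * (hat_bump ((s - x) / h) / h)) - f x\<bar> \<le> e"
proof -
  let ?r = "\<lambda>s. hat_bump ((s - x) / h) / h" and ?J = "{x..x+h}"
  have r0: "?r s = 0" if "s \<notin> ?J" for s
    using that \<open>h > 0\<close> by (auto simp: hat_bump_simps field_simps)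
  have ind: "indicator I s *\<^sub>R (f s * ?r s) = indicator ?J s *\<^sub>R (f s * ?r s)" for s
    using r0[of s] I by (auto split: split_indicator)
  have cr: "continuous_on ?J ?r"
    using \<open>h > 0\<close> by (auto intro!: continuous_intros continuous_on_compose2[OF continuous_on_hat_bump[of UNIV]])
  have si: "set_integrable lborel ?J g" if "continuous_on ?J g" for g :: "real \<Rightarrow> real"
    using that unfolding set_integrable_def by (intro borel_integrable_compact) auto
  have int1: "set_integrable lborel ?J (\<lambda>s. f s * ?r s)"
    by (intro si continuous_intros f cr)
  show "set_integrable lborel I (\<lambda>s. f s * ?r s)"
    using int1 unfolding set_integrable_def ind .
  have tot: "(LINT s:?J|lborel. ?r s) = 1"
  proof -
    have "(LINT s:?J|lborel. ?r s) = hat_ramp ((x + h - x) / h) - hat_ramp ((x - x) / h)"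
      unfolding set_lebesgue_integral_def
    proof (rule integral_FTC_atLeastAtMost)
      show "x \<le> x + h" using \<open>h > 0\<close> by simp
      show "((\<lambda>s. hat_ramp ((s - x) / h)) has_vector_derivative ?r s) (at s within ?J)" for s
        unfolding has_real_derivative_iff_has_vector_derivative[symmetric]
      proof -
        have "((\<lambda>s. (s - x) / h) has_real_derivative 1 / h) (at s within ?J)"
          using \<open>h > 0\<close> by (auto intro!: derivative_eq_intros)
        from DERIV_chain2[where f=hat_ramp, OF hat_ramp_deriv this]
        show "((\<lambda>s. hat_ramp ((s - x) / h)) has_real_derivative ?r s) (at s within ?J)" by simp
      qed
    qed (rule cr)
    also have "\<dots> = 1" using \<open>h > 0\<close> by (simp add: hat_ramp_simps)
    finally show ?thesis .
  qed
  have "(LINT s:I|lborel. f s * ?r s) - f x = (LINT s:?J|lborel. f s * ?r s) - f x * (LINT s:?J|lborel. ?r s)"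
    unfolding tot unfolding set_lebesgue_integral_def ind by simp
  also have "\<dots> = (LINT s:?J|lborel. f s * ?r s) - (LINT s:?J|lborel. f x * ?r s)" by simp
  also have "\<dots> = (LINT s:?J|lborel. f s * ?r s - f x * ?r s)"
    by (rule set_integral_diff(2)[symmetric]) (intro si continuous_intros f cr)+
  finally have eq: "(LINT s:I|lborel. f s * ?r s) - f x = (LINT s:?J|lborel. f s * ?r s - f x * ?r s)" .
  have "\<bar>LINT s:?J|lborel. f s * ?r s - f x * ?r s\<bar> \<le> (LINT s:?J|lborel. e * ?r s)"
  proof -
    have "\<bar>LINT s:?J|lborel. f s * ?r s - f x * ?r s\<bar> \<le> (LINT s:?J|lborel. \<bar>f s * ?r s - f x * ?r s\<bar>)"
    proof -
      have "set_integrable lborel ?J (\<lambda>s. f s * ?r s - f x * ?r s)"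
        by (intro si continuous_intros f cr)
      from set_integral_norm_bound[OF this] show ?thesis by simp
    qed
    also have "\<dots> \<le> (LINT s:?J|lborel. e * ?r s)"
    proof (rule set_integral_mono)
      fix s assume s: "s \<in> ?J"
      have "\<bar>f s * ?r s - f x * ?r s\<bar> = \<bar>f s - f x\<bar> * ?r s"
        using hat_bump_nonneg[of "(s - x) / h"] \<open>h > 0\<close> by (simp add: abs_mult flip: left_diff_distrib diff_divide_distrib)
      also have "\<dots> \<le> e * ?r s"
        using hat_bump_nonneg[of "(s - x) / h"] \<open>h > 0\<close> e[OF s] by (intro mult_right_mono) auto
      finally show "\<bar>f s * ?r s - f x * ?r s\<bar> \<le> e * ?r s" .
    qed (intro si continuous_intros f cr)+
    finally show ?thesis .
  qed
  also have "\<dots> = e" using tot by simp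
  finally show "\<bar>(LINT s:I|lborel. f s * ?r s) - f x\<bar> \<le> e" unfolding eq .
qed

text \<open>Pass to the limit in the test equation: the measure side converges by dominated
  convergence, and on the other side the two bumps recover the values of \<open>f\<close> at
  \<open>y\<close> and \<open>x\<close> by continuity.\<close>

lemma deriv_measure_Ioc_real:
  fixes f :: "real \<Rightarrow> real"
  assumes f: "continuous_on {0<..<L} f" and xy: "0 < x" "x \<le> y" "y < L"
    and d: "decomposes {0<..<L} \<mu> P N"
    and test: "\<And>\<psi>. test_function {0<..<L} \<psi> \<Longrightarrow>
      has_signed_integral {0<..<L} \<mu> {0<..<L} \<psi> (- (LINT x:{0<..<L}|lborel. f x * deriv \<psi> x))"
  shows "\<mu> {x<..y} = f y - f x"
proof -
  let ?I = "{0<..<L}"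
  \<comment> \<open>The denominators start at 2, so y + h k < L and the supports stay compactly
    inside the open interval.\<close>
  define h where "h k = (L - y) / (real k + 2)" for k
  have h: "h k > 0" "x + h k < L" "y + h k < L" for k
  proof -
    show "h k > 0" using xy by (simp add: h_def)
    have "(L - y) * 1 < (L - y) * (real k + 2)" using xy by (intro mult_strict_left_mono) auto
    then have "h k < L - y" by (simp add: h_def divide_less_eq)
    then show "x + h k < L" "y + h k < L" using xy by auto
  qed
  have h0: "h \<longlonglongrightarrow> 0" unfolding h_def by real_asymp
  define \<psi> where "\<psi> k s = hat_ramp ((s - x) / h k) - hat_ramp ((s - y) / h k)" for k s
  define b where "b k z s = hat_bump ((s - z) / h k) / h k" for k z s
  have der: "(\<psi> k has_real_derivative b k x s - b k y s) (at s)" for k s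
  proof -
    have *: "((\<lambda>s. (s - z) / h k) has_real_derivative 1 / h k) (at s)" for z
      using h(1)[of k] by (auto intro!: derivative_eq_intros)
    show ?thesis unfolding \<psi>_def[abs_def] b_def
      using DERIV_diff[OF DERIV_chain2[where f=hat_ramp, OF hat_ramp_deriv *[of x]]
          DERIV_chain2[where f=hat_ramp, OF hat_ramp_deriv *[of y]]] by simp
  qed
  have cb: "continuous_on S (b k z)" for S k z
    unfolding b_def[abs_def] using h(1)[of k]
    by (auto intro!: continuous_intros continuous_on_compose2[OF continuous_on_hat_bump[of UNIV]])
  have supp: "{s. \<psi> k s \<noteq> 0} \<subseteq> {x..y + h k}" for k
  proof
    fix s assume s: "s \<in> {s. \<psi> k s \<noteq> 0}"
    have "s \<ge> x"
    proof (rule ccontr)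
      assume "\<not> s \<ge> x"
      then have "(s - x) / h k \<le> 0" "(s - y) / h k \<le> 0" using h(1)[of k] xy by (auto simp: field_simps)
      with s show False by (simp add: \<psi>_def hat_ramp_simps)
    qed
    moreover have "s \<le> y + h k"
    proof (rule ccontr)
      assume "\<not> s \<le> y + h k"
      then have "(s - x) / h k \<ge> 1" "(s - y) / h k \<ge> 1" using h(1)[of k] xy by (auto simp: field_simps)
      with s show False by (simp add: \<psi>_def hat_ramp_simps)
    qed
    ultimately show "s \<in> {x..y + h k}" by simp
  qed
  have tf: "test_function ?I (\<psi> k)" for k
  proof -
    have cl: "closure {s. \<psi> k s \<noteq> 0} \<subseteq> {x..y + h k}"
      using supp by (intro closure_minimal) auto
    then have "bounded {s. \<psi> k s \<noteq> 0}" using supp[of k] bounded_subset bounded_closed_interval by blast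
    moreover have "\<psi> k C1_differentiable_on UNIV"
      unfolding C1_differentiable_on_def using der[of k] cb[of UNIV k]
      by (auto simp: has_real_derivative_iff_has_vector_derivative intro!: exI[of _ "\<lambda>s. b k x s - b k y s"] continuous_intros)
    ultimately show ?thesis
      using cl h(3)[of k] xy unfolding test_function_def by auto
  qed
  have cpsi: "continuous_on S (\<psi> k)" for S k
    using der[of k] by (meson DERIV_isCont continuous_at_imp_continuous_on)
  have bpsi: "\<bar>\<psi> k s\<bar> \<le> 1" for k s
    unfolding \<psi>_def using hat_ramp_bounds[of "(s - x) / h k"] hat_ramp_bounds[of "(s - y) / h k"] by auto
  have fb: "finite_borel_measure P" "finite_borel_measure N" using d by (auto simp: decomposes_def)
  have sip: "set_integrable Q ?I (\<psi> k)" if "finite_borel_measure Q" for Q k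
    using that bpsi[of k] by (intro set_integrable_bounded_continuous[where C=1 and I=UNIV] cpsi) auto
  have v: "- (LINT s:?I|lborel. f s * deriv (\<psi> k) s) = (LINT s:?I|P. \<psi> k s) - (LINT s:?I|N. \<psi> k s)" for k
    by (rule has_signed_integral_eq[OF _ _ d test[OF tf]]) (auto intro!: sip fb simp: sets_restrict_space_iff)
  have lim_mu: "(\<lambda>k. LINT s:?I|Q. \<psi> k s) \<longlonglongrightarrow> measure Q {x<..y}" if Q: "finite_borel_measure Q" for Q
  proof -
    interpret Q: finite_borel_measure Q by fact
    have "(\<lambda>k. LINT s|Q. indicator ?I s *\<^sub>R \<psi> k s) \<longlonglongrightarrow> (LINT s|Q. indicator {x<..y} s)"
    proof (rule integral_dominated_convergence[where w="\<lambda>_. 1"])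
      show "AE s in Q. (\<lambda>k. indicator ?I s *\<^sub>R \<psi> k s) \<longlonglongrightarrow> indicator {x<..y} s"
      proof (rule AE_I2)
        fix s
        have ev: "\<forall>\<^sub>F k in sequentially. h k < e" if "e > 0" for e
          using order_tendstoD(2)[OF h0 that] .
        consider "s \<le> x" | "x < s" "s \<le> y" | "y < s" by linarith
        then have "\<forall>\<^sub>F k in sequentially. \<psi> k s = indicator {x<..y} s"
        proof cases
          case 1
          then have "(s - x) / h k \<le> 0" "(s - y) / h k \<le> 0" for k
            using h(1)[of k] xy by (auto simp: field_simps)
          then show ?thesis using 1 by (simp add: \<psi>_def hat_ramp_simps)
        next
          case 2
          have "\<forall>\<^sub>F k in sequentially. h k < s - x" using ev 2 by simp
          then show ?thesis
          proof eventually_elim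
            case (elim k)
            then have "(s - x) / h k \<ge> 1" "(s - y) / h k \<le> 0"
              using h(1)[of k] 2 by (auto simp: field_simps)
            then show ?case using 2 by (simp add: \<psi>_def hat_ramp_simps)
          qed
        next
          case 3
          have "\<forall>\<^sub>F k in sequentially. h k < s - y" using ev 3 by simp
          then show ?thesis
          proof eventually_elim
            case (elim k)
            then have "(s - x) / h k \<ge> 1" "(s - y) / h k \<ge> 1"
              using h(1)[of k] 3 xy by (auto simp: field_simps)
            then show ?case using 3 by (simp add: \<psi>_def hat_ramp_simps)
          qed
        qed
        then have "\<forall>\<^sub>F k in sequentially. indicator {x<..y} s = indicator ?I s *\<^sub>R \<psi> k s"
          by (rule eventually_mono) (use xy in \<open>auto split: split_indicator\<close>)
        then show "(\<lambda>k. indicator ?I s *\<^sub>R \<psi> k s) \<longlonglongrightarrow> indicator {x<..y} s"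
          by (rule Lim_transform_eventually[OF tendsto_const])
      qed
      show "AE s in Q. norm (indicator ?I s *\<^sub>R \<psi> k s) \<le> 1" for k
        using bpsi[of k] by (intro AE_I2) (auto split: split_indicator)
      show "(\<lambda>s. indicator ?I s *\<^sub>R \<psi> k s) \<in> borel_measurable Q" for k
        using sip[OF Q, of k] by (auto simp: set_integrable_def)
    qed (auto simp: Q.M_is_borel intro!: borel_measurable_indicator)
    then show ?thesis by (simp add: set_lebesgue_integral_def Q.M_is_borel)
  qed
  have R: "(\<lambda>k. - (LINT s:?I|lborel. f s * deriv (\<psi> k) s)) \<longlonglongrightarrow> measure P {x<..y} - measure N {x<..y}"
    unfolding v by (intro tendsto_intros lim_mu fb)
  have mol: "(\<lambda>k. LINT s:?I|lborel. f s * b k z s) \<longlonglongrightarrow> f z \<and>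
      (\<forall>k. set_integrable lborel ?I (\<lambda>s. f s * b k z s))" if z: "0 < z" "z \<le> y" for z
  proof (intro conjI allI)
    have sub: "{z..z + h k} \<subseteq> ?I" for k using z h(3)[of k] by auto
    have cz: "continuous_on {z..z + h k} f" for k
      using f sub continuous_on_subset by blast
    show "set_integrable lborel ?I (\<lambda>s. f s * b k z s)" for k
    proof -
      have "bdd_above ((\<lambda>s. \<bar>f s - f z\<bar>) ` {z..z + h k})"
        by (intro bounded_imp_bdd_above compact_imp_bounded compact_continuous_image continuous_intros cz) auto
      then obtain e where "\<And>s. s \<in> {z..z + h k} \<Longrightarrow> \<bar>f s - f z\<bar> \<le> e"
        unfolding bdd_above_def by blast
      from mollified_value(1)[OF h(1) sub cz this] show ?thesis unfolding b_def by simp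
    qed
    show "(\<lambda>k. LINT s:?I|lborel. f s * b k z s) \<longlonglongrightarrow> f z"
    proof (rule LIMSEQ_I)
      fix e :: real assume "e > 0"
      have "isCont f z" using f z xy by (auto simp: continuous_on_eq_continuous_at)
      then obtain \<delta> where \<delta>: "\<delta> > 0" "\<And>s. \<bar>s - z\<bar> < \<delta> \<Longrightarrow> \<bar>f s - f z\<bar> < e/2"
        using \<open>e > 0\<close> unfolding continuous_at_eps_delta dist_real_def by (metis half_gt_zero)
      have "\<forall>\<^sub>F k in sequentially. h k < \<delta>" using order_tendstoD(2)[OF h0 \<delta>(1)] .
      then obtain K where K: "\<And>k. k \<ge> K \<Longrightarrow> h k < \<delta>" by (auto simp: eventually_sequentially)
      show "\<exists>K. \<forall>k\<ge>K. norm ((LINT s:?I|lborel. f s * b k z s) - f z) < e"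
      proof (intro exI allI impI)
        fix k assume k: "k \<ge> K"
        have "\<bar>(LINT s:?I|lborel. f s * (hat_bump ((s - z) / h k) / h k)) - f z\<bar> \<le> e/2"
          using \<delta>(2) K[OF k] by (intro mollified_value(2)[OF h(1) sub cz]) (force simp: less_imp_le)
        then show "norm ((LINT s:?I|lborel. f s * b k z s) - f z) < e"
          using \<open>e > 0\<close> unfolding b_def by simp
      qed
    qed
  qed
  have "- (LINT s:?I|lborel. f s * deriv (\<psi> k) s)
        = (LINT s:?I|lborel. f s * b k y s) - (LINT s:?I|lborel. f s * b k x s)" for k
  proof -
    have "deriv (\<psi> k) s = b k x s - b k y s" for s using der DERIV_imp_deriv by blast
    then have "(LINT s:?I|lborel. f s * deriv (\<psi> k) s) = (LINT s:?I|lborel. f s * b k x s - f s * b k y s)"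
      by (simp add: right_diff_distrib)
    also have "\<dots> = (LINT s:?I|lborel. f s * b k x s) - (LINT s:?I|lborel. f s * b k y s)"
      using mol xy by (intro set_integral_diff(2)) auto
    finally show ?thesis by simp
  qed
  moreover have "(\<lambda>k. (LINT s:?I|lborel. f s * b k y s) - (LINT s:?I|lborel. f s * b k x s)) \<longlonglongrightarrow> f y - f x"
    using mol xy by (intro tendsto_diff) auto
  ultimately have "measure P {x<..y} - measure N {x<..y} = f y - f x"
    using R LIMSEQ_unique by force
  moreover have "\<mu> ({x<..y} \<inter> ?I) = measure P {x<..y} - measure N {x<..y}"
    using d unfolding decomposes_def by auto
  moreover have "{x<..y} \<inter> ?I = {x<..y}" using xy by auto
  ultimately show ?thesis by simp
qed

section \<open>Distributional derivatives of continuous functions\<close>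

lemma sets_restrict_Ioo: "A \<in> sets (restrict_space borel {a<..<b}) \<longleftrightarrow> A \<in> sets borel \<and> A \<subseteq> {a<..<b::real}"
  by (auto simp: sets_restrict_space_iff)

lemma vector_measure_on_empty: "vector_measure_on I \<mu> \<Longrightarrow> \<mu> {} = 0"
proof -
  assume v: "vector_measure_on I \<mu>"
  have "(\<lambda>n::nat. \<mu> {}) sums \<mu> (\<Union>n::nat. {})"
    using v[unfolded vector_measure_on_def, THEN conjunct1, rule_format, of "\<lambda>_. {}"]
    by (auto simp: disjoint_family_on_def)
  then have "(\<lambda>n::nat. \<mu> {}) \<longlonglongrightarrow> 0" by (intro summable_LIMSEQ_zero) (auto simp: sums_iff)
  then show ?thesis using LIMSEQ_unique tendsto_const by blast
qed

lemma vector_measure_on_sums: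
  assumes "vector_measure_on I \<mu>" "\<And>n. B n \<in> sets (restrict_space borel I)" "disjoint_family B"
  shows "(\<lambda>n. \<mu> (B n)) sums \<mu> (\<Union>n. B n)"
  using assms unfolding vector_measure_on_def by (metis image_subsetI)

lemma vector_measure_on_finite_Union:
  fixes B :: "nat \<Rightarrow> real set"
  assumes v: "vector_measure_on I \<mu>" and B: "\<And>n. n < k \<Longrightarrow> B n \<in> sets (restrict_space borel I)"
    and d: "disjoint_family_on B {..<k}"
  shows "\<mu> (\<Union>n<k. B n) = (\<Sum>n<k. \<mu> (B n))"
proof -
  define C where "C n = (if n < k then B n else {})" for n
  have "(\<lambda>n. \<mu> (C n)) sums \<mu> (\<Union>n. C n)"
    using B d by (intro vector_measure_on_sums[OF v]) (auto simp: C_def disjoint_family_on_def)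
  moreover have "(\<lambda>n. \<mu> (C n)) sums (\<Sum>n<k. \<mu> (C n))"
    by (intro sums_finite) (auto simp: C_def vector_measure_on_empty[OF v])
  moreover have "(\<Union>n. C n) = (\<Union>n<k. B n)" by (auto simp: C_def split: if_splits)
  ultimately show ?thesis using sums_unique2 by (force simp: C_def)
qed

lemma vector_measure_on_Un:
  assumes v: "vector_measure_on I \<mu>" and A: "A \<in> sets (restrict_space borel I)"
    and B: "B \<in> sets (restrict_space borel I)" and d: "A \<inter> B = {}"
  shows "\<mu> (A \<union> B) = \<mu> A + \<mu> B"
proof -
  have "\<mu> (\<Union>n<2::nat. (if n = 0 then A else B)) = (\<Sum>n<2::nat. \<mu> (if n = 0 then A else B))"
    using A B d by (intro vector_measure_on_finite_Union[OF v]) (auto simp: disjoint_family_on_def)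
  moreover have "(\<Union>n<2::nat. (if n = 0 then A else B)) = A \<union> B" by (auto simp: less_2_cases_iff)
  moreover have "(\<Sum>n<2::nat. \<mu> (if n = 0 then A else B)) = \<mu> A + \<mu> B" by (simp add: numeral_2_eq_2)
  ultimately show ?thesis by metis
qed

lemma vector_measure_on_Diff:
  assumes v: "vector_measure_on I \<mu>" and A: "A \<in> sets (restrict_space borel I)"
    and B: "B \<in> sets (restrict_space borel I)" and d: "A \<subseteq> B"
  shows "\<mu> (B - A) = \<mu> B - \<mu> A"
proof -
  have "\<mu> (A \<union> (B - A)) = \<mu> A + \<mu> (B - A)"
    using A B by (intro vector_measure_on_Un[OF v]) auto
  moreover have "A \<union> (B - A) = B" using d by auto
  ultimately show ?thesis by simp
qed

lemma vector_measure_on_incseq: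
  assumes v: "vector_measure_on I \<mu>" and A: "\<And>n. A n \<in> sets (restrict_space borel I)" and inc: "incseq A"
  shows "(\<lambda>n. \<mu> (A n)) \<longlonglongrightarrow> \<mu> (\<Union>n. A n)"
proof -
  have D: "disjointed A n \<in> sets (restrict_space borel I)" for n
    using sets.range_disjointed_sets[of A] A by auto
  have "(\<lambda>n. \<mu> (disjointed A n)) sums \<mu> (\<Union>n. disjointed A n)"
    by (intro vector_measure_on_sums[OF v] D disjoint_family_disjointed)
  then have "(\<lambda>n. \<Sum>i<Suc n. \<mu> (disjointed A i)) \<longlonglongrightarrow> \<mu> (\<Union>n. A n)"
    unfolding sums_def UN_disjointed_eq by (rule LIMSEQ_Suc)
  moreover have "(\<Sum>i<Suc n. \<mu> (disjointed A i)) = \<mu> (A n)" for n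
  proof -
    have "(\<Sum>i<Suc n. \<mu> (disjointed A i)) = \<mu> (\<Union>i<Suc n. disjointed A i)"
      using D disjoint_family_disjointed[of A]
      by (intro vector_measure_on_finite_Union[OF v, symmetric]) (auto simp: disjoint_family_on_def)
    also have "(\<Union>i<Suc n. disjointed A i) = (\<Union>i<Suc n. A i)"
      using finite_UN_disjointed_eq[of A "Suc n"] by (simp add: atLeast0LessThan)
    also have "\<dots> = A n" using inc by (auto simp: incseq_def lessThan_Suc_atMost)
    finally show ?thesis .
  qed
  ultimately show ?thesis by simp
qed

text \<open>An argument with an intersection-stable generator. The traces of half-open intervals on
  the open interval generate its Borel sets, but they may touch its end points, which the hypothesis
  does not reach; these are exhausted from inside.\<close>

lemma vector_measure_on_eqI:
  assumes v: "vector_measure_on {0<..<L} \<mu>" "vector_measure_on {0<..<L} \<nu>"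
    and eq: "\<And>x y. 0 < x \<Longrightarrow> x \<le> y \<Longrightarrow> y < L \<Longrightarrow> \<mu> {x<..y} = \<nu> {x<..y}"
  shows "\<mu> = \<nu>"
proof
  fix A
  let ?I = "{0<..<L}"
  define G where "G = (\<inter>) ?I ` range (\<lambda>(a, b). {a<..b::real})"
  have G: "sets (restrict_space borel ?I) = sigma_sets ?I G"
  proof -
    have "sets (borel :: real measure) = sigma_sets UNIV (range (\<lambda>(a, b). {a<..b::real}))"
      by (subst borel_sigma_sets_Ioc) (simp add: sets_measure_of)
    note e = this
    have "?I \<in> sigma_sets UNIV (range (\<lambda>(a, b). {a<..b::real}))"
      unfolding e[symmetric] by simp
    from sigma_sets_Int[OF this] show ?thesis unfolding sets_restrict_space G_def e by simp
  qed
  have Gsub: "X \<in> G \<Longrightarrow> X \<in> sets (restrict_space borel ?I)" for X using G by auto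
  have onG: "\<mu> X = \<nu> X" if XG: "X \<in> G" for X
  proof -
    obtain a b where X: "X = ?I \<inter> {a<..b}" using XG by (auto simp: G_def)
    \<comment> \<open>Staying 1/(n+1) away from both end points makes the hypothesis
      applicable.\<close>
    define x where "x n = max a (1 / (real n + 1))" for n
    define y where "y n = min b (L - 1 / (real n + 1))" for n
    have dec: "1 / (real m + 1) \<le> 1 / (real n + 1)" if "n \<le> m" for n m
      using that by (intro divide_left_mono) auto
    have lim: "\<forall>\<^sub>F n in sequentially. 1 / (real n + 1) < e" if "e > 0" for e
    proof -
      have "(\<lambda>n. 1 / (real n + 1)) \<longlonglongrightarrow> 0" by real_asymp
      from order_tendstoD(2)[OF this that] show ?thesis .
    qed
    have un: "(\<Union>n. {x n<..y n}) = X"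
    proof (rule set_eqI, rule iffI)
      fix z assume "z \<in> (\<Union>n. {x n<..y n})"
      then obtain n where n: "x n < z" "z \<le> y n" by auto
      have p: "0 < 1 / (real n + 1)" by simp
      from n have "a < z" "1 / (real n + 1) < z" "z \<le> b" "z \<le> L - 1 / (real n + 1)"
        by (auto simp: x_def y_def)
      moreover from this p have "0 < z" "z < L" by linarith+
      ultimately show "z \<in> X" by (simp add: X)
    next
      fix z assume "z \<in> X"
      then have z: "0 < z" "z < L" "a < z" "z \<le> b" by (auto simp: X)
      have "\<forall>\<^sub>F n in sequentially. 1 / (real n + 1) < z \<and> 1 / (real n + 1) < L - z"
        using z by (intro eventually_conj lim) auto
      then obtain n where "1 / (real n + 1) < z" "1 / (real n + 1) < L - z"
        by (auto simp: eventually_sequentially)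
      with z have "z \<in> {x n<..y n}" by (auto simp: x_def y_def)
      then show "z \<in> (\<Union>n. {x n<..y n})" by blast
    qed
    have inc: "incseq (\<lambda>n. {x n<..y n})"
    proof (rule incseq_SucI)
      fix n
      have "x (Suc n) \<le> x n" "y n \<le> y (Suc n)"
        using dec[of n "Suc n"] unfolding x_def y_def by linarith+
      then show "{x n<..y n} \<subseteq> {x (Suc n)<..y (Suc n)}" by auto
    qed
    have sub: "{x n<..y n} \<in> sets (restrict_space borel ?I)" for n
      using un unfolding sets_restrict_Ioo X by auto
    have "\<mu> {x n<..y n} = \<nu> {x n<..y n}" for n
    proof (cases "x n \<le> y n")
      case True
      have "0 < 1 / (real n + 1)" by simp
      then have "0 < x n" "y n < L" unfolding x_def y_def by linarith+
      with True show ?thesis by (intro eq)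
    next
      case False
      then show ?thesis using v by (simp add: vector_measure_on_empty)
    qed
    then show ?thesis
      using vector_measure_on_incseq[OF v(1) sub inc] vector_measure_on_incseq[OF v(2) sub inc]
      unfolding un by (simp add: LIMSEQ_unique)
  qed
  show "\<mu> A = \<nu> A"
  proof (cases "A \<in> sets (restrict_space borel ?I)")
    case False
    then show ?thesis using v by (simp add: vector_measure_on_def)
  next
    case True
    \<comment> \<open>The whole open interval is the trace of (0, L], hence itself a generator, as
      complements require.\<close>
    have IG: "?I \<in> G" unfolding G_def by (auto intro!: image_eqI[of _ _ "{0<..L}"])
    have "Int_stable G"
    proof (rule Int_stableI)
      fix X Y assume "X \<in> G" "Y \<in> G"
      then obtain a b a' b' where "X = ?I \<inter> {a<..b}" "Y = ?I \<inter> {a'<..b'}" by (auto simp: G_def)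
      then have "X \<inter> Y = ?I \<inter> {max a a'<..min b b'}" by auto
      moreover have "{max a a'<..min b b'} \<in> range (\<lambda>(a, b). {a<..b})"
        by (rule range_eqI[of _ _ "(max a a', min b b')"]) simp
      ultimately show "X \<inter> Y \<in> G" unfolding G_def by (rule image_eqI)
    qed
    moreover have "G \<subseteq> Pow ?I" by (auto simp: G_def)
    moreover have "A \<in> sigma_sets ?I G" using True G by simp
    ultimately show ?thesis
    proof (induction rule: sigma_sets_induct_disjoint)
      case (basic X)
      then show ?case by (rule onG)
    next
      case empty
      then show ?case using v by (simp add: vector_measure_on_empty)
    next
      case (compl X)
      have X1: "X \<in> sets (restrict_space borel ?I)"
        unfolding G by (rule compl(1))
      then have X: "X \<in> sets (restrict_space borel ?I)" "?I \<in> sets (restrict_space borel ?I)" "X \<subseteq> ?I"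
        by (simp_all add: sets_restrict_Ioo)
      show ?case
        using vector_measure_on_Diff[OF v(1) X] vector_measure_on_Diff[OF v(2) X] compl(2) onG[OF IG] by simp
    next
      case (union X)
      have X: "X n \<in> sets (restrict_space borel ?I)" for n
        unfolding G using union(2) by blast
      show ?case
        using vector_measure_on_sums[OF v(1) X union(1)] vector_measure_on_sums[OF v(2) X union(1)]
        unfolding union(3) by (rule sums_unique2)
    qed
  qed
qed

text \<open>The positive measures are hidden inside the signed integrals against test functions; the
  zero test function is enough to bring them out.\<close>

lemma is_deriv_measure_component:
  assumes "is_deriv_measure {0<..<L} u \<mu>" "e \<in> Basis"
  obtains P N where "decomposes {0<..<L} (\<lambda>B. \<mu> B \<bullet> e) P N"
proof -
  have "test_function {0<..<L} (\<lambda>_. 0)"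
    by (auto simp: test_function_def C1_differentiable_on_def intro!: exI[of _ "\<lambda>_. 0"])
  with assms have "has_signed_integral {0<..<L} (\<lambda>B. \<mu> B \<bullet> e) {0<..<L} (\<lambda>_. 0)
      (- (LINT x:{0<..<L}|lborel. u x \<bullet> e * deriv (\<lambda>_. 0) x))"
    unfolding is_deriv_measure_def by blast
  from has_signed_integral_decomposes[OF _ _ this] show ?thesis
    using that by (auto simp: sets_restrict_Ioo)
qed

lemma deriv_measure_Ioc:
  fixes u :: "real \<Rightarrow> 'a::euclidean_space"
  assumes d: "is_deriv_measure {0<..<L} u \<mu>" and u: "continuous_on {0<..<L} u"
    and xy: "0 < x" "x \<le> y" "y < L"
  shows "\<mu> {x<..y} = u y - u x"
proof (rule euclidean_eqI)
  fix e :: 'a assume e: "e \<in> Basis"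
  obtain P N where "decomposes {0<..<L} (\<lambda>B. \<mu> B \<bullet> e) P N"
    using is_deriv_measure_component[OF d e] .
  then have "\<mu> {x<..y} \<bullet> e = u y \<bullet> e - u x \<bullet> e"
    using d e by (intro deriv_measure_Ioc_real[OF _ xy] continuous_intros u) (auto simp: is_deriv_measure_def)
  then show "\<mu> {x<..y} \<bullet> e = (u y - u x) \<bullet> e" by (simp add: inner_diff_left)
qed

text \<open>Since \<open>deriv_measure\<close> is a definite description, uniqueness has to be
  known. It holds because the increments of a continuous function determine the measure on half-open
  intervals.\<close>

lemma deriv_measure_eqI:
  fixes u :: "real \<Rightarrow> 'a::euclidean_space"
  assumes d: "is_deriv_measure {0<..<L} u \<mu>" and u: "continuous_on {0<..<L} u"
  shows "deriv_measure {0<..<L} u = \<mu>"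
  unfolding deriv_measure_def
proof (rule the_equality)
  fix \<nu> assume \<nu>: "is_deriv_measure {0<..<L} u \<nu>"
  show "\<nu> = \<mu>"
  proof (rule vector_measure_on_eqI)
    show "vector_measure_on {0<..<L} \<nu>" "vector_measure_on {0<..<L} \<mu>"
      using d \<nu> by (simp_all add: is_deriv_measure_def)
    show "\<nu> {x<..y} = \<mu> {x<..y}" if "0 < x" "x \<le> y" "y < L" for x y
      using deriv_measure_Ioc[OF d u that] deriv_measure_Ioc[OF \<nu> u that] by simp
  qed
qed fact

text \<open>The given positive measures may share mass. On a Hahn set \<open>Y\<close> the
  difference P - N is a positive measure, on the rest of \<open>I\<close> the difference N - P is,
  and these two differences are mutually singular.\<close>

lemma hahn_jordan_decomposition:
  assumes d: "decomposes I \<mu> P N" and I: "I \<in> sets borel"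
  obtains P0 N0 Y where "decomposes I \<mu> P0 N0" "Y \<in> sets borel" "Y \<subseteq> I"
    "\<And>A. A \<in> sets borel \<Longrightarrow> measure P0 A = \<mu> (A \<inter> Y)"
    "\<And>A. A \<in> sets borel \<Longrightarrow> measure N0 A = - \<mu> (A \<inter> I - Y)"
proof -
  have fb: "finite_borel_measure P" "finite_borel_measure N"
    and mu: "\<And>A. A \<in> sets borel \<Longrightarrow> \<mu> (A \<inter> I) = measure P A - measure N A"
    using d by (auto simp: decomposes_def)
  interpret P: finite_borel_measure P by fact
  interpret N: finite_borel_measure N by fact
  have mu': "A \<in> sets borel \<Longrightarrow> A \<subseteq> I \<Longrightarrow> \<mu> A = measure P A - measure N A" for A
    using mu[of A] by (simp add: Int_absorb2)
  obtain Y0 where Y0: "Y0 \<in> sets borel" "\<And>X. X \<in> sets borel \<Longrightarrow> X \<subseteq> Y0 \<Longrightarrow> emeasure N X \<le> emeasure P X"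
    "\<And>X. X \<in> sets borel \<Longrightarrow> X \<inter> Y0 = {} \<Longrightarrow> emeasure P X \<le> emeasure N X"
    using finite_unsigned_Hahn_decomposition[of P N] P.finite_measure_axioms N.finite_measure_axioms
    by (auto simp: P.M_is_borel N.M_is_borel)
  define Y where "Y = Y0 \<inter> I"
  have Yb[measurable]: "Y \<in> sets borel" using Y0 I by (auto simp: Y_def)
  have [measurable]: "I \<in> sets borel" by fact
  \<comment> \<open>A density by an indicator restricts the measure but keeps the whole line as its
    space.\<close>
  define R where "R M X = density M (indicator X)" for M :: "real measure" and X
  have R: "emeasure (R M X) A = emeasure M (A \<inter> X)" "sets (R M X) = sets borel" "finite_measure (R M X)"
    if "finite_borel_measure M" "A \<in> sets borel" "X \<in> sets borel" for M A X
  proof -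
    interpret finite_borel_measure M by fact
    have *: "emeasure (R M X) A = emeasure M (A \<inter> X)" if "A \<in> sets borel" for A
      unfolding R_def using that \<open>X \<in> sets borel\<close>
      by (subst emeasure_density) (auto simp: M_is_borel Int_commute simp flip: indicator_inter_arith intro!: borel_measurable_indicator)
    show "emeasure (R M X) A = emeasure M (A \<inter> X)" by (rule *) fact
    show "sets (R M X) = sets borel" by (simp add: R_def M_is_borel)
    show "finite_measure (R M X)"
      by (rule finite_measureI) (use *[of UNIV] in \<open>simp add: R_def borel_UNIV\<close>)
  qed
  have D: "finite_borel_measure (diff_measure (R M X) (R M' X)) \<and>
      (\<forall>A\<in>sets borel. measure (diff_measure (R M X) (R M' X)) A = measure M (A \<inter> X) - measure M' (A \<inter> X))"
    if M: "finite_borel_measure M" "finite_borel_measure M'" "X \<in> sets borel"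
      and le: "\<And>A. A \<in> sets borel \<Longrightarrow> A \<subseteq> X \<Longrightarrow> emeasure M' A \<le> emeasure M A" for M M' X
  proof -
    interpret M: finite_borel_measure M by fact
    interpret M': finite_borel_measure M' by fact
    have e: "emeasure (diff_measure (R M X) (R M' X)) A = emeasure M (A \<inter> X) - emeasure M' (A \<inter> X)"
      if "A \<in> sets borel" for A
      using that M le by (subst emeasure_diff_measure) (auto simp: R)
    have e': "emeasure (diff_measure (R M X) (R M' X)) A = ennreal (measure M (A \<inter> X) - measure M' (A \<inter> X))"
      if "A \<in> sets borel" for A
      by (simp add: e that M.emeasure_eq_measure M'.emeasure_eq_measure ennreal_minus)
    have s: "sets (diff_measure (R M X) (R M' X)) = sets borel" using R M by simp
    have "finite_measure (diff_measure (R M X) (R M' X))"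
      by (rule finite_measureI) (use e'[of UNIV] sets_eq_imp_space_eq[OF s] in simp)
    moreover have "measure (diff_measure (R M X) (R M' X)) A = measure M (A \<inter> X) - measure M' (A \<inter> X)"
      if "A \<in> sets borel" for A
    proof -
      have "measure M' (A \<inter> X) \<le> measure M (A \<inter> X)"
        using le[of "A \<inter> X"] that M(3) by (simp add: M.emeasure_eq_measure M'.emeasure_eq_measure)
      then show ?thesis unfolding measure_def[of "diff_measure _ _"] e'[OF that] by simp
    qed
    ultimately show ?thesis using s by (auto intro: finite_borel_measureI)
  qed
  define P0 where "P0 = diff_measure (R P Y) (R N Y)"
  define N0 where "N0 = diff_measure (R N (I - Y)) (R P (I - Y))"
  have P0: "finite_borel_measure P0" "\<And>A. A \<in> sets borel \<Longrightarrow> measure P0 A = measure P (A \<inter> Y) - measure N (A \<inter> Y)"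
    unfolding P0_def using D[OF fb, of Y] Y0 by (auto simp: Y_def)
  have N0: "finite_borel_measure N0" "\<And>A. A \<in> sets borel \<Longrightarrow> measure N0 A = measure N (A \<inter> (I - Y)) - measure P (A \<inter> (I - Y))"
  proof -
    have "X \<in> sets borel \<Longrightarrow> X \<subseteq> I - Y \<Longrightarrow> emeasure P X \<le> emeasure N X" for X
      by (rule Y0(3)) (auto simp: Y_def)
    then show "finite_borel_measure N0" "\<And>A. A \<in> sets borel \<Longrightarrow> measure N0 A = measure N (A \<inter> (I - Y)) - measure P (A \<inter> (I - Y))"
      unfolding N0_def using D[OF fb(2,1), of "I - Y"] by auto
  qed
  have p: "measure P0 A = \<mu> (A \<inter> Y)" if A[measurable]: "A \<in> sets borel" for A
  proof -
    have "A \<inter> Y \<in> sets borel" "A \<inter> Y \<subseteq> I" using A Yb by (auto simp: Y_def)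
    from mu'[OF this] P0(2)[OF A] show ?thesis by simp
  qed
  have n: "measure N0 A = - \<mu> (A \<inter> I - Y)" if A[measurable]: "A \<in> sets borel" for A
  proof -
    have "A \<inter> I - Y \<in> sets borel" "A \<inter> I - Y \<subseteq> I" by auto
    from mu'[OF this] N0(2)[OF A] show ?thesis by (simp add: Int_Diff)
  qed
  have "\<mu> (A \<inter> I) = measure P0 A - measure N0 A" if A[measurable]: "A \<in> sets borel" for A
  proof -
    have "\<mu> (A \<inter> I) = measure P (A \<inter> I) - measure N (A \<inter> I)" by (rule mu') auto
    moreover have "A \<inter> I = (A \<inter> Y) \<union> (A \<inter> I - Y)" by (auto simp: Y_def)
    then have "measure P (A \<inter> I) = measure P (A \<inter> Y) + measure P (A \<inter> I - Y)"
      "measure N (A \<inter> I) = measure N (A \<inter> Y) + measure N (A \<inter> I - Y)"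
      using P.finite_measure_Union[of "A \<inter> Y" "A \<inter> I - Y"] N.finite_measure_Union[of "A \<inter> Y" "A \<inter> I - Y"]
      by (auto simp: P.M_is_borel N.M_is_borel)
    ultimately show ?thesis using P0(2)[OF A] N0(2)[OF A] by (simp add: Int_Diff)
  qed
  then have dec: "decomposes I \<mu> P0 N0" using P0(1) N0(1) by (simp add: decomposes_def)
  have "Y \<subseteq> I" by (simp add: Y_def)
  from that[OF dec Yb this p n] show ?thesis .
qed

section \<open>Fine variation and hat averages\<close>

text \<open>The intersection with \<open>A\<close> serves to localise to complements of compact
  sets. The second conjunct orders the end points, which the induction step needs to split the
  interval.\<close>

lemma measure_Ioc_sum:
  assumes "finite_borel_measure M" "A \<in> sets borel" "\<And>k. k < n \<Longrightarrow> s k \<le> s (Suc k)"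
  shows "measure M ({s 0<..s n} \<inter> A) = (\<Sum>k<n. measure M ({s k<..s (Suc k)} \<inter> A)) \<and> s 0 \<le> s n"
  using assms(3)
proof (induction n)
  case 0
  then show ?case by simp
next
  case (Suc n)
  interpret finite_borel_measure M by fact
  have IH: "measure M ({s 0<..s n} \<inter> A) = (\<Sum>k<n. measure M ({s k<..s (Suc k)} \<inter> A))" "s 0 \<le> s n" "s n \<le> s (Suc n)"
    using Suc by auto
  then have "{s 0<..s (Suc n)} \<inter> A = ({s 0<..s n} \<inter> A) \<union> ({s n<..s (Suc n)} \<inter> A)" by auto
  then have "measure M ({s 0<..s (Suc n)} \<inter> A) = measure M ({s 0<..s n} \<inter> A) + measure M ({s n<..s (Suc n)} \<inter> A)"
    using assms(2) by (auto intro!: finite_measure_Union simp: M_is_borel)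
  with IH show ?case by simp
qed

lemma (in finite_borel_measure) measure_Ioc_Un:
  "x \<le> y \<Longrightarrow> y \<le> z \<Longrightarrow> measure M {x<..z} = measure M {x<..y} + measure M {y<..z}"
proof -
  assume "x \<le> y" "y \<le> z"
  then have "{x<..z} = {x<..y} \<union> {y<..z}" by auto
  then show ?thesis by (simp add: M_is_borel finite_measure_Union)
qed

text \<open>Without atoms the distribution function is continuous, hence uniformly continuous on
  [a, b].\<close>

lemma (in finite_borel_measure) uniformly_small_Ioc:
  assumes "\<And>x. measure M {x} = 0" "e > 0"
  obtains \<delta> where "\<delta> > 0" "\<And>x y. a \<le> x \<Longrightarrow> x \<le> y \<Longrightarrow> y \<le> b \<Longrightarrow> y - x < \<delta> \<Longrightarrow> measure M {x<..y} < e"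
proof -
  have "continuous_on {a..b} (cdf M)"
    using assms(1) by (intro continuous_at_imp_continuous_on) (simp add: isCont_cdf)
  then have "uniformly_continuous_on {a..b} (cdf M)" by (rule compact_uniformly_continuous) simp
  then obtain \<delta> where \<delta>: "\<delta> > 0" "\<And>x y. x \<in> {a..b} \<Longrightarrow> y \<in> {a..b} \<Longrightarrow> dist y x < \<delta> \<Longrightarrow> dist (cdf M y) (cdf M x) < e"
    unfolding uniformly_continuous_on_def using assms(2) by metis
  show ?thesis
  proof (rule that[OF \<delta>(1)])
    fix x y assume xy: "a \<le> x" "x \<le> y" "y \<le> b" "y - x < \<delta>"
    show "measure M {x<..y} < e"
    proof (cases "x = y")
      case False
      then have "measure M {x<..y} = cdf M y - cdf M x" using xy by (simp add: cdf_diff_eq)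
      also have "\<dots> < e" using \<delta>(2)[of x y] xy by (auto simp: dist_real_def)
      finally show ?thesis .
    qed (use assms in simp)
  qed
qed

lemma (in finite_borel_measure) compact_inner_approx:
  assumes "A \<in> sets borel" "e > 0"
  obtains K where "compact K" "K \<subseteq> A" "measure M (A - K) < e"
proof -
  have "emeasure M A = (SUP K \<in> {K. K \<subseteq> A \<and> compact K}. emeasure M K)"
    using assms by (intro inner_regular) (auto simp: M_is_borel)
  moreover have "\<exists>K. K \<subseteq> A \<and> compact K \<and> measure M A - e < measure M K"
  proof (cases "measure M A - e < 0")
    \<comment> \<open>A negative bound would be truncated to 0 by \<open>ennreal\<close>, so this
      case is served by the empty set.\<close>
    case True
    then show ?thesis by (intro exI[of _ "{}"]) auto
  next
    case False
    then have "ennreal (measure M A - e) < emeasure M A"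
      using assms by (simp add: emeasure_eq_measure ennreal_less_iff)
    with calculation obtain K where "K \<subseteq> A" "compact K" "ennreal (measure M A - e) < emeasure M K"
      by (auto simp: less_SUP_iff)
    then show ?thesis using False by (auto simp: emeasure_eq_measure ennreal_less_iff)
  qed
  then obtain K where K: "K \<subseteq> A" "compact K" "measure M A - e < measure M K" by blast
  moreover have "measure M (A - K) = measure M A - measure M K"
    using K assms by (intro finite_measure_Diff) (auto simp: M_is_borel compact_imp_closed)
  ultimately show ?thesis using that by auto
qed

text \<open>
  \<open>P\<close> and \<open>N\<close> live up to \<open>e\<close> on disjoint compact sets, and an interval shorter than the distance of
  these sets meets at most one of them.
\<close>

lemma singular_measures_fine_variation:
  assumes P: "finite_borel_measure P" and N: "finite_borel_measure N"
    and Y: "Y \<in> sets borel" "measure P (- Y) = 0" "measure N Y = 0" and "e > 0"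
  shows "\<exists>\<delta>>0. \<forall>s n. (\<forall>k<n. s k \<le> s (Suc k) \<and> s (Suc k) - s k < \<delta>) \<longrightarrow>
       measure P {s 0<..s n} + measure N {s 0<..s n}
         \<le> (\<Sum>k<n. \<bar>measure P {s k<..s (Suc k)} - measure N {s k<..s (Suc k)}\<bar>) + e"
proof -
  interpret P: finite_borel_measure P by fact
  interpret N: finite_borel_measure N by fact
  \<comment> \<open>A quarter of \<open>e\<close>, since the masses off the two compact sets both
    enter the final estimate twice.\<close>
  obtain K1 where K1: "compact K1" "K1 \<subseteq> Y" "measure P (Y - K1) < e/4"
    using P.compact_inner_approx[of Y "e/4"] Y \<open>e > 0\<close> by auto
  obtain K2 where K2: "compact K2" "K2 \<subseteq> - Y" "measure N (- Y - K2) < e/4"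
    using N.compact_inner_approx[of "- Y" "e/4"] Y \<open>e > 0\<close> by (auto simp: borel_comp)
  have b: "K1 \<in> sets borel" "K2 \<in> sets borel" using K1 K2 by (auto simp: compact_imp_closed)
  have c1: "measure P (- K1) < e/4"
  proof -
    have "- K1 = (Y - K1) \<union> (- Y)" using K1 by auto
    then have "measure P (- K1) \<le> measure P (Y - K1) + measure P (- Y)"
      using measure_Un_le[of "Y - K1" P "- Y"] Y b by (simp add: P.M_is_borel borel_comp)
    then show ?thesis using K1 Y by simp
  qed
  have c2: "measure N (- K2) < e/4"
  proof -
    have "- K2 = (- Y - K2) \<union> Y" using K2 by auto
    then have "measure N (- K2) \<le> measure N (- Y - K2) + measure N Y"
      using measure_Un_le[of "- Y - K2" N Y] Y b by (simp add: N.M_is_borel borel_comp sets.Diff)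
    then show ?thesis using K2 Y by simp
  qed
  have "K1 \<inter> K2 = {}" using K1 K2 by auto
  then obtain d where d: "d > 0" "\<And>x y. x \<in> K1 \<Longrightarrow> y \<in> K2 \<Longrightarrow> d \<le> dist x y"
    using separate_compact_closed[OF K1(1) compact_imp_closed[OF K2(1)]] by blast
  show ?thesis
  proof (intro exI conjI allI impI)
    fix s :: "nat \<Rightarrow> real" and n assume "\<forall>k<n. s k \<le> s (Suc k) \<and> s (Suc k) - s k < d"
    then have s: "\<And>k. k < n \<Longrightarrow> s k \<le> s (Suc k) \<and> s (Suc k) - s k < d" by blast
    let ?J = "\<lambda>k. {s k<..s (Suc k)}"
    \<comment> \<open>For masses p and n one has p + n = |p - n| + 2 min p n. An interval that
      misses one of the compact sets carries all of the corresponding measure off that set, which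
      bounds the minimum.\<close>
    have each: "measure P (?J k) + measure N (?J k) \<le> \<bar>measure P (?J k) - measure N (?J k)\<bar>
        + 2 * measure P (?J k \<inter> - K1) + 2 * measure N (?J k \<inter> - K2)" if k: "k < n" for k
    proof (cases "?J k \<inter> K1 = {}")
      case True
      then have "?J k \<inter> - K1 = ?J k" by auto
      then have "measure P (?J k \<inter> - K1) = measure P (?J k)" by simp
      then show ?thesis using measure_nonneg[of N "?J k \<inter> - K2"] by linarith
    next
      case False
      then obtain x where x: "x \<in> ?J k" "x \<in> K1" by blast
      have "?J k \<inter> K2 = {}"
      proof (rule ccontr)
        assume "?J k \<inter> K2 \<noteq> {}"
        then obtain y where "y \<in> ?J k" "y \<in> K2" by blast
        with x d(2)[of x y] s[OF k] show False by (auto simp: dist_real_def abs_if split: if_splits)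
      qed
      then have "?J k \<inter> - K2 = ?J k" by auto
      then have "measure N (?J k \<inter> - K2) = measure N (?J k)" by simp
      then show ?thesis using measure_nonneg[of P "?J k \<inter> - K1"] by linarith
    qed
    have s': "\<And>k. k < n \<Longrightarrow> s k \<le> s (Suc k)" using s by auto
    have "measure P {s 0<..s n} + measure N {s 0<..s n} = (\<Sum>k<n. measure P (?J k) + measure N (?J k))"
      using measure_Ioc_sum[OF P, of UNIV n s] measure_Ioc_sum[OF N, of UNIV n s] s'
      by (simp add: sum.distrib)
    also have "\<dots> \<le> (\<Sum>k<n. \<bar>measure P (?J k) - measure N (?J k)\<bar>
        + 2 * measure P (?J k \<inter> - K1) + 2 * measure N (?J k \<inter> - K2))"
      using each by (intro sum_mono) auto
    also have "\<dots> = (\<Sum>k<n. \<bar>measure P (?J k) - measure N (?J k)\<bar>)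
        + 2 * measure P ({s 0<..s n} \<inter> - K1) + 2 * measure N ({s 0<..s n} \<inter> - K2)"
      using measure_Ioc_sum[OF P, of "- K1" n s] measure_Ioc_sum[OF N, of "- K2" n s] b s'
      by (simp add: sum.distrib sum_distrib_left borel_comp)
    also have "measure P ({s 0<..s n} \<inter> - K1) \<le> measure P (- K1)"
      using b by (intro P.finite_measure_mono) (auto simp: P.M_is_borel borel_comp)
    also have "measure N ({s 0<..s n} \<inter> - K2) \<le> measure N (- K2)"
      using b by (intro N.finite_measure_mono) (auto simp: N.M_is_borel borel_comp)
    finally show "measure P {s 0<..s n} + measure N {s 0<..s n}
         \<le> (\<Sum>k<n. \<bar>measure P (?J k) - measure N (?J k)\<bar>) + e"
      using c1 c2 by simp
  qed (rule d(1))
qed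

section \<open>Integrals of continuous functions over half-open intervals\<close>

context finite_borel_measure
begin

lemma set_integrable_Ioc:
  fixes F :: "real \<Rightarrow> 'a::{banach, second_countable_topology}"
  assumes "continuous_on UNIV F"
  shows "set_integrable M {x<..y} F"
proof -
  have c: "continuous_on {x..y} F" using assms continuous_on_subset by blast
  then have "bounded (F ` {x..y})" by (intro compact_imp_bounded compact_continuous_image) auto
  then obtain C where "\<And>u. u \<in> {x..y} \<Longrightarrow> norm (F u) \<le> C"
    unfolding bounded_iff by blast
  then show ?thesis
    by (intro set_integrable_bounded_continuous[where I="{x..y}" and C=C] c) (auto simp: finite_borel_measure_axioms)
qed

lemma set_integral_Ioc_norm_le:
  fixes F :: "real \<Rightarrow> 'a::{banach, second_countable_topology}"
  assumes F: "continuous_on UNIV F" and W: "continuous_on UNIV W"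
    and le: "\<And>u. x < u \<Longrightarrow> u \<le> y \<Longrightarrow> norm (F u) \<le> W u"
  shows "norm (LINT u:{x<..y}|M. F u) \<le> (LINT u:{x<..y}|M. W u)"
proof -
  have "norm (LINT u:{x<..y}|M. F u) \<le> (LINT u:{x<..y}|M. norm (F u))"
    by (intro set_integral_norm_bound set_integrable_Ioc F)
  also have "\<dots> \<le> (LINT u:{x<..y}|M. W u)"
    using le by (intro set_integral_mono set_integrable_Ioc continuous_intros F W) auto
  finally show ?thesis .
qed

lemma set_integral_Ioc_const: "(LINT u:{x<..y}|M. a) = measure M {x<..y} *\<^sub>R (a::'a::{banach, second_countable_topology})"
proof -
  have "(LINT u:{x<..y}|M. a) = (LINT u|M. indicator {x<..y} u) *\<^sub>R a"
    unfolding set_lebesgue_integral_def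
    by (rule integral_scaleR_left) (auto simp: M_is_borel emeasure_finite top.not_eq_extremum[symmetric])
  then show ?thesis by (simp add: borel_UNIV)
qed

lemma set_integral_Ioc_Un:
  fixes F :: "real \<Rightarrow> 'a::{banach, second_countable_topology}"
  assumes F: "continuous_on UNIV F" and "x \<le> y" "y \<le> z"
  shows "(LINT u:{x<..z}|M. F u) = (LINT u:{x<..y}|M. F u) + (LINT u:{y<..z}|M. F u)"
proof -
  have "{x<..z} = {x<..y} \<union> {y<..z}" using assms by auto
  then show ?thesis
    by (auto intro!: set_integral_Un set_integrable_Ioc F)
qed

text \<open>Freezing the vector factor isolates a main term of known direction; what remains is
  controlled by the oscillation of \<open>F\<close>.\<close>

lemma set_integral_Ioc_split_const:
  fixes F :: "real \<Rightarrow> 'a::{banach, second_countable_topology}"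
  assumes F: "continuous_on UNIV F" and W: "continuous_on UNIV W"
  shows "(LINT u:{x<..y}|M. W u *\<^sub>R F u) = (LINT u:{x<..y}|M. W u) *\<^sub>R a + (LINT u:{x<..y}|M. W u *\<^sub>R (F u - a))"
proof -
  have "(LINT u:{x<..y}|M. W u *\<^sub>R F u) = (LINT u:{x<..y}|M. W u *\<^sub>R a + W u *\<^sub>R (F u - a))"
    by (simp add: algebra_simps)
  also have "\<dots> = (LINT u:{x<..y}|M. W u *\<^sub>R a) + (LINT u:{x<..y}|M. W u *\<^sub>R (F u - a))"
    by (intro set_integral_add set_integrable_Ioc continuous_intros F W)
  also have "(LINT u:{x<..y}|M. W u *\<^sub>R a) = (LINT u:{x<..y}|M. W u) *\<^sub>R a"
    using set_integrable_Ioc[OF W, of x y]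
    unfolding set_lebesgue_integral_def set_integrable_def by simp
  finally show ?thesis .
qed

end

section \<open>Hat weights and their averages\<close>

text \<open>
  The density, up to the factor \<open>D\<theta>\<close>, of the middle point of a triple \<open>p < u < q\<close> with \<open>p \<in> [a, b]\<close> and
  \<open>q \<in> [b, c]\<close>; it comes from \<open>t q - t p = \<integral> n D\<theta>\<close> over \<open>(p, q]\<close>.
\<close>

definition hat :: "real \<Rightarrow> real \<Rightarrow> real \<Rightarrow> real \<Rightarrow> real" where
  "hat a b c u = max 0 (min ((c - b) * (u - a)) ((b - a) * (c - u)))"

lemma hat_eqs:
  assumes "a < b" "b < c"
  shows "u \<le> a \<Longrightarrow> hat a b c u = 0" "c \<le> u \<Longrightarrow> hat a b c u = 0"
    "a \<le> u \<Longrightarrow> u \<le> b \<Longrightarrow> hat a b c u = (c - b) * (u - a)"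
    "b \<le> u \<Longrightarrow> u \<le> c \<Longrightarrow> hat a b c u = (b - a) * (c - u)"
proof -
  show "hat a b c u = 0" if "u \<le> a"
  proof -
    have "(c - b) * (u - a) \<le> 0" using assms that by (intro mult_nonneg_nonpos) auto
    then show ?thesis by (simp add: hat_def)
  qed
  show "hat a b c u = 0" if "c \<le> u"
  proof -
    have "(b - a) * (c - u) \<le> 0" using assms that by (intro mult_nonneg_nonpos) auto
    then show ?thesis by (simp add: hat_def)
  qed
  show "hat a b c u = (c - b) * (u - a)" if "a \<le> u" "u \<le> b"
  proof -
    have "(c - b) * (u - a) \<le> (c - u) * (b - a)"
      using assms that by (intro mult_mono) auto
    then show ?thesis using assms that by (simp add: hat_def min_def mult.commute)
  qed
  show "hat a b c u = (b - a) * (c - u)" if "b \<le> u" "u \<le> c"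
  proof -
    have "(b - a) * (c - u) \<le> (u - a) * (c - b)"
      using assms that by (intro mult_mono) auto
    then show ?thesis using assms that by (simp add: hat_def min_def mult.commute)
  qed
qed

lemma hat_nonneg: "0 \<le> hat a b c u"
  by (simp add: hat_def)

lemma continuous_on_hat: "continuous_on S (hat a b c)"
  unfolding hat_def[abs_def] by (intro continuous_intros)

lemma continuous_on_hat': "continuous_on S f \<Longrightarrow> continuous_on S (\<lambda>x. hat a b c (f x))"
  unfolding hat_def by (intro continuous_intros)

context finite_borel_measure
begin

definition hat_integral :: "real \<Rightarrow> real \<Rightarrow> real \<Rightarrow> (real \<Rightarrow> 'a::{banach, second_countable_topology}) \<Rightarrow> 'a" where
  "hat_integral a b c F = (LINT u|M. hat a b c u *\<^sub>R F u)"

lemma indicator_hat: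
  assumes "a < b" "b < c"
  shows "(\<lambda>u. indicator {a<..c} u *\<^sub>R (hat a b c u *\<^sub>R F u)) = (\<lambda>u. hat a b c u *\<^sub>R (F u :: 'a::real_vector))"
proof
  fix u show "indicator {a<..c} u *\<^sub>R (hat a b c u *\<^sub>R F u) = hat a b c u *\<^sub>R F u"
    using hat_eqs(1,2)[OF assms, of u] by (cases "u \<in> {a<..c}") auto
qed

lemma integrable_hat:
  fixes F :: "real \<Rightarrow> 'a::{banach, second_countable_topology}"
  assumes "a < b" "b < c" and F: "continuous_on UNIV F"
  shows "integrable M (\<lambda>u. hat a b c u *\<^sub>R F u)"
proof -
  have "set_integrable M {a<..c} (\<lambda>u. hat a b c u *\<^sub>R F u)"
    by (intro set_integrable_Ioc continuous_intros continuous_on_hat' F)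
  then show ?thesis unfolding set_integrable_def indicator_hat[OF assms(1,2)] .
qed

lemma hat_integral_Ioc:
  fixes F :: "real \<Rightarrow> 'a::{banach, second_countable_topology}"
  assumes "a < b" "b < c"
  shows "hat_integral a b c F = (LINT u:{a<..c}|M. hat a b c u *\<^sub>R F u)"
  unfolding hat_integral_def set_lebesgue_integral_def indicator_hat[OF assms] ..

text \<open>The two moments on the right are the remainders in the expansions of two consecutive
  chords about their common end point. This is how the hat enters the cross product.\<close>

lemma hat_integral_split:
  fixes F :: "real \<Rightarrow> 'a::{banach, second_countable_topology}"
  assumes "a < b" "b < c" and F: "continuous_on UNIV F"
  shows "hat_integral a b c F = (c - b) *\<^sub>R (LINT u:{a<..b}|M. (u - a) *\<^sub>R F u) + (b - a) *\<^sub>R (LINT u:{b<..c}|M. (c - u) *\<^sub>R F u)"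
proof -
  have "hat_integral a b c F = (LINT u:{a<..b}|M. hat a b c u *\<^sub>R F u) + (LINT u:{b<..c}|M. hat a b c u *\<^sub>R F u)"
    unfolding hat_integral_Ioc[OF assms(1,2)] using assms
    by (intro set_integral_Ioc_Un continuous_intros continuous_on_hat') auto
  also have "(LINT u:{a<..b}|M. hat a b c u *\<^sub>R F u) = (LINT u:{a<..b}|M. (c - b) *\<^sub>R ((u - a) *\<^sub>R F u))"
    using assms by (intro set_lebesgue_integral_cong) (auto simp: hat_eqs M_is_borel)
  also have "(LINT u:{b<..c}|M. hat a b c u *\<^sub>R F u) = (LINT u:{b<..c}|M. (b - a) *\<^sub>R ((c - u) *\<^sub>R F u))"
    using assms by (intro set_lebesgue_integral_cong) (auto simp: hat_eqs M_is_borel)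
  finally show ?thesis
    by (simp only: set_integral_scaleR_right)
qed

lemma hat_integral_diff:
  fixes F G :: "real \<Rightarrow> 'a::{banach, second_countable_topology}"
  assumes "a < b" "b < c" "continuous_on UNIV F" "continuous_on UNIV G"
  shows "hat_integral a b c (\<lambda>u. F u - G u) = hat_integral a b c F - hat_integral a b c G"
  using integrable_hat[OF assms(1,2,3)] integrable_hat[OF assms(1,2,4)]
  by (simp add: hat_integral_def scaleR_diff_right)

lemma hat_integral_bounded_linear:
  fixes F :: "real \<Rightarrow> 'a::{banach, second_countable_topology}" and T :: "'a \<Rightarrow> 'b::{banach, second_countable_topology}"
  assumes "a < b" "b < c" "continuous_on UNIV F" "bounded_linear T"
  shows "hat_integral a b c (\<lambda>u. T (F u)) = T (hat_integral a b c F)"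
proof -
  interpret T: bounded_linear T by fact
  show ?thesis
    unfolding hat_integral_def
    by (subst integral_bounded_linear[OF assms(4) integrable_hat[OF assms(1-3)], symmetric]) (simp add: T.scaleR)
qed

lemma hat_integral_const:
  fixes k :: "'a::{banach, second_countable_topology}"
  assumes "a < b" "b < c"
  shows "hat_integral a b c (\<lambda>_. k) = hat_integral a b c (\<lambda>_. 1) *\<^sub>R k"
  using integrable_hat[OF assms, of "\<lambda>_. 1::real"] by (simp add: hat_integral_def)

lemma hat_integral_norm_le:
  fixes F :: "real \<Rightarrow> 'a::{banach, second_countable_topology}"
  assumes "a < b" "b < c" "continuous_on UNIV F"
    and le: "\<And>u. a < u \<Longrightarrow> u \<le> c \<Longrightarrow> norm (F u) \<le> k"
  shows "norm (hat_integral a b c F) \<le> hat_integral a b c (\<lambda>_. 1) * k"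
proof -
  have "norm (hat_integral a b c F) \<le> (LINT u:{a<..c}|M. hat a b c u *\<^sub>R k)"
    unfolding hat_integral_Ioc[OF assms(1,2)]
    using le by (intro set_integral_Ioc_norm_le continuous_intros continuous_on_hat' assms(3))
       (auto intro!: mult_left_mono simp: hat_nonneg)
  also have "\<dots> = hat_integral a b c (\<lambda>_. 1) * k"
    using hat_integral_const[OF assms(1,2), of k] by (simp add: hat_integral_Ioc[OF assms(1,2)])
  finally show ?thesis .
qed

text \<open>On the right half of [a, b] the hat is at least half its maximum (c - b) * (b -
  a).\<close>

lemma hat_integral_pos:
  assumes "a < b" "b < c" "measure M {(a + b) / 2<..b} > 0"
  shows "hat_integral a b c (\<lambda>_. 1) > (0::real)"
proof -
  have ab: "(a + b)/2 \<le> b" "a \<le> (a + b)/2" using assms by auto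
  have "0 < (c - b) * ((b - a) / 2) * measure M {(a + b) / 2<..b}"
    using assms by simp
  also have "\<dots> = (LINT u:{(a + b)/2<..b}|M. (c - b) * ((b - a) / 2))"
    by (simp add: set_integral_Ioc_const)
  also have "\<dots> \<le> (LINT u:{(a + b)/2<..b}|M. hat a b c u)"
    using assms by (intro set_integral_mono set_integrable_Ioc continuous_intros continuous_on_hat)
       (auto simp: hat_eqs)
  also have "\<dots> \<le> (LINT u|M. hat a b c u)"
    unfolding set_lebesgue_integral_def
    using integrable_hat[OF assms(1,2), of "\<lambda>_. 1::real"] set_integrable_Ioc[OF continuous_on_hat[of UNIV a b c], of "(a+b)/2" b]
    by (intro integral_mono) (auto simp: set_integrable_def hat_nonneg split: split_indicator)
  also have "\<dots> = hat_integral a b c (\<lambda>_. 1)" by (simp add: hat_integral_def)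
  finally show ?thesis .
qed

text \<open>
  The difference \<open>D\<close> of the normalised densities changes sign exactly once, at some \<open>z\<close>, and has integral
  \<open>0\<close>; hence \<open>\<integral> D g = \<integral> D (g - g z) \<ge> 0\<close>.
\<close>

lemma hat_mean_mono:
  fixes g :: "real \<Rightarrow> real"
  assumes o: "a < b" "b < c" "c < d" and g: "mono g" "continuous_on UNIV g"
    and K: "hat_integral a b c (\<lambda>_. 1) > (0::real)" "hat_integral b c d (\<lambda>_. 1) > (0::real)"
  shows "hat_integral a b c g / hat_integral a b c (\<lambda>_. 1) \<le> hat_integral b c d g / hat_integral b c d (\<lambda>_. 1)"
proof -
  define k1 where "k1 = hat_integral a b c (\<lambda>_. 1::real)"
  define k2 where "k2 = hat_integral b c d (\<lambda>_. 1::real)"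
  \<comment> \<open>The difference of the normalised densities, multiplied by \<open>k1 * k2\<close>
    to avoid division.\<close>
  define D where "D u = k1 * hat b c d u - k2 * hat a b c u" for u
  have k: "k1 > 0" "k2 > 0" using K by (auto simp: k1_def k2_def)
  have cD: "continuous_on S D" for S unfolding D_def by (intro continuous_intros continuous_on_hat)
  have Db: "D b \<le> 0" using o k by (simp add: D_def hat_eqs)
  have Dc: "0 \<le> D c" using o k by (simp add: D_def hat_eqs)
  obtain z where z: "b \<le> z" "z \<le> c" "D z = 0"
    using IVT'[OF Db Dc _ cD] o by auto
  \<comment> \<open>On [b, c], where the two hats overlap, the later one rises and the earlier one
    falls.\<close>
  have Dmono: "D u \<le> D v" if "b \<le> u" "u \<le> v" "v \<le> c" for u v
    unfolding D_def using that o k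
    by (simp add: hat_eqs) (intro diff_mono mult_left_mono; simp)
  have neg: "D u \<le> 0" if "u \<le> z" for u
  proof (cases "b \<le> u")
    case True
    then show ?thesis using Dmono[of u z] z that by simp
  next
    case False
    then show ?thesis using o k hat_nonneg[of a b c u] by (simp add: D_def hat_eqs)
  qed
  have pos: "0 \<le> D u" if "z \<le> u" for u
  proof (cases "u \<le> c")
    case True
    then show ?thesis using Dmono[of z u] z that by simp
  next
    case False
    then show ?thesis using o k hat_nonneg[of b c d u] by (simp add: D_def hat_eqs)
  qed
  have D_int: "(LINT u|M. D u * f u) = k1 * hat_integral b c d f - k2 * hat_integral a b c f"
    if "continuous_on UNIV f" for f :: "real \<Rightarrow> real"
    using integrable_hat[OF o(1,2) that] integrable_hat[OF o(2,3) that]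
    by (simp add: D_def hat_integral_def left_diff_distrib mult.assoc)
  have "0 \<le> (LINT u|M. D u * (g u - g z))"
  proof (intro integral_nonneg_AE AE_I2)
    fix u show "0 \<le> D u * (g u - g z)"
      using neg[of u] pos[of u] monoD[OF g(1), of u z] monoD[OF g(1), of z u]
      by (cases "u \<le> z") (auto simp: zero_le_mult_iff)
  qed
  also have "\<dots> = k1 * hat_integral b c d (\<lambda>u. g u - g z) - k2 * hat_integral a b c (\<lambda>u. g u - g z)"
    by (intro D_int continuous_intros g)
  also have "\<dots> = k1 * hat_integral b c d g - k2 * hat_integral a b c g"
    using o hat_integral_const[OF o(1,2), of "g z"] hat_integral_const[OF o(2,3), of "g z"]
    by (simp add: hat_integral_diff g k1_def k2_def algebra_simps)
  finally have "k2 * hat_integral a b c g \<le> k1 * hat_integral b c d g" by simp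
  then show ?thesis using k unfolding k1_def[symmetric] k2_def[symmetric] by (simp add: field_simps)
qed

end

section \<open>Curves with a moving frame\<close>

lemma norm_cross3_le: "norm (cross3 x y) \<le> norm x * norm y"
proof -
  have "(norm (cross3 x y))\<^sup>2 \<le> (norm x * norm y)\<^sup>2"
    using norm_cross_dot[of x y] zero_le_power2[of "x \<bullet> y"] by linarith
  then show ?thesis by (rule power2_le_imp_le) simp
qed

lemma bounded_linear_cross3_right: "bounded_linear (cross3 x)"
proof -
  have "linear (cross3 x)" using bilinear_cross by (simp add: bilinear_def)
  then show ?thesis by (simp add: linear_conv_bounded_linear)
qed

declare continuous_on_cross [continuous_intros]

text \<open>Here \<open>M\<close> stands for D theta, and \<open>P\<close> and \<open>N\<close> for
  the Jordan parts of D phi, carried by \<open>Y\<close> and its complement. The frame is given on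
  the whole line, so that integrals up to the end points of the curve need no separate treatment. Of
  the equation for \<open>n\<close> only a bound on increments is kept, which is all that the error
  estimates use.\<close>

locale frame_curve =
  fixes L :: real and t n b \<gamma> :: "real \<Rightarrow> real^3" and M P N :: "real measure" and Y :: "real set"
  assumes L: "L > 0"
    and M: "finite_borel_measure M" and P: "finite_borel_measure P" and N: "finite_borel_measure N"
    and atomless: "measure M {x} = 0" "measure P {x} = 0" "measure N {x} = 0"
    and M_pos: "0 \<le> x \<Longrightarrow> x < y \<Longrightarrow> y \<le> L \<Longrightarrow> measure M {x<..y} > 0"
    and singular: "Y \<in> sets borel" "measure P (- Y) = 0" "measure N Y = 0"
    and cont: "continuous_on UNIV t" "continuous_on UNIV n" "continuous_on UNIV b"
    and norms: "norm (t x) = 1" "norm (n x) = 1" "norm (b x) = 1"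
    and cross_tn: "cross3 (t x) (n x) = b x"
    and t_eq: "x \<le> y \<Longrightarrow> t y - t x = (LINT u:{x<..y}|M. n u)"
    and b_eq: "x \<le> y \<Longrightarrow> b y - b x = (LINT u:{x<..y}|N. n u) - (LINT u:{x<..y}|P. n u)"
    and n_diff: "x \<le> y \<Longrightarrow> norm (n y - n x) \<le> measure M {x<..y} + measure P {x<..y} + measure N {x<..y}"
    and curve_cont: "continuous_on {0..L} \<gamma>"
    and curve_deriv: "0 < x \<Longrightarrow> x < L \<Longrightarrow> (\<gamma> has_vector_derivative t x) (at x)"
begin

sublocale M: finite_borel_measure M by (rule M)
sublocale P: finite_borel_measure P by (rule P)
sublocale N: finite_borel_measure N by (rule N)

definition curv :: "real \<Rightarrow> real \<Rightarrow> real" where "curv x y = measure M {x<..y}"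
definition tors :: "real \<Rightarrow> real \<Rightarrow> real" where "tors x y = measure P {x<..y} + measure N {x<..y}"
text \<open>Both parts enter because the derivative of \<open>n\<close> has a curvature term and a
  torsion term.\<close>

definition rot :: "real \<Rightarrow> real \<Rightarrow> real" where "rot x y = curv x y + tors x y"

lemma nonneg [simp]: "0 \<le> curv x y" "0 \<le> tors x y" "0 \<le> rot x y"
  by (simp_all add: curv_def tors_def rot_def)

lemma additive:
  assumes "x \<le> y" "y \<le> z"
  shows "curv x z = curv x y + curv y z" "tors x z = tors x y + tors y z" "rot x z = rot x y + rot y z"
  using M.measure_Ioc_Un[OF assms] P.measure_Ioc_Un[OF assms] N.measure_Ioc_Un[OF assms]
  by (auto simp: curv_def tors_def rot_def)

lemma sub_mono:
  assumes "x \<le> x'" "x' \<le> y'" "y' \<le> y"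
  shows "curv x' y' \<le> curv x y" "tors x' y' \<le> tors x y" "rot x' y' \<le> rot x y"
  using assms additive[of x x' y'] additive[of x y' y] nonneg[of x x'] nonneg[of y' y] by auto

lemma small_gaps:
  assumes "e > 0"
  obtains \<delta> where "\<delta> > 0" "\<And>x y. 0 \<le> x \<Longrightarrow> x \<le> y \<Longrightarrow> y \<le> L \<Longrightarrow> y - x < \<delta> \<Longrightarrow> rot x y < e"
proof -
  have e: "e / 3 > 0" using assms by simp
  obtain d1 where d1: "d1 > 0" "\<And>x y. 0 \<le> x \<Longrightarrow> x \<le> y \<Longrightarrow> y \<le> L \<Longrightarrow> y - x < d1 \<Longrightarrow> measure M {x<..y} < e/3"
    using M.uniformly_small_Ioc[OF atomless(1) e] by metis
  obtain d2 where d2: "d2 > 0" "\<And>x y. 0 \<le> x \<Longrightarrow> x \<le> y \<Longrightarrow> y \<le> L \<Longrightarrow> y - x < d2 \<Longrightarrow> measure P {x<..y} < e/3"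
    using P.uniformly_small_Ioc[OF atomless(2) e] by metis
  obtain d3 where d3: "d3 > 0" "\<And>x y. 0 \<le> x \<Longrightarrow> x \<le> y \<Longrightarrow> y \<le> L \<Longrightarrow> y - x < d3 \<Longrightarrow> measure N {x<..y} < e/3"
    using N.uniformly_small_Ioc[OF atomless(3) e] by metis
  show ?thesis
  proof (rule that)
    show "min d1 (min d2 d3) > 0" using d1 d2 d3 by simp
    show "rot x y < e" if "0 \<le> x" "x \<le> y" "y \<le> L" "y - x < min d1 (min d2 d3)" for x y
      using d1(2)[of x y] d2(2)[of x y] d3(2)[of x y] that by (simp add: rot_def curv_def tors_def)
  qed
qed

lemma n_lipschitz:
  assumes "a \<le> x" "x \<le> y" "y \<le> c"
  shows "norm (n y - n x) \<le> rot a c" "norm (n x - n y) \<le> rot a c"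
proof -
  have "norm (n y - n x) \<le> rot x y" using n_diff[OF assms(2)] by (simp add: rot_def curv_def tors_def)
  also have "\<dots> \<le> rot a c" using assms by (intro sub_mono) auto
  finally show "norm (n y - n x) \<le> rot a c" .
  then show "norm (n x - n y) \<le> rot a c" by (simp add: norm_minus_commute)
qed

lemma n_lipschitz':
  assumes "a \<le> x" "x \<le> c" "a \<le> y" "y \<le> c"
  shows "norm (n y - n x) \<le> rot a c"
  using n_lipschitz[of a x y c] n_lipschitz[of a y x c] assms by (cases "x \<le> y") auto

lemma t_lipschitz:
  assumes "x \<le> y"
  shows "norm (t y - t x) \<le> curv x y"
proof -
  have "norm (t y - t x) \<le> (LINT u:{x<..y}|M. 1)"
    unfolding t_eq[OF assms] by (intro M.set_integral_Ioc_norm_le cont continuous_intros) (simp add: norms)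
  then show ?thesis by (simp add: M.set_integral_Ioc_const curv_def)
qed

lemma b_lipschitz:
  assumes "x \<le> y"
  shows "norm (b y - b x) \<le> tors x y"
proof -
  have "norm (LINT u:{x<..y}|N. n u) \<le> (LINT u:{x<..y}|N. 1)"
    by (intro N.set_integral_Ioc_norm_le cont continuous_intros) (simp add: norms)
  moreover have "norm (LINT u:{x<..y}|P. n u) \<le> (LINT u:{x<..y}|P. 1)"
    by (intro P.set_integral_Ioc_norm_le cont continuous_intros) (simp add: norms)
  ultimately show ?thesis
    using norm_triangle_ineq4[of "LINT u:{x<..y}|N. n u" "LINT u:{x<..y}|P. n u"]
    by (simp add: b_eq[OF assms] N.set_integral_Ioc_const P.set_integral_Ioc_const tors_def)
qed

text \<open>The increment of \<open>t\<close> is an integral of \<open>n\<close>, so up to the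
  oscillation of \<open>n\<close> it is parallel to \<open>n z\<close>. The cross product removes
  the parallel part and is of second order.\<close>

lemma chord_cross_normal:
  assumes "x \<le> y" "x \<le> z" "z \<le> y" "a \<le> x" "y \<le> c"
  shows "norm (cross3 (t y - t x) (n z)) \<le> curv a c * rot a c"
proof -
  have "t y - t x = (LINT u:{x<..y}|M. 1 *\<^sub>R n u)" by (simp add: t_eq[OF assms(1)])
  also have "\<dots> = (LINT u:{x<..y}|M. 1) *\<^sub>R n z + (LINT u:{x<..y}|M. 1 *\<^sub>R (n u - n z))"
    by (intro M.set_integral_Ioc_split_const cont continuous_intros)
  finally have eq: "t y - t x = (LINT u:{x<..y}|M. 1) *\<^sub>R n z + (LINT u:{x<..y}|M. (n u - n z))" by simp
  have "cross3 (t y - t x) (n z) = cross3 (LINT u:{x<..y}|M. (n u - n z)) (n z)"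
    unfolding eq by (simp add: cross_add_left cross_mult_left)
  then have "norm (cross3 (t y - t x) (n z)) \<le> norm (LINT u:{x<..y}|M. (n u - n z))"
    using norm_cross3_le[of "LINT u:{x<..y}|M. (n u - n z)" "n z"] by (simp add: norms)
  also have "\<dots> \<le> (LINT u:{x<..y}|M. rot a c)"
    using assms by (intro M.set_integral_Ioc_norm_le cont continuous_intros n_lipschitz') auto
  also have "\<dots> = curv x y * rot a c" by (simp add: M.set_integral_Ioc_const curv_def)
  also have "\<dots> \<le> curv a c * rot a c" using assms by (intro mult_right_mono sub_mono) auto
  finally show ?thesis .
qed

text \<open>A Taylor formula with a Stieltjes remainder. The function \<open>t\<close> need not be
  differentiable, but the remainder, as a function of its upper limit, has derivative
  \<open>t z - t x\<close>; hence the defect \<open>D\<close> is constant.\<close>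

lemma curve_chord_right:
  assumes "0 \<le> x" "x \<le> y" "y \<le> L"
  shows "\<gamma> y - \<gamma> x = (y - x) *\<^sub>R t x + (LINT u:{x<..y}|M. (y - u) *\<^sub>R n u)"
proof (cases "x = y")
  case True
  then show ?thesis by (simp add: set_lebesgue_integral_def)
next
  case False
  define H where "H z = (LINT u:{x<..z}|M. (z - u) *\<^sub>R n u)" for z
  define D where "D z = \<gamma> z - \<gamma> x - (z - x) *\<^sub>R t x - H z" for z
  have cH: "continuous_on UNIV (\<lambda>u. (z - u) *\<^sub>R n u)" for z by (intro continuous_intros cont)
  \<comment> \<open>The error is small compared with \<open>z' - z\<close>, because
    \<open>curv\<close> over a shrinking interval tends to 0.\<close>
  have step: "norm (H z' - H z - (z' - z) *\<^sub>R (t z - t x)) \<le> (z' - z) * curv z z'"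
    if z: "x \<le> z" "z \<le> z'" for z z'
  proof -
    have "H z' = (LINT u:{x<..z}|M. (z' - u) *\<^sub>R n u) + (LINT u:{z<..z'}|M. (z' - u) *\<^sub>R n u)"
      unfolding H_def by (intro M.set_integral_Ioc_Un cH z)
    also have "(LINT u:{x<..z}|M. (z' - u) *\<^sub>R n u) = (LINT u:{x<..z}|M. (z' - z) *\<^sub>R n u + (z - u) *\<^sub>R n u)"
      by (simp add: algebra_simps)
    also have "\<dots> = (LINT u:{x<..z}|M. (z' - z) *\<^sub>R n u) + H z"
      unfolding H_def by (intro set_integral_add M.set_integrable_Ioc continuous_intros cont)
    also have "(LINT u:{x<..z}|M. (z' - z) *\<^sub>R n u) = (z' - z) *\<^sub>R (t z - t x)"
      using t_eq[OF z(1)] by simp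
    finally have "H z' - H z - (z' - z) *\<^sub>R (t z - t x) = (LINT u:{z<..z'}|M. (z' - u) *\<^sub>R n u)" by simp
    also have "norm \<dots> \<le> (LINT u:{z<..z'}|M. z' - z)"
      by (intro M.set_integral_Ioc_norm_le cH continuous_intros) (auto simp: norms)
    finally show ?thesis by (simp add: M.set_integral_Ioc_const curv_def mult.commute)
  qed
  have Hder: "(H has_vector_derivative (t z - t x)) (at z within {x..y})" if z: "z \<in> {x..y}" for z
    unfolding has_vector_derivative_def has_derivative_within_alt
  proof (intro conjI allI impI bounded_linear_scaleR_left)
    fix e :: real assume "e > 0"
    then obtain \<delta> where \<delta>: "\<delta> > 0" "\<And>x y. 0 \<le> x \<Longrightarrow> x \<le> y \<Longrightarrow> y \<le> L \<Longrightarrow> y - x < \<delta> \<Longrightarrow> rot x y < e / 2"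
      using small_gaps[of "e/2"] by (metis half_gt_zero)
    have c2: "curv u v \<le> e / 2" if "x \<le> u" "u \<le> v" "v \<le> y" "v - u < \<delta>" for u v
    proof -
      have "curv u v \<le> rot u v" by (simp add: rot_def)
      with \<delta>(2)[of u v] that assms show ?thesis by simp
    qed
    show "\<exists>d>0. \<forall>z'\<in>{x..y}. norm (z' - z) < d \<longrightarrow>
        norm (H z' - H z - (z' - z) *\<^sub>R (t z - t x)) \<le> e * norm (z' - z)"
    proof (intro exI conjI ballI impI)
      fix z' assume z': "z' \<in> {x..y}" "norm (z' - z) < \<delta>"
      show "norm (H z' - H z - (z' - z) *\<^sub>R (t z - t x)) \<le> e * norm (z' - z)"
      proof (cases "z \<le> z'")
        case True
        have "norm (H z' - H z - (z' - z) *\<^sub>R (t z - t x)) \<le> (z' - z) * curv z z'"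
          using step[of z z'] z True by auto
        also have "\<dots> \<le> (z' - z) * e"
          using c2[of z z'] z z' True \<open>e > 0\<close> by (intro mult_left_mono) auto
        finally show ?thesis using True by (simp add: mult.commute)
      next
        case False
        \<comment> \<open>The expansion is based at the left one of two points. For z' < z the roles
          are exchanged, and replacing \<open>t z'\<close> by \<open>t z\<close> costs a second
          curvature term; hence the halves of \<open>e\<close>.\<close>
        have c3: "curv z' z \<le> e/2" using c2[of z' z] z z' False by auto
        have "H z' - H z - (z' - z) *\<^sub>R (t z - t x) =
            - (H z - H z' - (z - z') *\<^sub>R (t z' - t x)) + (z - z') *\<^sub>R (t z - t z')"
          by (simp add: algebra_simps)
        also have "norm \<dots> \<le> norm (H z - H z' - (z - z') *\<^sub>R (t z' - t x)) + norm ((z - z') *\<^sub>R (t z - t z'))"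
          by (metis norm_triangle_ineq norm_minus_cancel)
        also have "\<dots> \<le> (z - z') * curv z' z + (z - z') * curv z' z"
          using step[of z' z] z' False t_lipschitz[of z' z] by (intro add_mono) (auto intro!: mult_left_mono)
        also have "\<dots> \<le> (z - z') * (e/2) + (z - z') * (e/2)"
          using c3 False by (intro add_mono mult_left_mono) auto
        finally show ?thesis using False by (simp add: mult.commute)
      qed
    qed (rule \<delta>(1))
  qed
  have Hc: "continuous_on {x..y} H"
    using Hder by (rule continuous_on_vector_derivative)
  \<comment> \<open>The derivative of the curve is given only on the open interval, so the end
    points form a finite exceptional set where continuity suffices.\<close>
  have "D y = D x"
  proof (rule has_derivative_zero_unique_strong_interval[where k="{x, y}" and a=x and b=y])
    show "continuous_on {x..y} D"
      unfolding D_def using assms by (intro continuous_intros Hc continuous_on_subset[OF curve_cont]) auto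
    fix z assume z: "z \<in> {x..y} - {x, y}"
    have "(D has_vector_derivative (t z - 0 - (1 *\<^sub>R t x) - (t z - t x))) (at z within {x..y})"
      unfolding D_def
    proof (intro has_vector_derivative_diff Hder has_vector_derivative_const)
      show "(\<gamma> has_vector_derivative t z) (at z within {x..y})"
        using curve_deriv[of z] z assms by (auto intro: has_vector_derivative_at_within)
      show "((\<lambda>z. (z - x) *\<^sub>R t x) has_vector_derivative 1 *\<^sub>R t x) (at z within {x..y})"
        by (auto intro!: derivative_eq_intros)
    qed (use z in auto)
    then show "(D has_derivative (\<lambda>h. 0)) (at z within {x..y})"
      by (simp add: has_vector_derivative_def)
  qed (use assms in auto)
  moreover have "D x = 0" by (simp add: D_def H_def set_lebesgue_integral_def)
  ultimately show ?thesis by (simp add: D_def H_def algebra_simps)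
qed

text \<open>The two moments add up to \<open>(y - x) *\<^sub>R (t y - t x)\<close>, which converts
  the expansion about the left end point into one about the right end point.\<close>

lemma curve_chord_left:
  assumes "0 \<le> x" "x \<le> y" "y \<le> L"
  shows "\<gamma> y - \<gamma> x = (y - x) *\<^sub>R t y - (LINT u:{x<..y}|M. (u - x) *\<^sub>R n u)"
proof -
  have "(y - x) *\<^sub>R (t y - t x) = (LINT u:{x<..y}|M. (y - x) *\<^sub>R n u)"
    using t_eq[OF assms(2)] by simp
  also have "\<dots> = (LINT u:{x<..y}|M. (y - u) *\<^sub>R n u + (u - x) *\<^sub>R n u)" by (simp add: algebra_simps)
  also have "\<dots> = (LINT u:{x<..y}|M. (y - u) *\<^sub>R n u) + (LINT u:{x<..y}|M. (u - x) *\<^sub>R n u)"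
    by (intro set_integral_add M.set_integrable_Ioc continuous_intros cont)
  finally have "(y - x) *\<^sub>R t y - (y - x) *\<^sub>R t x =
      (LINT u:{x<..y}|M. (y - u) *\<^sub>R n u) + (LINT u:{x<..y}|M. (u - x) *\<^sub>R n u)"
    by (simp only: scaleR_diff_right)
  then have "(y - x) *\<^sub>R t y = (y - x) *\<^sub>R t x +
      ((LINT u:{x<..y}|M. (y - u) *\<^sub>R n u) + (LINT u:{x<..y}|M. (u - x) *\<^sub>R n u))"
    by (simp only: diff_eq_eq add_ac)
  then show ?thesis using curve_chord_right[OF assms] by simp
qed

lemma curve_lipschitz:
  assumes "0 \<le> x" "x \<le> y" "y \<le> L"
  shows "norm (\<gamma> y - \<gamma> x - (y - x) *\<^sub>R t x) \<le> (y - x) * curv x y"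
proof -
  have "norm (LINT u:{x<..y}|M. (y - u) *\<^sub>R n u) \<le> (LINT u:{x<..y}|M. y - x)"
    by (intro M.set_integral_Ioc_norm_le continuous_intros cont) (auto simp: norms)
  then show ?thesis
    unfolding curve_chord_right[OF assms] by (simp add: M.set_integral_Ioc_const curv_def mult.commute)
qed

section \<open>Cross products of consecutive chords\<close>

definition weight :: "real \<Rightarrow> real \<Rightarrow> real \<Rightarrow> real" where
  "weight x y z = M.hat_integral x y z (\<lambda>_. 1)"

definition mean :: "real \<Rightarrow> real \<Rightarrow> real \<Rightarrow> (real \<Rightarrow> 'a::{banach, second_countable_topology}) \<Rightarrow> 'a" where
  "mean x y z F = (1 / weight x y z) *\<^sub>R M.hat_integral x y z F"

lemma weight_pos:
  assumes "0 \<le> x" "x < y" "y < z" "z \<le> L"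
  shows "weight x y z > 0"
  unfolding weight_def using assms by (intro M.hat_integral_pos M_pos) auto

text \<open>Expanding both chords about the middle point y gives t y x (hat integral of n) - p x q.
  Replacing t y by t u under the integral turns the first term into the hat integral of b and costs
  one unit of the constant 3. The remainders p and q are both nearly parallel to n y, so their cross
  product accounts for the other two. Both errors are proportional to the hat mass, so that division
  by it is harmless.\<close>

lemma chord_cross_estimate:
  assumes "0 \<le> x" "x < y" "y < z" "z \<le> L"
  shows "norm (cross3 (\<gamma> y - \<gamma> x) (\<gamma> z - \<gamma> y) - M.hat_integral x y z b) \<le> 3 * curv x z * rot x z * weight x y z"
proof -
  define p where "p = (LINT u:{x<..y}|M. (u - x) *\<^sub>R n u)"
  define q where "q = (LINT u:{y<..z}|M. (z - u) *\<^sub>R n u)"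
  define p0 where "p0 = (LINT u:{x<..y}|M. (u - x))"
  define q0 where "q0 = (LINT u:{y<..z}|M. (z - u))"
  define p' where "p' = (LINT u:{x<..y}|M. (u - x) *\<^sub>R (n u - n y))"
  define q' where "q' = (LINT u:{y<..z}|M. (z - u) *\<^sub>R (n u - n y))"
  let ?W = "weight x y z" and ?r = "rot x z" and ?c = "curv x z"
  have s1: "\<gamma> y - \<gamma> x = (y - x) *\<^sub>R t y - p"
    unfolding p_def using assms by (intro curve_chord_left) auto
  have s2: "\<gamma> z - \<gamma> y = (z - y) *\<^sub>R t y + q"
    unfolding q_def using assms by (intro curve_chord_right) auto
  have hn: "M.hat_integral x y z n = (z - y) *\<^sub>R p + (y - x) *\<^sub>R q"
    unfolding p_def q_def using assms by (intro M.hat_integral_split cont)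
  have W: "?W = (z - y) * p0 + (y - x) * q0"
    unfolding weight_def p0_def q0_def using assms M.hat_integral_split[of x y z "\<lambda>_. 1::real"] by simp
  have p_eq: "p = p0 *\<^sub>R n y + p'" unfolding p_def p0_def p'_def
    by (intro M.set_integral_Ioc_split_const cont continuous_intros)
  have q_eq: "q = q0 *\<^sub>R n y + q'" unfolding q_def q0_def q'_def
    by (intro M.set_integral_Ioc_split_const cont continuous_intros)
  have p0: "0 \<le> p0" unfolding p0_def set_lebesgue_integral_def
    by (intro integral_nonneg_AE AE_I2) (auto split: split_indicator)
  have q0: "0 \<le> q0" unfolding q0_def set_lebesgue_integral_def
    by (intro integral_nonneg_AE AE_I2) (auto split: split_indicator)
  have np': "norm p' \<le> p0 * ?r"
  proof -
    have "norm p' \<le> (LINT u:{x<..y}|M. (u - x) * ?r)"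
      unfolding p'_def using assms
      by (intro M.set_integral_Ioc_norm_le cont continuous_intros) (auto intro!: mult_left_mono n_lipschitz')
    then show ?thesis by (simp add: p0_def)
  qed
  have nq': "norm q' \<le> q0 * ?r"
  proof -
    have "norm q' \<le> (LINT u:{y<..z}|M. (z - u) * ?r)"
      unfolding q'_def using assms
      by (intro M.set_integral_Ioc_norm_le cont continuous_intros) (auto intro!: mult_left_mono n_lipschitz')
    then show ?thesis by (simp add: q0_def)
  qed
  have nq: "norm q \<le> q0"
    unfolding q_def q0_def
    by (intro M.set_integral_Ioc_norm_le cont continuous_intros) (auto simp: norms)
  \<comment> \<open>One moment is traded for a length times the curvature, so that the product
    \<open>p0 * q0\<close> becomes \<open>curv\<close> times a part of the hat mass.\<close>
  have p0c: "p0 \<le> (y - x) * ?c"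
  proof -
    have "p0 \<le> (LINT u:{x<..y}|M. y - x)" unfolding p0_def
      by (intro set_integral_mono M.set_integrable_Ioc continuous_intros) auto
    also have "\<dots> = (y - x) * curv x y" by (simp add: M.set_integral_Ioc_const curv_def)
    also have "\<dots> \<le> (y - x) * ?c" using assms by (intro mult_left_mono sub_mono) auto
    finally show ?thesis .
  qed
  have pq: "norm (cross3 p q) \<le> 2 * ?c * ?r * ?W"
  proof -
    have "cross3 p q = p0 *\<^sub>R cross3 (n y) q' + cross3 p' q"
    proof -
      have "cross3 (n y) q = cross3 (n y) q'"
        unfolding q_eq by (simp add: cross_add_right cross_mult_right)
      then show ?thesis unfolding p_eq by (simp add: cross_add_left cross_mult_left)
    qed
    also have "norm \<dots> \<le> norm (p0 *\<^sub>R cross3 (n y) q') + norm (cross3 p' q)" by (rule norm_triangle_ineq)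
    also have "norm (p0 *\<^sub>R cross3 (n y) q') \<le> p0 * (q0 * ?r)"
      using norm_cross3_le[of "n y" q'] p0 nq' by (auto simp: norms intro!: mult_left_mono)
    also have "norm (cross3 p' q) \<le> norm p' * norm q" by (rule norm_cross3_le)
    also have "norm p' * norm q \<le> (p0 * ?r) * q0"
      using np' nq p0 q0 by (intro mult_mono) auto
    finally have "norm (cross3 p q) \<le> 2 * ?r * (p0 * q0)" by (simp add: algebra_simps)
    also have "\<dots> \<le> 2 * ?r * (?c * ?W)"
    proof (rule mult_left_mono)
      have "p0 * q0 \<le> ((y - x) * ?c) * q0" using p0c q0 by (intro mult_right_mono)
      also have "\<dots> = ?c * ((y - x) * q0)" by simp
      also have "\<dots> \<le> ?c * ?W" using p0 assms unfolding W by (intro mult_left_mono) auto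
      finally show "p0 * q0 \<le> ?c * ?W" .
    qed simp
    finally show ?thesis by (simp add: algebra_simps)
  qed
  \<comment> \<open>Since b u = t u x n u, the integrand of the difference is (t y - t u) x n u,
    which is of second order.\<close>
  have main: "norm (cross3 (t y) (M.hat_integral x y z n) - M.hat_integral x y z b) \<le> ?W * (?c * ?r)"
  proof -
    have "cross3 (t y) (M.hat_integral x y z n) = M.hat_integral x y z (\<lambda>u. cross3 (t y) (n u))"
      using assms by (intro M.hat_integral_bounded_linear[symmetric] cont bounded_linear_cross3_right)
    then have "cross3 (t y) (M.hat_integral x y z n) - M.hat_integral x y z b
        = M.hat_integral x y z (\<lambda>u. cross3 (t y) (n u) - b u)"
      using assms by (simp add: M.hat_integral_diff cont continuous_intros)
    also have "\<dots> = M.hat_integral x y z (\<lambda>u. cross3 (t y - t u) (n u))"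
      by (simp add: Cross3.left_diff_distrib cross_tn)
    also have "norm \<dots> \<le> ?W * (?c * ?r)"
      unfolding weight_def
    proof (intro M.hat_integral_norm_le assms continuous_intros cont)
      fix u assume u: "x < u" "u \<le> z"
      show "norm (cross3 (t y - t u) (n u)) \<le> ?c * ?r"
      proof (cases "u \<le> y")
        case True
        then show ?thesis using chord_cross_normal[of u y u x z] u assms by auto
      next
        case False
        have "cross3 (t y - t u) (n u) = - cross3 (t u - t y) (n u)"
          by (simp add: Cross3.left_diff_distrib)
        then show ?thesis using chord_cross_normal[of y u u x z] u assms False by auto
      qed
    qed
    finally show ?thesis .
  qed
  have eq: "cross3 (\<gamma> y - \<gamma> x) (\<gamma> z - \<gamma> y) = cross3 (t y) (M.hat_integral x y z n) - cross3 p q"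
    unfolding s1 s2 hn
    by (simp add: cross_add_left cross_add_right cross_mult_left cross_mult_right
        Cross3.left_diff_distrib Cross3.right_diff_distrib algebra_simps cross_skew[of p "t y"])
  have "norm (cross3 (\<gamma> y - \<gamma> x) (\<gamma> z - \<gamma> y) - M.hat_integral x y z b)
     \<le> norm (cross3 (t y) (M.hat_integral x y z n) - M.hat_integral x y z b) + norm (cross3 p q)"
    unfolding eq
    using norm_triangle_ineq4[of "cross3 (t y) (M.hat_integral x y z n) - M.hat_integral x y z b" "cross3 p q"]
    by (simp add: algebra_simps)
  also have "\<dots> \<le> ?W * (?c * ?r) + 2 * ?c * ?r * ?W" using main pq by (rule add_mono)
  finally show ?thesis by (simp add: algebra_simps)
qed

section \<open>Hat averages of the binormal\<close>

definition cum :: "real \<Rightarrow> real" where "cum x = measure P {..x} + measure N {..x}"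

lemma cum_diff: "x \<le> y \<Longrightarrow> cum y - cum x = tors x y"
  using P.cdf_diff_eq[of x y] N.cdf_diff_eq[of x y]
  by (cases "x = y") (auto simp: cum_def tors_def cdf_def)

lemma continuous_on_cum: "continuous_on S cum"
proof -
  have "isCont (cdf P) x" "isCont (cdf N) x" for x
    using P.isCont_cdf N.isCont_cdf atomless by auto
  then have "continuous_on S (\<lambda>x. cdf P x + cdf N x)"
    by (intro continuous_intros continuous_at_imp_continuous_on) auto
  then show ?thesis by (simp add: cum_def[abs_def] cdf_def)
qed

text \<open>For every unit vector \<open>e\<close> the function \<open>cum - b \<bullet> e\<close> is increasing, so its hat averages are ordered.\<close>

lemma mean_b_diff:
  assumes "0 \<le> x" "x < y" "y < z" "z < w" "w \<le> L"
  shows "norm (mean y z w b - mean x y z b) \<le> mean y z w cum - mean x y z cum"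
proof -
  define d where "d = mean y z w b - mean x y z b"
  \<comment> \<open>Testing in the direction of the difference makes one scalar inequality yield the
    norm. If the difference vanishes, \<open>e\<close> is 0 and still has norm at most 1.\<close>
  define e where "e = sgn d"
  have pos: "weight x y z > 0" "weight y z w > 0" using assms by (auto intro!: weight_pos)
  define g where "g u = cum u - b u \<bullet> e" for u
  have cg: "continuous_on UNIV g" unfolding g_def by (intro continuous_intros cont continuous_on_cum)
  have "mono g"
  proof
    fix u v :: real assume uv: "u \<le> v"
    have "(b v - b u) \<bullet> e \<le> norm (b v - b u) * norm e" by (rule norm_cauchy_schwarz)
    also have "\<dots> \<le> norm (b v - b u) * 1" by (intro mult_left_mono) (auto simp: e_def norm_sgn)
    also have "\<dots> \<le> tors u v" using b_lipschitz[OF uv] by simp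
    finally show "g u \<le> g v" using cum_diff[OF uv] by (simp add: g_def inner_diff_left)
  qed
  then have "mean x y z g \<le> mean y z w g"
    using M.hat_mean_mono[OF assms(2,3,4) _ cg] pos unfolding mean_def weight_def by simp
  moreover have "mean p q r g = mean p q r cum - mean p q r b \<bullet> e" if "p < q" "q < r" for p q r
  proof -
    have "M.hat_integral p q r g = M.hat_integral p q r cum - M.hat_integral p q r (\<lambda>u. b u \<bullet> e)"
      unfolding g_def using that by (intro M.hat_integral_diff continuous_intros cont continuous_on_cum)
    also have "M.hat_integral p q r (\<lambda>u. b u \<bullet> e) = M.hat_integral p q r b \<bullet> e"
      using that by (intro M.hat_integral_bounded_linear[where T="\<lambda>v. v \<bullet> e"] cont bounded_linear_inner_left)
    finally show ?thesis by (simp add: mean_def diff_divide_distrib)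
  qed
  ultimately have "d \<bullet> e \<le> mean y z w cum - mean x y z cum"
    using assms by (simp add: d_def inner_diff_left)
  moreover have "d \<bullet> e = norm d"
    by (cases "d = 0") (simp_all add: e_def sgn_div_norm dot_square_norm power2_eq_square)
  ultimately show ?thesis by (simp add: d_def)
qed

lemma mean_const_diff:
  fixes F :: "real \<Rightarrow> 'a::{banach, second_countable_topology}"
  assumes "0 \<le> x" "x < y" "y < z" "z \<le> L" "continuous_on UNIV F"
    and le: "\<And>u. x < u \<Longrightarrow> u \<le> z \<Longrightarrow> norm (F u - k) \<le> e"
  shows "norm (mean x y z F - k) \<le> e"
proof -
  have pos: "weight x y z > 0" using assms by (auto intro!: weight_pos)
  have "M.hat_integral x y z (\<lambda>u. F u - k) = M.hat_integral x y z F - weight x y z *\<^sub>R k"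
    using assms M.hat_integral_const[of x y z k] by (simp add: M.hat_integral_diff weight_def)
  then have "mean x y z F - k = (1 / weight x y z) *\<^sub>R M.hat_integral x y z (\<lambda>u. F u - k)"
    using pos by (simp add: mean_def scaleR_diff_right)
  moreover have "norm (M.hat_integral x y z (\<lambda>u. F u - k)) \<le> weight x y z * e"
    unfolding weight_def using assms by (intro M.hat_integral_norm_le continuous_intros) auto
  ultimately show ?thesis using pos by (simp add: divide_le_eq mult.commute)
qed

lemma mean_b_near:
  assumes "0 \<le> x" "x < y" "y < z" "z \<le> L"
  shows "norm (mean x y z b - b y) \<le> tors x z"
proof (rule mean_const_diff[OF assms cont(3)])
  fix u assume "x < u" "u \<le> z"
  then show "norm (b u - b y) \<le> tors x z"
    using b_lipschitz[of u y] b_lipschitz[of y u] sub_mono(2)[of x u y z] sub_mono(2)[of x y u z] assms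
    by (cases "u \<le> y") (auto simp: norm_minus_commute)
qed

lemma mean_cum_bounds:
  assumes "0 \<le> x" "x < y" "y < z" "z \<le> L"
  shows "cum 0 \<le> mean x y z cum" "mean x y z cum \<le> cum L"
proof -
  \<comment> \<open>Midpoint and half length of [cum 0, cum L] express both one-sided bounds as one
    distance estimate.\<close>
  have "norm (mean x y z cum - (cum 0 + cum L) / 2) \<le> (cum L - cum 0) / 2"
  proof (rule mean_const_diff[OF assms continuous_on_cum])
    fix u assume u: "x < u" "u \<le> z"
    have "cum 0 \<le> cum u" "cum u \<le> cum L"
      using cum_diff[of 0 u] cum_diff[of u L] nonneg[of 0 u] nonneg[of u L] u assms by linarith+
    then show "norm (cum u - (cum 0 + cum L) / 2) \<le> (cum L - cum 0) / 2" by (auto simp: abs_le_iff field_simps)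
  qed
  then show "cum 0 \<le> mean x y z cum" "mean x y z cum \<le> cum L" by (auto simp: abs_le_iff field_simps)
qed

end

section \<open>Inscribed polygons\<close>

text \<open>Radial projection to the sphere of radius \<open>r\<close> does not increase distances
  outside the ball. With p, q the norms and u, v the directions, the difference of squares is (p -
  q)^2 + 2 (p q - r^2)(1 - u . v).\<close>

lemma norm_sgn_diff_le:
  fixes x y :: "'a::real_inner"
  assumes "r > 0" "r \<le> norm x" "r \<le> norm y"
  shows "r * norm (sgn x - sgn y) \<le> norm (x - y)"
proof (rule power2_le_imp_le)
  define p q u v where "p = norm x" "q = norm y" "u = sgn x" "v = sgn y"
  have "x \<noteq> 0" "y \<noteq> 0" using assms by auto
  then have x: "x = p *\<^sub>R u" and y: "y = q *\<^sub>R v" by (auto simp: p_q_u_v_def sgn_div_norm)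
  have uv: "u \<bullet> u = 1" "v \<bullet> v = 1" "u \<bullet> v \<le> 1"
  proof -
    have n1: "norm u = 1" "norm v = 1" using assms by (auto simp: p_q_u_v_def norm_sgn)
    then show "u \<bullet> u = 1" "v \<bullet> v = 1" by (simp_all add: dot_square_norm)
    show "u \<bullet> v \<le> 1" using norm_cauchy_schwarz[of u v] n1 by simp
  qed
  have pq: "r \<le> p" "r \<le> q" using assms by (auto simp: p_q_u_v_def)
  have "r * r \<le> p * q" using pq assms(1) by (intro mult_mono) auto
  then have "0 \<le> (p - q)\<^sup>2 + 2 * (p * q - r * r) * (1 - u \<bullet> v)" using uv by simp
  also have "\<dots> = (norm (x - y))\<^sup>2 - (r * norm (u - v))\<^sup>2"
    unfolding x y power_mult_distrib power2_norm_eq_inner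
    using uv by (simp add: inner_diff_left inner_diff_right inner_commute[of v u] power2_eq_square algebra_simps)
  finally show "(r * norm (sgn x - sgn y))\<^sup>2 \<le> (norm (x - y))\<^sup>2" by (simp add: p_q_u_v_def)
qed simp

lemma norm_sgn_diff_unit_le:
  fixes x y :: "'a::real_inner"
  assumes "norm y = 1"
  shows "norm (sgn x - y) \<le> 2 * norm (x - y)"
proof -
  have "norm (sgn x - x) \<le> norm (x - y)"
  proof (cases "x = 0")
    case False
    have "sgn x - x = (1 - norm x) *\<^sub>R sgn x" using False by (simp add: sgn_div_norm algebra_simps)
    then have "norm (sgn x - x) = \<bar>1 - norm x\<bar>" using False by (simp add: norm_sgn)
    also have "\<dots> \<le> norm (x - y)" using norm_triangle_ineq3[of x y] assms by (simp add: abs_minus_commute)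
    finally show ?thesis .
  qed simp
  then show ?thesis using norm_triangle_ineq[of "sgn x - x" "x - y"] by simp
qed

text \<open>A chord \<open>d\<close> of at most 1 forces a positive inner product, so the modulus
  disappears and the angle is the arc cosine of 1 - d^2/2. The factor 1 + d, instead of the usual
  pi/2, is what keeps the limit sharp.\<close>

lemma line_angle_bounds:
  fixes x y :: "'a::real_inner"
  assumes "x \<noteq> 0" "y \<noteq> 0" and d: "norm (sgn x - sgn y) = d" "d \<le> 1"
  shows "d \<le> line_angle x y" "line_angle x y \<le> d * (1 + d)"
proof -
  have d0: "0 \<le> d" using d by auto
  have d2: "d\<^sup>2 \<le> 1" using d0 d(2) by (simp add: power_le_one)
  have "norm (sgn x) = 1" "norm (sgn y) = 1" using assms by (auto simp: norm_sgn)
  then have "sgn x \<bullet> sgn x = 1" "sgn y \<bullet> sgn y = 1" by (simp_all add: dot_square_norm)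
  then have "d\<^sup>2 = 2 - 2 * (sgn x \<bullet> sgn y)"
    unfolding d(1)[symmetric] power2_norm_eq_inner inner_diff_left inner_diff_right
    by (simp add: inner_commute[of "sgn y" "sgn x"])
  then have "sgn x \<bullet> sgn y = 1 - d\<^sup>2 / 2" by linarith
  moreover have "sgn x \<bullet> sgn y = (x \<bullet> y) / (norm x * norm y)" by (simp add: sgn_div_norm divide_inverse)
  moreover have "\<bar>x \<bullet> y\<bar> / (norm x * norm y) = \<bar>(x \<bullet> y) / (norm x * norm y)\<bar>" by (simp add: abs_mult)
  ultimately have la: "line_angle x y = arccos (1 - d\<^sup>2 / 2)"
    using d2 by (simp add: line_angle_def)
  have cosb: "cos z \<le> 1 - z\<^sup>2 / 2 + z ^ 4 / 24" for z :: real
  proof -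
    obtain u where u: "cos z = (\<Sum>m<4. cos_coeff m * z ^ m) + cos (u + 1/2 * real 4 * pi) / fact 4 * z ^ 4"
      using Maclaurin_cos_expansion[of z 4] by blast
    have "(\<Sum>m<4. cos_coeff m * z ^ m) = 1 - z\<^sup>2 / 2"
      by (simp add: cos_coeff_def lessThan_nat_numeral fact_numeral)
    moreover have "cos (u + 1/2 * real 4 * pi) * z ^ 4 \<le> 1 * z ^ 4"
      by (intro mult_right_mono) auto
    ultimately show ?thesis using u by (simp add: fact_numeral)
  qed
  have pi: "2 \<le> pi" using pi_ge_two .
  show "d \<le> line_angle x y"
  proof -
    have "1 - d\<^sup>2 / 2 \<le> cos d"
    proof -
      have "(sin (d / 2))\<^sup>2 \<le> (d / 2)\<^sup>2"
        using d0 d(2) pi sin_x_le_x[of "d / 2"] by (intro power_mono sin_ge_zero) auto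
      then show ?thesis using cos_double_sin[of "d / 2"] by (simp add: power2_eq_square)
    qed
    then have "arccos (cos d) \<le> arccos (1 - d\<^sup>2/2)" using d2 by (intro arccos_le_arccos) auto
    then show ?thesis using d0 d(2) pi by (simp add: la arccos_cos)
  qed
  show "line_angle x y \<le> d * (1 + d)"
  proof -
    \<comment> \<open>Since d is at most 1, this is at most 2 and so below pi, where the arc cosine
      inverts the cosine.\<close>
    let ?z = "d * (1 + d)"
    have z: "0 \<le> ?z" "?z \<le> 2" using d0 d(2) mult_mono[of d 1 "1 + d" 2] by auto
    have "cos ?z \<le> 1 - ?z\<^sup>2 / 2 + ?z ^ 4 / 24" by (rule cosb)
    \<comment> \<open>After division by d^2/24 the claim is d^2 (1 + d)^4 <= 24 d + 12 d^2, and (1 +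
      d)^4 is at most 16.\<close>
    also have "\<dots> \<le> 1 - d\<^sup>2 / 2"
    proof -
      have "(1 + d) ^ 4 \<le> 2 ^ 4" using d0 d(2) by (intro power_mono) auto
      then have "d\<^sup>2 * (1 + d) ^ 4 \<le> d\<^sup>2 * 16" by (intro mult_left_mono) auto
      also have "\<dots> \<le> 24 * d + 12 * d\<^sup>2"
        using mult_mono[of d 1 d d] d0 d(2) by (simp add: power2_eq_square)
      finally have "0 \<le> (24 * d + 12 * d\<^sup>2 - d\<^sup>2 * (1 + d) ^ 4) * d\<^sup>2 / 24"
        by simp
      also have "\<dots> = ?z\<^sup>2 / 2 - ?z ^ 4 / 24 - d\<^sup>2 / 2"
        by (simp add: power_mult_distrib) (simp add: power2_eq_square power4_eq_xxxx field_simps)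
      finally show ?thesis by simp
    qed
    finally have "arccos (1 - d\<^sup>2/2) \<le> arccos (cos ?z)" using d2 by (intro arccos_le_arccos) auto
    then show ?thesis using z pi by (simp add: la arccos_cos)
  qed
qed

text \<open>A vertex on the segment between its neighbours would make the two adjacent segment
  vectors parallel, so nonzero cross products keep every vertex.\<close>

lemma straighten_id:
  fixes vs :: "(real^3) list"
  assumes "\<And>i. i + 2 < length vs \<Longrightarrow> cross3 (vs ! (i + 1) - vs ! i) (vs ! (i + 2) - vs ! (i + 1)) \<noteq> 0"
  shows "straighten vs = vs"
  using assms
proof (induction vs rule: straighten.induct)
  case (1 u v w vs)
  have "v \<notin> closed_segment u w"
  proof
    assume "v \<in> closed_segment u w"
    then obtain r where "v = (1 - r) *\<^sub>R u + r *\<^sub>R w" by (auto simp: closed_segment_def)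
    then have "v - u = r *\<^sub>R (w - u)" "w - v = (1 - r) *\<^sub>R (w - u)" by (auto simp: algebra_simps)
    then have "cross3 (v - u) (w - v) = 0" by (simp add: cross_mult_left cross_mult_right)
    then show False using "1.prems"[of 0] by simp
  qed
  moreover have "straighten (v # w # vs) = v # w # vs"
  proof (rule "1.IH"(2))
    fix i assume "i + 2 < length (v # w # vs)"
    then show "cross3 ((v # w # vs) ! (i + 1) - (v # w # vs) ! i) ((v # w # vs) ! (i + 2) - (v # w # vs) ! (i + 1)) \<noteq> 0"
      using "1.prems"[of "Suc i"] by simp
  qed (use calculation in simp)
  ultimately show ?case by simp
qed auto

lemma norm_diff_le_sum:
  fixes f :: "nat \<Rightarrow> 'a::real_normed_vector"
  assumes "p \<le> q"
  shows "norm (f q - f p) \<le> (\<Sum>i\<in>{p<..q}. norm (f i - f (i - 1)))"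
  using assms
proof (induction q rule: dec_induct)
  case (step q)
  have "{p<..Suc q} = insert (Suc q) {p<..q}" using step by auto
  then show ?case using step norm_triangle_ineq[of "f (Suc q) - f q" "f q - f p"] by simp
qed simp

text \<open>The triangle inequality in blocks of length \<open>m\<close>. The block before index
  \<open>m\<close> is left out because a polygon has no normal at its first vertex.\<close>

lemma sum_blocks_le:
  fixes f :: "nat \<Rightarrow> 'a::real_normed_vector"
  shows "(\<Sum>k<K. norm (f ((k + 2) * m) - f ((k + 1) * m))) \<le> (\<Sum>i\<in>{m<..(K + 1) * m}. norm (f i - f (i - 1)))"
proof (induction K)
  case (Suc K)
  have "{m<..(Suc K + 1) * m} = {m<..(K + 1) * m} \<union> {(K + 1) * m<..(K + 2) * m}" by (auto simp: algebra_simps)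
  then have "(\<Sum>i\<in>{m<..(Suc K + 1) * m}. norm (f i - f (i - 1))) = (\<Sum>i\<in>{m<..(K + 1) * m}. norm (f i - f (i - 1)))
     + (\<Sum>i\<in>{(K + 1) * m<..(K + 2) * m}. norm (f i - f (i - 1)))"
    by (simp only:) (rule sum.union_disjoint, auto)
  then show ?case using Suc norm_diff_le_sum[of "(K + 1) * m" "(K + 2) * m" f] by simp
qed simp

section \<open>Normals of the osculating planes of a polygon\<close>

context frame_curve
begin

definition bivector :: "real \<Rightarrow> real \<Rightarrow> real \<Rightarrow> real^3" where
  "bivector x y z = cross3 (\<gamma> y - \<gamma> x) (\<gamma> z - \<gamma> y)"

text \<open>Two accuracies are recorded. The distance from the hat average is of second order and
  can be summed along the polygon; the distance from \<open>b y\<close> is only of first order, but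
  it bounds the length from below and excludes zero.\<close>

lemma bivector_scaled:
  assumes "0 \<le> x" "x < y" "y < z" "z \<le> L" and e: "rot x z \<le> e" "e \<le> 1/20"
  defines "X \<equiv> (1 / weight x y z) *\<^sub>R bivector x y z"
  shows "norm (X - mean x y z b) \<le> 3 * e * rot x z" "1 - 4 * e \<le> norm X" "norm (X - b y) \<le> 4 * e"
    "sgn (bivector x y z) = sgn X" "bivector x y z \<noteq> 0"
proof -
  have w: "weight x y z > 0" using assms by (intro weight_pos) auto
  have r0: "0 \<le> rot x z" by simp
  have e0: "0 \<le> e" using e r0 by linarith
  have ce: "curv x z \<le> e" "tors x z \<le> e" using e nonneg[of x z] unfolding rot_def by linarith+
  have "X - mean x y z b = (1 / weight x y z) *\<^sub>R (bivector x y z - M.hat_integral x y z b)"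
    by (simp add: X_def mean_def scaleR_diff_right)
  then have "norm (X - mean x y z b) \<le> (1 / weight x y z) * (3 * curv x z * rot x z * weight x y z)"
    using w chord_cross_estimate[OF assms(1-4)] by (simp add: bivector_def divide_le_eq)
  also have "\<dots> = 3 * curv x z * rot x z" using w by simp
  also have "\<dots> \<le> 3 * e * rot x z" using ce(1) by (intro mult_right_mono mult_left_mono) simp_all
  finally show 1: "norm (X - mean x y z b) \<le> 3 * e * rot x z" .
  \<comment> \<open>At most 3e/20; together with the torsion term \<open>e\<close> this stays below
    \<open>4 * e\<close>.\<close>
  have "3 * e * rot x z \<le> 3 * e * (1/20)"
  proof (rule mult_left_mono)
    show "rot x z \<le> 1/20" using e by linarith
    show "0 \<le> 3 * e" using e0 by simp
  qed
  then show 2: "norm (X - b y) \<le> 4 * e"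
    using 1 mean_b_near[OF assms(1-4)] ce norm_triangle_ineq[of "X - mean x y z b" "mean x y z b - b y"] e0 by simp
  show 3: "1 - 4 * e \<le> norm X"
    using 2 norm_triangle_ineq2[of "b y" X] norms(3)[of y] by (simp add: norm_minus_commute)
  show "sgn (bivector x y z) = sgn X" using w by (simp add: X_def sgn_scaleR)
  show "bivector x y z \<noteq> 0" using 3 e by (auto simp: X_def)
qed

lemma bivector_near:
  assumes "0 \<le> x" "x < y" "y < z" "z \<le> L" and e: "rot x z \<le> e" "e \<le> 1/20"
  shows "norm (sgn (bivector x y z) - b y) \<le> 8 * e"
  using bivector_scaled[OF assms] norm_sgn_diff_unit_le[OF norms(3)[of y], of "(1 / weight x y z) *\<^sub>R bivector x y z"]
  by simp

text \<open>Both scaled normals have length at least \<open>1 - 4 * e\<close>, so normalising them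
  costs only this factor, which tends to 1. A crude factor 2 would spoil the sharp upper
  bound.\<close>

lemma bivector_turn:
  assumes "0 \<le> x" "x < y" "y < z" "z < w" "w \<le> L" and e: "rot x z \<le> e" "rot y w \<le> e" "e \<le> 1/20"
  shows "(1 - 4 * e) * norm (sgn (bivector y z w) - sgn (bivector x y z))
     \<le> mean y z w cum - mean x y z cum + 3 * e * (rot x z + rot y w)"
proof -
  define X where "X = (1 / weight x y z) *\<^sub>R bivector x y z"
  define Z where "Z = (1 / weight y z w) *\<^sub>R bivector y z w"
  note X = bivector_scaled[of x y z e, folded X_def] and Z = bivector_scaled[of y z w e, folded Z_def]
  have "(1 - 4 * e) * norm (sgn Z - sgn X) \<le> norm (Z - X)"
    using assms X Z by (intro norm_sgn_diff_le) auto
  also have "Z - X = (Z - mean y z w b) + (mean y z w b - mean x y z b) - (X - mean x y z b)" by simp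
  also have "norm \<dots> \<le> norm (Z - mean y z w b) + norm (mean y z w b - mean x y z b) + norm (X - mean x y z b)"
    by (meson norm_triangle_ineq norm_triangle_ineq4 order_trans add_right_mono)
  also have "\<dots> \<le> 3 * e * rot y w + (mean y z w cum - mean x y z cum) + 3 * e * rot x z"
    using assms X(1) Z(1) mean_b_diff[of x y z w] by (intro add_mono) auto
  finally show ?thesis using X(4) Z(4) assms by (simp add: algebra_simps)
qed

text \<open>Comparing with \<open>b\<close> at the two middle vertices gives 8 + 1 + 8. This crude
  bound only serves to bring the normals close enough for angle and chord to be comparable.\<close>

lemma bivector_small_turn:
  assumes "0 \<le> x" "x < y" "y < z" "z < w" "w \<le> L" and e: "rot x z \<le> e" "rot y w \<le> e" "e \<le> 1/20"
  shows "norm (sgn (bivector y z w) - sgn (bivector x y z)) \<le> 17 * e"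
proof -
  have nb: "norm (b z - b y) \<le> e"
    using b_lipschitz[of y z] sub_mono(2)[of x y z z] assms(1-4) e(1) nonneg[of x z] unfolding rot_def by linarith
  have nz: "norm (sgn (bivector y z w) - b z) \<le> 8 * e" and ny: "norm (sgn (bivector x y z) - b y) \<le> 8 * e"
    using assms by (auto intro!: bivector_near)
  have eq: "sgn (bivector y z w) - sgn (bivector x y z)
     = (sgn (bivector y z w) - b z) + (b z - b y) - (sgn (bivector x y z) - b y)" by simp
  have "norm (sgn (bivector y z w) - sgn (bivector x y z))
      \<le> norm (sgn (bivector y z w) - b z) + norm (b z - b y) + norm (sgn (bivector x y z) - b y)"
    unfolding eq by (meson norm_triangle_ineq norm_triangle_ineq4 order_trans add_right_mono)
  with nb nz ny show ?thesis by linarith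
qed

end

section \<open>Fine polygons, meshes and grids\<close>

context frame_curve
begin

text \<open>The injection \<open>f\<close> allows shifted indices: overlapping triples are split
  into single gaps, and each of the resulting shifted families uses a gap at most once.\<close>

lemma sum_gaps_le:
  fixes s :: "nat \<Rightarrow> real"
  assumes s: "\<And>k. k < m \<Longrightarrow> s k < s (Suc k)" "s 0 = 0" "s m = L"
    and f: "inj_on f A" "f ` A \<subseteq> {..<m}"
  shows "(\<Sum>i\<in>A. rot (s (f i)) (s (Suc (f i)))) \<le> rot 0 L"
proof -
  have s': "\<And>k. k < m \<Longrightarrow> s k \<le> s (Suc k)" using s(1) less_imp_le by blast
  have "(\<Sum>i\<in>A. rot (s (f i)) (s (Suc (f i)))) = (\<Sum>k\<in>f ` A. rot (s k) (s (Suc k)))"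
    using f(1) by (simp add: sum.reindex)
  also have "\<dots> \<le> (\<Sum>k<m. rot (s k) (s (Suc k)))"
    using f(2) by (intro sum_mono2) auto
  also have "\<dots> = rot 0 L"
    using measure_Ioc_sum[OF M, of UNIV m s] measure_Ioc_sum[OF P, of UNIV m s] measure_Ioc_sum[OF N, of UNIV m s] s' s(2,3)
    by (simp add: rot_def curv_def tors_def sum.distrib)
  finally show ?thesis .
qed

lemma subdivision_nth:
  assumes "subdivision 0 L ss"
  shows "\<And>k. Suc k < length ss \<Longrightarrow> ss ! k < ss ! Suc k" "ss ! 0 = 0" "ss ! (length ss - 1) = L" "length ss \<ge> 2"
    "\<And>k. k < length ss \<Longrightarrow> 0 \<le> ss ! k \<and> ss ! k \<le> L"
proof -
  have ne: "ss \<noteq> []" and hd: "hd ss = 0" and last: "last ss = L" and srt: "sorted_wrt (<) ss"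
    using assms by (auto simp: subdivision_def)
  show "ss ! k < ss ! Suc k" if "Suc k < length ss" for k
    using sorted_wrt_nth_less[OF srt] that by simp
  show s0: "ss ! 0 = 0" using ne hd by (simp add: hd_conv_nth)
  show sn: "ss ! (length ss - 1) = L" using ne last by (simp add: last_conv_nth)
  have "length ss \<noteq> 0" "length ss \<noteq> 1" using ne s0 sn L by auto
  then show "length ss \<ge> 2" by linarith
  have le: "ss ! i \<le> ss ! j" if "i \<le> j" "j < length ss" for i j
    using sorted_wrt_nth_less[OF srt, of i j] that by (cases "i = j") auto
  show "0 \<le> ss ! k \<and> ss ! k \<le> L" if "k < length ss" for k
    using le[of 0 k] le[of k "length ss - 1"] that s0 sn by auto
qed

text \<open>In the upper bound, \<open>1 + 17 * e\<close> is the ratio of angle to chord,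
  \<open>1 - 4 * e\<close> comes from normalising, and 12 is 3 times the multiplicity 1 + 2 + 1 with
  which the three gaps of two overlapping triples occur. The last two claims prepare the lower
  bound.\<close>

lemma fine_polygon:
  assumes e: "0 < e" "e \<le> 1/20"
    and ss: "subdivision 0 L ss"
    and fine: "\<And>x y. 0 \<le> x \<Longrightarrow> x \<le> y \<Longrightarrow> y \<le> L \<Longrightarrow> y - x < \<delta> \<Longrightarrow> rot x y < e"
    and gaps: "\<And>i. Suc i < length ss \<Longrightarrow> ss ! Suc i - ss ! i < \<delta> / 2"
  defines "\<beta> \<equiv> \<lambda>i. sgn (bivector (ss ! (i - 1)) (ss ! i) (ss ! Suc i))"
  shows "straighten (map \<gamma> ss) = map \<gamma> ss" "admissible_polygon (map \<gamma> ss)"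
    "TAT_polygon (map \<gamma> ss) \<le> (1 + 17 * e) / (1 - 4 * e) * (tors 0 L + 12 * e * rot 0 L)"
    "\<And>i. 1 \<le> i \<Longrightarrow> Suc i < length ss \<Longrightarrow> norm (\<beta> i - b (ss ! i)) \<le> 8 * e"
    "(\<Sum>i\<in>{2..length ss - 2}. norm (\<beta> i - \<beta> (i - 1))) \<le> TAT_polygon (map \<gamma> ss)"
proof -
  note s = subdivision_nth[OF ss]
  define m where "m = length ss - 1"
  have len: "length ss = Suc m" "m \<ge> 1" using s(4) by (auto simp: m_def)
  define B where "B i = bivector (ss ! (i - 1)) (ss ! i) (ss ! Suc i)" for i
  have tri: "0 \<le> ss ! (i - 1) \<and> ss ! (i - 1) < ss ! i \<and> ss ! i < ss ! Suc i \<and> ss ! Suc i \<le> L \<and>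
      rot (ss ! (i - 1)) (ss ! Suc i) \<le> e" if i: "1 \<le> i" "i < m" for i
  proof -
    have "ss ! (i - 1) < ss ! i" "ss ! i < ss ! Suc i" "0 \<le> ss ! (i - 1)" "ss ! Suc i \<le> L"
      using s(1)[of "i - 1"] s(1)[of i] s(5)[of "i - 1"] s(5)[of "Suc i"] i len by auto
    \<comment> \<open>A triple spans two gaps, hence the bound by half of
      \<open>\<delta>\<close>.\<close>
    moreover have "ss ! Suc i - ss ! (i - 1) < \<delta>"
      using gaps[of "i - 1"] gaps[of i] i len by auto
    ultimately show ?thesis using fine[of "ss ! (i - 1)" "ss ! Suc i"] by auto
  qed
  have B0: "B i \<noteq> 0" if "1 \<le> i" "i < m" for i
    unfolding B_def using tri[OF that] e by (intro bivector_scaled(5)) auto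
  have cr: "cross3 (seg (map \<gamma> ss) i) (seg (map \<gamma> ss) (i + 1)) = B i" if "1 \<le> i" "i < m" for i
    using that len by (simp add: seg_def B_def bivector_def)
  show st: "straighten (map \<gamma> ss) = map \<gamma> ss"
  proof (rule straighten_id)
    fix i assume "i + 2 < length (map \<gamma> ss)"
    then have i: "1 \<le> i + 1" "i + 1 < m" using len by auto
    show "cross3 (map \<gamma> ss ! (i + 1) - map \<gamma> ss ! i) (map \<gamma> ss ! (i + 2) - map \<gamma> ss ! (i + 1)) \<noteq> 0"
      using B0[OF i] cr[OF i] i len by (simp add: seg_def)
  qed
  show "admissible_polygon (map \<gamma> ss)"
    unfolding admissible_polygon_def
  proof (intro conjI ballI)
    fix i assume "i \<in> {1..length (map \<gamma> ss) - 1}"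
    then have i: "1 \<le> i" "i \<le> m" using len by auto
    define x y where "x = ss ! (i - 1)" and "y = ss ! i"
    have xy: "x < y" "0 \<le> x" "y \<le> L" "y - x < \<delta> / 2"
      using s(1)[of "i - 1"] s(5)[of "i - 1"] s(5)[of i] gaps[of "i - 1"] i len by (auto simp: x_def y_def)
    have "rot x y < e" using xy by (intro fine) auto
    \<comment> \<open>A gap with curvature below 1 cannot close up: the chord differs from
      \<open>(y - x) *\<^sub>R t x\<close> by less than the length of that vector.\<close>
    then have "curv x y < 1" using e nonneg(2)[of x y] unfolding rot_def by linarith
    then have "(y - x) * curv x y < y - x" using xy by simp
    moreover have "norm (\<gamma> y - \<gamma> x - (y - x) *\<^sub>R t x) \<le> (y - x) * curv x y" using xy by (intro curve_lipschitz) auto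
    ultimately have "\<gamma> y - \<gamma> x \<noteq> 0" using xy by (auto simp: norms)
    then show "seg (map \<gamma> ss) i \<noteq> 0" using i len by (simp add: seg_def x_def y_def)
  next
    fix i assume "i \<in> {1..length (map \<gamma> ss) - 2}"
    then have i: "1 \<le> i" "i < m" using len by auto
    show "cross3 (seg (map \<gamma> ss) i) (seg (map \<gamma> ss) (i + 1)) \<noteq> 0" using B0[OF i] cr[OF i] by simp
  qed
  show "norm (\<beta> i - b (ss ! i)) \<le> 8 * e" if "1 \<le> i" "Suc i < length ss" for i
    unfolding \<beta>_def using tri[of i] that len e by (intro bivector_near) auto
  have TAT: "TAT_polygon (map \<gamma> ss) = (\<Sum>i\<in>{2..m - 1}. line_angle (B (i - 1)) (B i))"
    unfolding TAT_polygon_def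
  proof (rule sum.cong)
    show "{2..length (map \<gamma> ss) - 2} = {2..m - 1}" using len by auto
    fix i assume i: "i \<in> {2..m - 1}"
    then show "line_angle (cross3 (seg (map \<gamma> ss) (i - 1)) (seg (map \<gamma> ss) i)) (cross3 (seg (map \<gamma> ss) i) (seg (map \<gamma> ss) (i + 1)))
       = line_angle (B (i - 1)) (B i)"
      using cr[of "i - 1"] cr[of i] by auto
  qed
  have lens: "length ss - 2 = m - 1" using len by simp
  have idx: "1 \<le> i - 1" "i - 1 < m" "1 \<le> i" "i < m" "Suc (i - 1) = i" "i - 1 - 1 = i - 2" "Suc (i - 2) = i - 1"
    if "i \<in> {2..m - 1}" for i using that by auto
  have small: "norm (\<beta> i - \<beta> (i - 1)) \<le> 17 * e" if i: "i \<in> {2..m - 1}" for i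
    unfolding \<beta>_def using tri[of i] tri[of "i - 1"] idx[OF i] e
    by (auto intro!: bivector_small_turn)
  have ang: "norm (\<beta> i - \<beta> (i - 1)) \<le> line_angle (B (i - 1)) (B i) \<and>
     line_angle (B (i - 1)) (B i) \<le> (1 + 17 * e) * norm (\<beta> i - \<beta> (i - 1))" if i: "i \<in> {2..m - 1}" for i
  proof -
    have 1: "norm (sgn (B (i - 1)) - sgn (B i)) = norm (\<beta> i - \<beta> (i - 1))"
      by (simp add: \<beta>_def B_def norm_minus_commute)
    \<comment> \<open>The bound 1/20 on \<open>e\<close> is chosen so that \<open>17 * e\<close>
      stays below 1.\<close>
    have 2: "norm (\<beta> i - \<beta> (i - 1)) \<le> 1" using small[OF i] e by linarith
    note la = line_angle_bounds[OF B0[OF idx(1,2)[OF i]] B0[OF idx(3,4)[OF i]] 1 2]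
    have "norm (\<beta> i - \<beta> (i - 1)) * (1 + norm (\<beta> i - \<beta> (i - 1))) \<le> norm (\<beta> i - \<beta> (i - 1)) * (1 + 17 * e)"
      using small[OF i] by (intro mult_left_mono) auto
    with la show ?thesis by (simp add: mult.commute)
  qed
  show "(\<Sum>i\<in>{2..length ss - 2}. norm (\<beta> i - \<beta> (i - 1))) \<le> TAT_polygon (map \<gamma> ss)"
    unfolding TAT lens using ang by (intro sum_mono) auto
  define \<mu> where "\<mu> i = mean (ss ! (i - 1)) (ss ! i) (ss ! Suc i) cum" for i
  define \<rho> where "\<rho> i = rot (ss ! i) (ss ! Suc i)" for i
  have turn: "(1 - 4 * e) * norm (\<beta> i - \<beta> (i - 1)) \<le> \<mu> i - \<mu> (i - 1) + 3 * e * (\<rho> (i - 2) + 2 * \<rho> (i - 1) + \<rho> i)"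
    if i: "i \<in> {2..m - 1}" for i
  proof -
    \<comment> \<open>Counting from the first vertex of the two triples avoids truncated
      subtraction.\<close>
    define j where "j = i - 2"
    have j: "i = Suc (Suc j)" using i by (auto simp: j_def)
    have T: "0 \<le> ss ! j" "ss ! j < ss ! Suc j" "ss ! Suc j < ss ! Suc (Suc j)" "ss ! Suc (Suc j) < ss ! Suc (Suc (Suc j))"
      "ss ! Suc (Suc (Suc j)) \<le> L" "rot (ss ! j) (ss ! Suc (Suc j)) \<le> e" "rot (ss ! Suc j) (ss ! Suc (Suc (Suc j))) \<le> e"
      using tri[of "Suc j"] tri[of "Suc (Suc j)"] i by (auto simp: j)
    have "(1 - 4 * e) * norm (\<beta> i - \<beta> (i - 1)) \<le> \<mu> i - \<mu> (i - 1)
        + 3 * e * (rot (ss ! j) (ss ! Suc (Suc j)) + rot (ss ! Suc j) (ss ! Suc (Suc (Suc j))))"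
      using bivector_turn[OF T(1-7) e(2)] by (simp add: \<beta>_def \<mu>_def j)
    moreover have "rot (ss ! j) (ss ! Suc (Suc j)) = \<rho> j + \<rho> (Suc j)"
      using additive(3)[of "ss ! j" "ss ! Suc j" "ss ! Suc (Suc j)"] T by (simp add: \<rho>_def)
    moreover have "rot (ss ! Suc j) (ss ! Suc (Suc (Suc j))) = \<rho> (Suc j) + \<rho> (Suc (Suc j))"
      using additive(3)[of "ss ! Suc j" "ss ! Suc (Suc j)" "ss ! Suc (Suc (Suc j))"] T by (simp add: \<rho>_def)
    ultimately show ?thesis by (simp add: j algebra_simps)
  qed
  have gap: "(\<Sum>i\<in>{2..m - 1}. \<rho> (f i)) \<le> rot 0 L" if "inj_on f {2..m - 1}" "f ` {2..m - 1} \<subseteq> {..<m}" for f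
    unfolding \<rho>_def using s len that by (intro sum_gaps_le[where m=m]) auto
  have g1: "(\<Sum>i\<in>{2..m - 1}. \<rho> (i - 2)) \<le> rot 0 L" by (rule gap) (auto simp: inj_on_def)
  have g2: "(\<Sum>i\<in>{2..m - 1}. \<rho> (i - 1)) \<le> rot 0 L" by (rule gap) (auto simp: inj_on_def)
  have g3: "(\<Sum>i\<in>{2..m - 1}. \<rho> i) \<le> rot 0 L" by (rule gap) (auto simp: inj_on_def)
  \<comment> \<open>For a single segment there is no triple at index 1, so the telescoped form makes
    sense only from two segments on.\<close>
  have tele: "(\<Sum>i\<in>{2..m - 1}. \<mu> i - \<mu> (i - 1)) \<le> tors 0 L"
  proof (cases "1 \<le> m - 1")
    case True
    have "(\<Sum>i\<in>{Suc 1..m - 1}. \<mu> i - \<mu> (i - 1)) = \<mu> (m - 1) - \<mu> 1"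
      using True by (rule sum_telescope'')
    also have "\<dots> \<le> cum L - cum 0"
      unfolding \<mu>_def using True tri[of "m - 1"] tri[of 1]
      by (intro diff_mono mean_cum_bounds) auto
    also have "\<dots> = tors 0 L" using L by (simp add: cum_diff)
    finally show ?thesis by (simp add: numeral_2_eq_2)
  qed auto
  have "(1 - 4 * e) * (\<Sum>i\<in>{2..m - 1}. norm (\<beta> i - \<beta> (i - 1)))
      \<le> (\<Sum>i\<in>{2..m - 1}. \<mu> i - \<mu> (i - 1) + 3 * e * (\<rho> (i - 2) + 2 * \<rho> (i - 1) + \<rho> i))"
    unfolding sum_distrib_left using turn by (intro sum_mono) auto
  also have "\<dots> = (\<Sum>i\<in>{2..m - 1}. \<mu> i - \<mu> (i - 1)) + 3 * e * ((\<Sum>i\<in>{2..m - 1}. \<rho> (i - 2)) + 2 * (\<Sum>i\<in>{2..m - 1}. \<rho> (i - 1)) + (\<Sum>i\<in>{2..m - 1}. \<rho> i))"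
    by (simp only: sum.distrib sum_distrib_left[symmetric])
  also have "\<dots> \<le> tors 0 L + 3 * e * (rot 0 L + 2 * rot 0 L + rot 0 L)"
    using e by (intro add_mono tele mult_left_mono g1 g2 g3) auto
  finally have S: "(\<Sum>i\<in>{2..m - 1}. norm (\<beta> i - \<beta> (i - 1))) \<le> (tors 0 L + 12 * e * rot 0 L) / (1 - 4 * e)"
    using e by (simp add: pos_le_divide_eq ac_simps)
  have "TAT_polygon (map \<gamma> ss) \<le> (\<Sum>i\<in>{2..m - 1}. (1 + 17 * e) * norm (\<beta> i - \<beta> (i - 1)))"
    unfolding TAT using ang by (intro sum_mono) auto
  also have "\<dots> = (1 + 17 * e) * (\<Sum>i\<in>{2..m - 1}. norm (\<beta> i - \<beta> (i - 1)))" by (simp add: sum_distrib_left)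
  also have "\<dots> \<le> (1 + 17 * e) * ((tors 0 L + 12 * e * rot 0 L) / (1 - 4 * e))"
    using e by (intro mult_left_mono S) auto
  finally show "TAT_polygon (map \<gamma> ss) \<le> (1 + 17 * e) / (1 - 4 * e) * (tors 0 L + 12 * e * rot 0 L)" by simp
qed

text \<open>The mesh measures arcs in space, whereas the estimates need short parameter intervals.
  An arc of parameter length \<open>d\<close> with curvature below 1/2 has a chord of length at
  least d/2, so a long gap would be visible in the mesh.\<close>

lemma mesh_imp_gaps:
  assumes "\<delta> > 0"
  obtains \<epsilon> where "\<epsilon> > 0" "\<And>ss i. subdivision 0 L ss \<Longrightarrow> mesh \<gamma> ss < \<epsilon> \<Longrightarrow> Suc i < length ss \<Longrightarrow> ss ! Suc i - ss ! i < \<delta>"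
proof -
  obtain \<delta>1 where \<delta>1: "\<delta>1 > 0" "\<And>x y. 0 \<le> x \<Longrightarrow> x \<le> y \<Longrightarrow> y \<le> L \<Longrightarrow> y - x < \<delta>1 \<Longrightarrow> rot x y < 1/2"
    using small_gaps[of "1/2"] by auto
  \<comment> \<open>Halving \<open>\<delta>1\<close> makes an interval of length exactly
    \<open>d\<close> strictly shorter than \<open>\<delta>1\<close>.\<close>
  define d where "d = min \<delta> (\<delta>1 / 2)"
  have d: "d > 0" "d \<le> \<delta>" "d < \<delta>1" using assms \<delta>1 by (auto simp: d_def)
  show ?thesis
  proof (rule that)
    show "d / 2 > 0" using d by simp
    fix ss i assume ss: "subdivision 0 L ss" and mesh: "mesh \<gamma> ss < d / 2" and i: "Suc i < length ss"
    note s = subdivision_nth[OF ss]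
    show "ss ! Suc i - ss ! i < \<delta>"
    proof (rule ccontr)
      assume "\<not> ?thesis"
      then have ge: "d \<le> ss ! Suc i - ss ! i" using d by simp
      define x where "x = ss ! i"
      have x: "0 \<le> x" "x + d \<le> L" "x + d \<le> ss ! Suc i" using s(5)[of i] s(5)[of "Suc i"] i ge by (auto simp: x_def)
      have "rot x (x + d) < 1/2" using x d by (intro \<delta>1) auto
      then have "curv x (x + d) \<le> 1/2" using nonneg(2)[of x "x + d"] unfolding rot_def by linarith
      then have "d * curv x (x + d) \<le> d * (1/2)" using d by (intro mult_left_mono) auto
      moreover have "norm (\<gamma> (x + d) - \<gamma> x - d *\<^sub>R t x) \<le> d * curv x (x + d)"
        using curve_lipschitz[of x "x + d"] x d by simp
      moreover have "d - norm (\<gamma> (x + d) - \<gamma> x) \<le> norm (\<gamma> (x + d) - \<gamma> x - d *\<^sub>R t x)"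
        using norm_triangle_ineq2[of "d *\<^sub>R t x" "\<gamma> (x + d) - \<gamma> x"] d norms(1)[of x] by (simp add: norm_minus_commute)
      ultimately have "d / 2 \<le> dist (\<gamma> (x + d)) (\<gamma> x)" by (simp add: dist_norm)
      also have "\<dots> \<le> diameter (\<gamma> ` {ss ! i..ss ! Suc i})"
      proof (rule diameter_bounded_bound)
        have "{ss ! i..ss ! Suc i} \<subseteq> {0..L}" using s(5)[of i] s(5)[of "Suc i"] i by auto
        then show "bounded (\<gamma> ` {ss ! i..ss ! Suc i})"
          by (intro compact_imp_bounded compact_continuous_image continuous_on_subset[OF curve_cont]) auto
      qed (use x d in \<open>auto simp: x_def\<close>)
      also have "\<dots> \<le> mesh \<gamma> ss"
        unfolding mesh_def
      proof (rule Max_ge)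
        have "{diameter (\<gamma> ` {ss ! i..ss ! Suc i}) |i. Suc i < length ss} = (\<lambda>i. diameter (\<gamma> ` {ss ! i..ss ! Suc i})) ` {i. Suc i < length ss}" by auto
        moreover have "finite {i. Suc i < length ss}" by (rule finite_subset[of _ "{..length ss}"]) auto
        ultimately show "finite {diameter (\<gamma> ` {ss ! i..ss ! Suc i}) |i. Suc i < length ss}" by simp
      qed (use i in auto)
      finally show False using mesh by simp
    qed
  qed
qed

text \<open>The curve is Lipschitz with constant \<open>1 + rot 0 L\<close>; raising the constant by
  one makes the inequality strict.\<close>

lemma gaps_imp_mesh:
  assumes ss: "subdivision 0 L ss" and gaps: "\<And>i. Suc i < length ss \<Longrightarrow> ss ! Suc i - ss ! i < h" and "h > 0"
  shows "mesh \<gamma> ss < h * (2 + rot 0 L)"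
proof -
  note s = subdivision_nth[OF ss]
  let ?S = "{diameter (\<gamma> ` {ss ! i..ss ! Suc i}) |i. Suc i < length ss}"
  have "?S = (\<lambda>i. diameter (\<gamma> ` {ss ! i..ss ! Suc i})) ` {i. Suc i < length ss}" by auto
  moreover have "finite {i. Suc i < length ss}" by (rule finite_subset[of _ "{..length ss}"]) auto
  ultimately have fin: "finite ?S" by simp
  have ne: "?S \<noteq> {}" using s(4) by (auto intro!: exI[of _ 0])
  have pos: "0 < h * (2 + rot 0 L)" using \<open>h > 0\<close> nonneg(3)[of 0 L] by (intro mult_pos_pos) linarith+
  have "d \<le> h * (1 + rot 0 L)" if dS: "d \<in> ?S" for d
  proof -
    obtain i where i: "Suc i < length ss" "d = diameter (\<gamma> ` {ss ! i..ss ! Suc i})" using dS by blast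
    have lip: "norm (\<gamma> y - \<gamma> x) \<le> h * (1 + rot 0 L)" if xy: "ss ! i \<le> x" "x \<le> y" "y \<le> ss ! Suc i" for x y
    proof -
      have r: "0 \<le> x" "y \<le> L" using xy s(5)[of i] s(5)[of "Suc i"] i by auto
      have "norm (\<gamma> y - \<gamma> x) \<le> norm (\<gamma> y - \<gamma> x - (y - x) *\<^sub>R t x) + norm ((y - x) *\<^sub>R t x)"
        using norm_triangle_ineq[of "\<gamma> y - \<gamma> x - (y - x) *\<^sub>R t x" "(y - x) *\<^sub>R t x"] by simp
      also have "\<dots> \<le> (y - x) * curv x y + (y - x)"
        using curve_lipschitz[of x y] r xy by (intro add_mono) (auto simp: norms)
      also have "\<dots> = (y - x) * (1 + curv x y)" by (simp add: algebra_simps)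
      also have "\<dots> \<le> h * (1 + rot 0 L)"
      proof (intro mult_mono add_left_mono)
        show "y - x \<le> h" using gaps[OF i(1)] xy by simp
        have "curv x y \<le> curv 0 L" using xy r by (intro sub_mono) auto
        then show "curv x y \<le> rot 0 L" using nonneg(2)[of 0 L] unfolding rot_def by linarith
      qed (use xy \<open>h > 0\<close> in auto)
      finally show ?thesis .
    qed
    show "d \<le> h * (1 + rot 0 L)"
      unfolding i(2)
    proof (rule diameter_le)
      fix u v assume "u \<in> \<gamma> ` {ss ! i..ss ! Suc i}" "v \<in> \<gamma> ` {ss ! i..ss ! Suc i}"
      then obtain x y where "u = \<gamma> x" "v = \<gamma> y" "x \<in> {ss ! i..ss ! Suc i}" "y \<in> {ss ! i..ss ! Suc i}" by auto
      then show "norm (u - v) \<le> h * (1 + rot 0 L)"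
        using lip[of x y] lip[of y x] by (cases "x \<le> y") (auto simp: norm_minus_commute)
    qed (use s(1)[of i] i in auto)
  qed
  then have "mesh \<gamma> ss \<le> h * (1 + rot 0 L)" unfolding mesh_def using fin ne by (subst Max_le_iff) auto
  also have "\<dots> < h * (2 + rot 0 L)" using \<open>h > 0\<close> by simp
  finally show ?thesis .
qed

text \<open>On a short cell \<open>n\<close> is almost constant, so the increment of
  \<open>b\<close> has nearly the length |P - N| of the cell, and on a fine grid these sum to P + N
  by mutual singularity. The first and last of the K + 2 cells are dropped so that all nodes lie
  inside the interval. The fine variation, the freezing of \<open>n\<close> and the two end cells
  each cost a quarter of \<open>\<epsilon>\<close>.\<close>

lemma grid_variation:
  assumes "\<epsilon> > 0"
  obtains K where "tors 0 L \<le> (\<Sum>k<K. norm (b (real (k + 2) * L / real (K + 2)) - b (real (k + 1) * L / real (K + 2)))) + \<epsilon>"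
proof -
  have e4: "\<epsilon> / 4 > 0" using assms by simp
  obtain \<delta>1 where \<delta>1: "\<delta>1 > 0" "\<forall>s m. (\<forall>k<m. s k \<le> s (Suc k) \<and> s (Suc k) - s k < \<delta>1) \<longrightarrow>
       measure P {s 0<..s m} + measure N {s 0<..s m}
         \<le> (\<Sum>k<m. \<bar>measure P {s k<..s (Suc k)} - measure N {s k<..s (Suc k)}\<bar>) + \<epsilon> / 4"
    using singular_measures_fine_variation[OF P N singular e4] by blast
  \<comment> \<open>The first entry pays for an end cell, the second for freezing \<open>n\<close>
    on all cells together; the summand 1 avoids division by zero.\<close>
  define \<eta> where "\<eta> = min (\<epsilon> / 4) (\<epsilon> / (4 * (1 + tors 0 L)))"
  have \<eta>: "\<eta> > 0" "\<eta> \<le> \<epsilon> / 4" "\<eta> * tors 0 L \<le> \<epsilon> / 4"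
  proof -
    have p: "1 + tors 0 L > 0" using nonneg(2)[of 0 L] by linarith
    show "\<eta> > 0" using assms p by (simp add: \<eta>_def)
    show "\<eta> \<le> \<epsilon> / 4" unfolding \<eta>_def by (rule min.cobounded1)
    have "\<eta> * tors 0 L \<le> \<epsilon> / (4 * (1 + tors 0 L)) * (1 + tors 0 L)"
      using p assms by (intro mult_mono) (auto simp: \<eta>_def)
    also have "\<dots> = \<epsilon> / 4" using p by (simp add: field_simps)
    finally show "\<eta> * tors 0 L \<le> \<epsilon> / 4" .
  qed
  obtain \<delta>2 where \<delta>2: "\<delta>2 > 0" "\<And>x y. 0 \<le> x \<Longrightarrow> x \<le> y \<Longrightarrow> y \<le> L \<Longrightarrow> y - x < \<delta>2 \<Longrightarrow> rot x y < \<eta>"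
    using small_gaps[OF \<eta>(1)] by metis
  define \<delta> where "\<delta> = min \<delta>1 \<delta>2"
  have "\<delta> > 0" using \<delta>1 \<delta>2 by (simp add: \<delta>_def)
  then obtain K :: nat where K: "L / \<delta> < real K" using reals_Archimedean2 by blast
  define s where "s k = real (k + 1) * L / real (K + 2)" for k
  have gap: "s (Suc k) - s k = L / real (K + 2)" for k
  proof -
    have "real (Suc k + 1) * L = real (k + 1) * L + L" by (simp add: algebra_simps)
    then show ?thesis unfolding s_def by (simp add: diff_divide_distrib[symmetric])
  qed
  have small: "L / real (K + 2) < \<delta>" "0 < L / real (K + 2)"
  proof -
    have "L < real K * \<delta>" using K \<open>\<delta> > 0\<close> by (simp add: field_simps)
    also have "\<dots> \<le> real (K + 2) * \<delta>" using \<open>\<delta> > 0\<close> by simp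
    finally show "L / real (K + 2) < \<delta>" by (simp add: pos_divide_less_eq mult.commute)
    show "0 < L / real (K + 2)" using L by simp
  qed
  have s0: "s 0 = L / real (K + 2)" by (simp add: s_def)
  have sK: "L - s K = L / real (K + 2)"
    by (simp add: s_def field_simps)
  have mono: "s i \<le> s j" if "i \<le> j" for i j
    unfolding s_def using that L by (intro divide_right_mono mult_right_mono) auto
  have each: "\<bar>measure P {s k<..s (Suc k)} - measure N {s k<..s (Suc k)}\<bar> \<le> norm (b (s (Suc k)) - b (s k)) + \<eta> * tors (s k) (s (Suc k))"
    if k: "k < K" for k
  proof -
    let ?x = "s k" and ?y = "s (Suc k)"
    have xy: "0 \<le> ?x" "?x \<le> ?y" "?y \<le> L" "?y - ?x < \<delta>2"
      using mono[of 0 k] mono[of k "Suc k"] mono[of "Suc k" K] k s0 sK small gap[of k] by (auto simp: \<delta>_def)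
    have r: "rot ?x ?y < \<eta>" using xy by (intro \<delta>2)
    have near: "norm (n u - n ?x) \<le> \<eta>" if "?x < u" "u \<le> ?y" for u
      using n_lipschitz(1)[of ?x ?x u ?y] that r by linarith
    have rem: "norm (LINT u:{?x<..?y}|Q. n u - n ?x) \<le> \<eta> * measure Q {?x<..?y}" if "finite_borel_measure Q" for Q
    proof -
      interpret Q: finite_borel_measure Q by fact
      have "norm (LINT u:{?x<..?y}|Q. n u - n ?x) \<le> (LINT u:{?x<..?y}|Q. \<eta>)"
        using near by (intro Q.set_integral_Ioc_norm_le continuous_intros cont) auto
      then show ?thesis by (simp add: Q.set_integral_Ioc_const mult.commute)
    qed
    have split: "(LINT u:{?x<..?y}|Q. n u) = measure Q {?x<..?y} *\<^sub>R n ?x + (LINT u:{?x<..?y}|Q. n u - n ?x)" if "finite_borel_measure Q" for Q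
    proof -
      interpret Q: finite_borel_measure Q by fact
      show ?thesis
        using Q.set_integral_Ioc_split_const[OF cont(2), of "\<lambda>_. 1" ?x ?y "n ?x"] by (simp add: Q.set_integral_Ioc_const)
    qed
    let ?p = "measure P {?x<..?y}" and ?n = "measure N {?x<..?y}"
    have eq: "(?n - ?p) *\<^sub>R n ?x = (b ?y - b ?x) - (LINT u:{?x<..?y}|N. n u - n ?x) + (LINT u:{?x<..?y}|P. n u - n ?x)"
      unfolding b_eq[OF xy(2)] split[OF P] split[OF N] by (simp add: algebra_simps)
    have "norm ((?n - ?p) *\<^sub>R n ?x) \<le> norm (b ?y - b ?x) + norm (LINT u:{?x<..?y}|N. n u - n ?x) + norm (LINT u:{?x<..?y}|P. n u - n ?x)"
      unfolding eq by (meson norm_triangle_ineq norm_triangle_ineq4 order_trans add_right_mono)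
    also have "norm ((?n - ?p) *\<^sub>R n ?x) = \<bar>?p - ?n\<bar>" by (simp add: norms abs_minus_commute)
    finally show ?thesis using rem[OF P] rem[OF N] by (simp add: tors_def algebra_simps)
  qed
  have sK': "0 \<le> s 0" "s 0 \<le> s K" "s K \<le> L" using s0 sK small mono[of 0 K] by auto
  have "tors (s 0) (s K) \<le> (\<Sum>k<K. \<bar>measure P {s k<..s (Suc k)} - measure N {s k<..s (Suc k)}\<bar>) + \<epsilon> / 4"
    unfolding tors_def using mono small gap by (intro \<delta>1(2)[rule_format]) (auto simp: \<delta>_def)
  also have "\<dots> \<le> (\<Sum>k<K. norm (b (s (Suc k)) - b (s k)) + \<eta> * tors (s k) (s (Suc k))) + \<epsilon> / 4"
    using each by (intro add_mono sum_mono) auto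
  also have "\<dots> = (\<Sum>k<K. norm (b (s (Suc k)) - b (s k))) + \<eta> * tors (s 0) (s K) + \<epsilon> / 4"
    using measure_Ioc_sum[OF P, of UNIV K s] measure_Ioc_sum[OF N, of UNIV K s] mono
    by (simp add: sum.distrib tors_def flip: sum_distrib_left)
  also have "\<eta> * tors (s 0) (s K) \<le> \<eta> * tors 0 L"
    using \<eta>(1) sK' by (intro mult_left_mono sub_mono) auto
  also have "\<dots> \<le> \<epsilon> / 4" by (rule \<eta>)
  finally have "tors (s 0) (s K) \<le> (\<Sum>k<K. norm (b (s (Suc k)) - b (s k))) + \<epsilon> / 4 + \<epsilon> / 4" by simp
  moreover have "tors 0 L = tors 0 (s 0) + tors (s 0) (s K) + tors (s K) L"
    using additive(2)[of 0 "s 0" L] additive(2)[of "s 0" "s K" L] sK' by simp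
  moreover have "rot 0 (s 0) < \<eta>" "rot (s K) L < \<eta>"
    using sK' s0 sK small by (auto intro!: \<delta>2 simp: \<delta>_def)
  then have "tors 0 (s 0) \<le> \<epsilon> / 4" "tors (s K) L \<le> \<epsilon> / 4"
    using \<eta>(2) nonneg(1)[of 0 "s 0"] nonneg(1)[of "s K" L] unfolding rot_def by linarith+
  ultimately have "tors 0 L \<le> (\<Sum>k<K. norm (b (s (Suc k)) - b (s k))) + \<epsilon>" by linarith
  then show ?thesis using that[of K] by (simp add: s_def add.commute)
qed

end

section \<open>Total absolute torsion\<close>

context frame_curve
begin

lemma TAT_upper:
  assumes "\<eta> > 0"
  obtains \<epsilon> where "\<epsilon> > 0" "\<And>ss. subdivision 0 L ss \<Longrightarrow> mesh \<gamma> ss < \<epsilon> \<Longrightarrow> TAT_polygon (straighten (map \<gamma> ss)) \<le> tors 0 L + \<eta>"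
proof -
  \<comment> \<open>As \<open>e\<close> tends to 0, the bound for fine polygons tends to
    \<open>tors 0 L\<close>; this determines how fine the polygon must be.\<close>
  have "((\<lambda>e. (1 + 17 * e) / (1 - 4 * e) * (tors 0 L + 12 * e * rot 0 L)) \<longlongrightarrow>
      (1 + 17 * 0) / (1 - 4 * 0) * (tors 0 L + 12 * 0 * rot 0 L)) (at_right 0)"
    by (intro tendsto_intros) auto
  then have "\<forall>\<^sub>F e in at_right 0. (1 + 17 * e) / (1 - 4 * e) * (tors 0 L + 12 * e * rot 0 L) < tors 0 L + \<eta>"
    using assms by (intro order_tendstoD(2)) auto
  moreover have "\<forall>\<^sub>F e in at_right (0::real). 0 < e \<and> e < 1/20"
    unfolding eventually_at_right_field by (intro exI[of _ "1/20"]) auto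
  ultimately have "\<forall>\<^sub>F e in at_right 0. (1 + 17 * e) / (1 - 4 * e) * (tors 0 L + 12 * e * rot 0 L) < tors 0 L + \<eta> \<and> 0 < e \<and> e < 1/20"
    by eventually_elim auto
  then obtain e where e: "(1 + 17 * e) / (1 - 4 * e) * (tors 0 L + 12 * e * rot 0 L) < tors 0 L + \<eta>" "0 < e" "e < 1/20"
    using eventually_happens[of _ "at_right (0::real)"] by (auto simp: trivial_limit_at_right_real)
  obtain \<delta> where \<delta>: "\<delta> > 0" "\<And>x y. 0 \<le> x \<Longrightarrow> x \<le> y \<Longrightarrow> y \<le> L \<Longrightarrow> y - x < \<delta> \<Longrightarrow> rot x y < e"
    using small_gaps[OF e(2)] by metis
  have "\<delta> / 2 > 0" using \<delta> by simp
  then obtain \<epsilon> where \<epsilon>: "\<epsilon> > 0" "\<And>ss i. subdivision 0 L ss \<Longrightarrow> mesh \<gamma> ss < \<epsilon> \<Longrightarrow> Suc i < length ss \<Longrightarrow> ss ! Suc i - ss ! i < \<delta> / 2"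
    using mesh_imp_gaps by metis
  show ?thesis
  proof (rule that[OF \<epsilon>(1)])
    fix ss assume ss: "subdivision 0 L ss" "mesh \<gamma> ss < \<epsilon>"
    have "TAT_polygon (map \<gamma> ss) \<le> (1 + 17 * e) / (1 - 4 * e) * (tors 0 L + 12 * e * rot 0 L)"
      using e \<epsilon>(2)[OF ss] by (intro fine_polygon(3)[OF _ _ ss(1) \<delta>(2)]) auto
    moreover have "straighten (map \<gamma> ss) = map \<gamma> ss"
      using e \<epsilon>(2)[OF ss] by (intro fine_polygon(1)[OF _ _ ss(1) \<delta>(2)]) auto
    ultimately show "TAT_polygon (straighten (map \<gamma> ss)) \<le> tors 0 L + \<eta>" using e by simp
  qed
qed

lemma TAT_lower:
  assumes "\<eta> > 0" "\<epsilon> > 0"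
  obtains ss where "subdivision 0 L ss" "admissible_polygon (straighten (map \<gamma> ss))" "mesh \<gamma> ss < \<epsilon>"
    "tors 0 L \<le> TAT_polygon (straighten (map \<gamma> ss)) + \<eta>"
proof -
  have "\<eta> / 2 > 0" using assms by simp
  then obtain K where K: "tors 0 L \<le> (\<Sum>k<K. norm (b (real (k + 2) * L / real (K + 2)) - b (real (k + 1) * L / real (K + 2)))) + \<eta> / 2"
    using grid_variation by blast
  \<comment> \<open>Each of the K increments loses \<open>8 * e\<close> at either end, in total at
    most half of \<open>\<eta>\<close>.\<close>
  define e where "e = min (1/20) (\<eta> / (32 * (real K + 1)))"
  have e: "0 < e" "e \<le> 1/20"
    using assms unfolding e_def by (simp, intro min.cobounded1)
  have eK: "real K * (16 * e) \<le> \<eta> / 2"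
  proof -
    have "real K * (16 * e) \<le> (real K + 1) * (16 * (\<eta> / (32 * (real K + 1))))"
      using assms by (intro mult_mono) (auto simp: e_def)
    also have "\<dots> = \<eta> / 2" by (simp add: field_simps)
    finally show ?thesis .
  qed
  obtain \<delta> where \<delta>: "\<delta> > 0" "\<And>x y. 0 \<le> x \<Longrightarrow> x \<le> y \<Longrightarrow> y \<le> L \<Longrightarrow> y - x < \<delta> \<Longrightarrow> rot x y < e"
    using small_gaps[OF e(1)] by metis
  have R: "0 < 2 + rot 0 L" using nonneg(3)[of 0 L] by linarith
  define h where "h = min (\<delta> / 2) (\<epsilon> / (2 + rot 0 L))"
  have h: "h > 0" "h \<le> \<delta> / 2" "h * (2 + rot 0 L) \<le> \<epsilon>"
  proof -
    show "h > 0" using \<delta> assms R by (simp add: h_def)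
    show "h \<le> \<delta> / 2" unfolding h_def by (rule min.cobounded1)
    have "h \<le> \<epsilon> / (2 + rot 0 L)" unfolding h_def by (rule min.cobounded2)
    then show "h * (2 + rot 0 L) \<le> \<epsilon>" using R by (simp add: pos_le_divide_eq)
  qed
  obtain m0 :: nat where m0: "L / h < real m0" using reals_Archimedean2 by blast
  define m where "m = Suc m0"
  \<comment> \<open>A multiple of K + 2, so the uniform subdivision refines the coarse grid, whose
    k-th node is the vertex with index \<open>k * m\<close>.\<close>
  define q where "q = (K + 2) * m"
  have q: "q > 0" "m > 0" by (auto simp: q_def m_def)
  have Lq: "L / real q < h"
  proof -
    have "L < real m0 * h" using m0 h by (simp add: field_simps)
    also have "\<dots> \<le> real q * h"
    proof (intro mult_right_mono)
      have "m0 \<le> q" by (simp add: q_def m_def)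
      then show "real m0 \<le> real q" by simp
    qed (use h in simp)
    finally show ?thesis using q by (simp add: pos_divide_less_eq mult.commute)
  qed
  define ss where "ss = map (\<lambda>j. real j * L / real q) [0..<Suc q]"
  have len: "length ss = Suc q" by (simp add: ss_def)
  have nth: "ss ! j = real j * L / real q" if "j \<le> q" for j
    using that by (simp add: ss_def del: upt_Suc)
  have sub: "subdivision 0 L ss"
    unfolding subdivision_def
  proof (intro conjI)
    show ne: "ss \<noteq> []" by (simp add: ss_def)
    show "hd ss = 0" using ne nth[of 0] by (simp add: hd_conv_nth)
    show "last ss = L" using ne nth[of q] len q by (simp add: last_conv_nth)
    show "sorted_wrt (<) ss"
      unfolding sorted_wrt_iff_nth_less using L q len
      by (auto simp: nth intro!: divide_strict_right_mono mult_strict_right_mono)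
  qed
  have gaps: "ss ! Suc i - ss ! i < h" if "Suc i < length ss" for i
  proof -
    have "ss ! Suc i - ss ! i = (real (Suc i) * L - real i * L) / real q"
      using that len by (simp add: nth diff_divide_distrib)
    also have "real (Suc i) * L - real i * L = L" by (simp add: algebra_simps)
    finally show ?thesis using Lq by simp
  qed
  have gaps2: "ss ! Suc i - ss ! i < \<delta> / 2" if "Suc i < length ss" for i
    using gaps[OF that] h by linarith
  define \<beta> where "\<beta> i = sgn (bivector (ss ! (i - 1)) (ss ! i) (ss ! Suc i))" for i
  note F = fine_polygon[OF e sub \<delta>(2) gaps2, folded \<beta>_def]
  have mesh: "mesh \<gamma> ss < \<epsilon>"
    using gaps_imp_mesh[OF sub gaps h(1)] h(3) by linarith
  have node: "norm (\<beta> (k * m) - b (real k * L / real (K + 2))) \<le> 8 * e" if k: "1 \<le> k" "k \<le> K + 1" for k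
  proof -
    have "k * m \<le> (K + 1) * m" using k by (intro mult_right_mono) auto
    then have km: "1 \<le> k * m" "k * m < q"
      using k q by (auto simp: q_def)
    have "ss ! (k * m) = real (k * m) * L / real q" using km by (intro nth) auto
    also have "\<dots> = (real m * (real k * L)) / (real m * real (K + 2))"
      by (simp only: q_def of_nat_mult ac_simps)
    also have "\<dots> = real k * L / real (K + 2)"
      using q by (intro mult_divide_mult_cancel_left) simp
    finally have "ss ! (k * m) = real k * L / real (K + 2)" .
    then show ?thesis using F(4)[of "k * m"] km len by simp
  qed
  have step: "norm (b (real (k + 2) * L / real (K + 2)) - b (real (k + 1) * L / real (K + 2)))
     \<le> norm (\<beta> ((k + 2) * m) - \<beta> ((k + 1) * m)) + 16 * e" if k: "k < K" for k
  proof -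
    let ?u = "b (real (k + 2) * L / real (K + 2))" and ?v = "b (real (k + 1) * L / real (K + 2))"
    have 1: "norm (\<beta> ((k + 2) * m) - ?u) \<le> 8 * e" by (rule node) (use k in auto)
    have 2: "norm (\<beta> ((k + 1) * m) - ?v) \<le> 8 * e" by (rule node) (use k in auto)
    have eq: "?u - ?v = (\<beta> ((k + 2) * m) - \<beta> ((k + 1) * m)) - (\<beta> ((k + 2) * m) - ?u) + (\<beta> ((k + 1) * m) - ?v)" by simp
    have "norm (?u - ?v) \<le> norm (\<beta> ((k + 2) * m) - \<beta> ((k + 1) * m)) + norm (\<beta> ((k + 2) * m) - ?u) + norm (\<beta> ((k + 1) * m) - ?v)"
      by (subst eq) (meson norm_triangle_ineq norm_triangle_ineq4 order_trans add_right_mono)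
    with 1 2 show ?thesis by linarith
  qed
  have "tors 0 L \<le> (\<Sum>k<K. norm (\<beta> ((k + 2) * m) - \<beta> ((k + 1) * m)) + 16 * e) + \<eta> / 2"
    using K step sum_mono[of "{..<K}" "\<lambda>k. norm (b (real (k + 2) * L / real (K + 2)) - b (real (k + 1) * L / real (K + 2)))"
      "\<lambda>k. norm (\<beta> ((k + 2) * m) - \<beta> ((k + 1) * m)) + 16 * e"] by force
  also have "\<dots> = (\<Sum>k<K. norm (\<beta> ((k + 2) * m) - \<beta> ((k + 1) * m))) + real K * (16 * e) + \<eta> / 2"
    by (simp add: sum.distrib)
  also have "\<dots> \<le> (\<Sum>i\<in>{m<..(K + 1) * m}. norm (\<beta> i - \<beta> (i - 1))) + \<eta> / 2 + \<eta> / 2"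
    by (intro add_mono sum_blocks_le eK order_refl)
  also have "(\<Sum>i\<in>{m<..(K + 1) * m}. norm (\<beta> i - \<beta> (i - 1))) \<le> (\<Sum>i\<in>{2..length ss - 2}. norm (\<beta> i - \<beta> (i - 1)))"
    using len q by (intro sum_mono2) (auto simp: q_def)
  also have "\<dots> \<le> TAT_polygon (map \<gamma> ss)" by (rule F(5))
  finally have "tors 0 L \<le> TAT_polygon (map \<gamma> ss) + \<eta>" by simp
  then show ?thesis using that[OF sub _ mesh] F(1,2) by simp
qed

lemma TAT_eq_tors: "TAT 0 L \<gamma> = ennreal (tors 0 L)"
proof -
  define g where "g = (\<lambda>\<epsilon>::real. SUP ss \<in> {ss. subdivision 0 L ss \<and> admissible_polygon (straighten (map \<gamma> ss)) \<and> mesh \<gamma> ss < \<epsilon>}.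
         ennreal (TAT_polygon (straighten (map \<gamma> ss))))"
  have low: "ennreal r \<le> g \<epsilon>" if r: "r < tors 0 L" "\<epsilon> > 0" for r \<epsilon>
  proof -
    obtain ss where ss: "subdivision 0 L ss" "admissible_polygon (straighten (map \<gamma> ss))" "mesh \<gamma> ss < \<epsilon>"
      "tors 0 L \<le> TAT_polygon (straighten (map \<gamma> ss)) + (tors 0 L - r)"
    proof (rule TAT_lower[of "tors 0 L - r" \<epsilon>])
    qed (use r in auto)
    then have "ennreal r \<le> ennreal (TAT_polygon (straighten (map \<gamma> ss)))" by (intro ennreal_leI) simp
    also have "\<dots> \<le> g \<epsilon>" unfolding g_def using ss by (intro SUP_upper) auto
    finally show ?thesis .
  qed
  have "(g \<longlongrightarrow> ennreal (tors 0 L)) (at_right 0)"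
  proof (rule order_tendstoI)
    fix a assume "a < ennreal (tors 0 L)"
    then obtain c where c: "a < c" "c < ennreal (tors 0 L)" using dense by blast
    then obtain r where r: "c = ennreal r" "r < tors 0 L" "0 \<le> r"
      by (cases c rule: ennreal_cases) (auto simp: ennreal_less_iff)
    show "\<forall>\<^sub>F \<epsilon> in at_right 0. a < g \<epsilon>"
      unfolding eventually_at_right_field
      using low[OF r(2)] c(1) r(1) by (intro exI[of _ 1]) (auto intro: less_le_trans)
  next
    fix a assume "ennreal (tors 0 L) < a"
    \<comment> \<open>The supremum of values below a bound is only weakly below it; the intermediate
      \<open>c\<close> restores strictness.\<close>
    then obtain c where c: "c < a" "ennreal (tors 0 L) < c" using dense by blast
    then have "c \<noteq> top" by auto
    with c obtain r where r: "c = ennreal r" "tors 0 L < r"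
      by (cases c rule: ennreal_cases) (auto simp: ennreal_less_iff)
    obtain \<epsilon>0 where \<epsilon>0: "\<epsilon>0 > 0" "\<And>ss. subdivision 0 L ss \<Longrightarrow> mesh \<gamma> ss < \<epsilon>0 \<Longrightarrow>
        TAT_polygon (straighten (map \<gamma> ss)) \<le> tors 0 L + (r - tors 0 L)"
      using TAT_upper[of "r - tors 0 L"] r by auto
    have "g \<epsilon> \<le> c" if "\<epsilon> < \<epsilon>0" for \<epsilon>
      unfolding g_def r(1) using \<epsilon>0(2) that by (intro SUP_least ennreal_leI) auto
    then show "\<forall>\<^sub>F \<epsilon> in at_right 0. g \<epsilon> < a"
      unfolding eventually_at_right_field
      using \<epsilon>0(1) c(1) by (intro exI[of _ \<epsilon>0]) (auto intro: le_less_trans)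
  qed
  then have "Lim (at_right 0) g = ennreal (tors 0 L)"
    by (intro tendsto_Lim) (auto simp: trivial_limit_at_right_real)
  then show ?thesis by (simp add: TAT_def g_def)
qed

end

section \<open>Variation of derivative measures\<close>

text \<open>The variation ranges over countable partitions of all of \<open>I\<close>, so the finite
  family is completed by its remainder at index \<open>K\<close> and by empty sets.\<close>

lemma finite_sum_le_variation:
  fixes A :: "nat \<Rightarrow> real set"
  assumes A: "\<And>k. k < K \<Longrightarrow> A k \<in> sets borel \<and> A k \<subseteq> I" "disjoint_family_on A {..<K}" and I: "I \<in> sets borel"
  shows "ennreal (\<Sum>k<K. norm (\<mu> (A k))) \<le> variation \<mu> I"
proof -
  define B where "B k = (if k < K then A k else if k = K then I - (\<Union>j<K. A j) else {})" for k
  have "(\<Union>j<K. A j) \<in> sets borel" using A(1) by (intro sets.finite_UN) auto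
  then have "I - (\<Union>j<K. A j) \<in> sets borel" using I by (rule sets.Diff[rotated])
  then have "B k \<in> sets borel" for k using A(1) by (auto simp: B_def)
  moreover have "disjoint_family B"
    unfolding disjoint_family_on_def
  proof (intro ballI impI)
    fix i j :: nat assume "i \<noteq> j"
    then show "B i \<inter> B j = {}" using A(2) by (auto simp: B_def disjoint_family_on_def)
  qed
  moreover have "(\<Union>k. B k) = I"
  proof
    show "(\<Union>k. B k) \<subseteq> I" using A(1) by (auto simp: B_def split: if_splits)
    show "I \<subseteq> (\<Union>k. B k)"
    proof
      fix x assume "x \<in> I"
      show "x \<in> (\<Union>k. B k)"
      proof (cases "\<exists>j<K. x \<in> A j")
        case True
        then obtain j where "j < K" "x \<in> A j" by blast
        then show ?thesis by (intro UN_I[of j]) (auto simp: B_def)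
      next
        case False
        then show ?thesis using \<open>x \<in> I\<close> by (intro UN_I[of K]) (auto simp: B_def)
      qed
    qed
  qed
  ultimately have "(\<Sum>n. ennreal (norm (\<mu> (B n)))) \<le> variation \<mu> I"
    unfolding variation_def by (intro SUP_upper) auto
  moreover have "(\<Sum>k<K. ennreal (norm (\<mu> (B k)))) \<le> (\<Sum>n. ennreal (norm (\<mu> (B n))))"
    by (intro sum_le_suminf) auto
  moreover have "(\<Sum>k<K. ennreal (norm (\<mu> (B k)))) = ennreal (\<Sum>k<K. norm (\<mu> (A k)))"
    by (subst sum_ennreal) (auto simp: B_def intro!: arg_cong[where f=ennreal] sum.cong)
  ultimately show ?thesis by simp
qed

lemma variation_le_dominating:
  assumes P: "finite_borel_measure P" and N: "finite_borel_measure N" and I: "I \<in> sets borel"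
    and le: "\<And>A. A \<in> sets borel \<Longrightarrow> A \<subseteq> I \<Longrightarrow> norm (\<mu> A) \<le> measure P A + measure N A"
  shows "variation \<mu> I \<le> ennreal (measure P I + measure N I)"
  unfolding variation_def
proof (rule SUP_least)
  interpret P: finite_borel_measure P by fact
  interpret N: finite_borel_measure N by fact
  fix A assume "A \<in> {A :: nat \<Rightarrow> real set. range A \<subseteq> sets borel \<and> disjoint_family A \<and> (\<Union>n. A n) = I}"
  then have A: "range A \<subseteq> sets borel" "disjoint_family A" "(\<Union>n. A n) = I" by auto
  have "(\<Sum>n. ennreal (norm (\<mu> (A n)))) \<le> (\<Sum>n. emeasure P (A n) + emeasure N (A n))"
  proof (intro suminf_le)
    fix n
    have "A n \<in> sets borel" "A n \<subseteq> I" using A by auto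
    from le[OF this] show "ennreal (norm (\<mu> (A n))) \<le> emeasure P (A n) + emeasure N (A n)"
      by (simp add: P.emeasure_eq_measure N.emeasure_eq_measure flip: ennreal_plus)
  qed auto
  also have "\<dots> = (\<Sum>n. emeasure P (A n)) + (\<Sum>n. emeasure N (A n))"
    by (rule suminf_add[symmetric]) auto
  also have "\<dots> = emeasure P I + emeasure N I"
    using A suminf_emeasure[of A P] suminf_emeasure[of A N] by (simp add: P.M_is_borel N.M_is_borel)
  also have "\<dots> = ennreal (measure P I + measure N I)"
    by (simp add: P.emeasure_eq_measure N.emeasure_eq_measure)
  finally show "(\<Sum>n. ennreal (norm (\<mu> (A n)))) \<le> ennreal (measure P I + measure N I)" .
qed

lemma vector_measure_on_bounded_linear:
  assumes "vector_measure_on I \<mu>" "bounded_linear T"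
  shows "vector_measure_on I (\<lambda>B. T (\<mu> B))"
proof -
  interpret T: bounded_linear T by fact
  show ?thesis
    using assms(1) unfolding vector_measure_on_def by (auto intro!: T.sums simp: T.zero)
qed

lemma is_deriv_measure_inner:
  assumes "is_deriv_measure I u \<mu>" "e \<in> Basis"
  shows "is_deriv_measure I (\<lambda>s. u s \<bullet> e) (\<lambda>B. \<mu> B \<bullet> e)"
  using assms vector_measure_on_bounded_linear[OF _ bounded_linear_inner_left[of e], of I \<mu>]
  unfolding is_deriv_measure_def by auto

lemma is_deriv_measure_BV:
  assumes "u \<in> BV {0<..<L} X" "continuous_on {0<..<L} u"
  shows "is_deriv_measure {0<..<L} u (deriv_measure {0<..<L} u)"
  using assms deriv_measure_eqI unfolding BV_def by blast

text \<open>A point is the decreasing limit of half-open intervals ending there, whose measures are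
  increments of \<open>f\<close> and vanish by continuity.\<close>

lemma deriv_measure_atom:
  fixes f :: "real \<Rightarrow> real"
  assumes d: "is_deriv_measure {0<..<L} f \<mu>" and f: "continuous_on {0<..<L} f" and y: "0 < y" "y < L"
  shows "\<mu> {y} = 0"
proof -
  obtain P N where PN: "decomposes {0<..<L} (\<lambda>B. \<mu> B \<bullet> 1) P N"
    using is_deriv_measure_component[OF d, of 1] by auto
  \<comment> \<open>The denominators start at 2 to keep these points positive.\<close>
  define x where "x n = y - y / real (n + 2)" for n :: nat
  have x: "0 < x n" "x n < y" for n
  proof -
    have "y / real (n + 2) < y / 1" using y by (intro divide_strict_left_mono) auto
    then show "0 < x n" by (simp add: x_def)
    show "x n < y" using y by (simp add: x_def)
  qed
  have xl: "x \<longlonglongrightarrow> y" unfolding x_def by real_asymp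
  have mx: "x n \<le> x m" if "n \<le> m" for n m
    using that y unfolding x_def by (intro diff_left_mono divide_left_mono) auto
  have lim: "(\<lambda>n. measure Q {x n<..y}) \<longlonglongrightarrow> measure Q {y}" if "finite_borel_measure Q" for Q
  proof -
    interpret Q: finite_borel_measure Q by fact
    have "(\<Inter>n. {x n<..y}) = {y}"
    proof (intro set_eqI iffI)
      fix z assume z: "z \<in> (\<Inter>n. {x n<..y})"
      then have "\<And>n. x n \<le> z" by (auto intro: less_imp_le)
      then have "y \<le> z" using xl by (meson LIMSEQ_le_const2)
      then show "z \<in> {y}" using z by auto
    qed (use x in auto)
    moreover have "decseq (\<lambda>n. {x n<..y})"
    proof (rule decseq_SucI)
      fix n show "{x (Suc n)<..y} \<subseteq> {x n<..y}" using mx[of n "Suc n"] by auto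
    qed
    moreover have "range (\<lambda>n. {x n<..y}) \<subseteq> sets Q" by (auto simp: Q.M_is_borel)
    ultimately show ?thesis
      using Q.finite_Lim_measure_decseq[of "\<lambda>n. {x n<..y}"] by simp
  qed
  have mu: "\<mu> A = measure P A - measure N A" if "A \<in> sets borel" "A \<subseteq> {0<..<L}" for A
    using PN that by (metis (no_types, lifting) decomposes_def inner_real_def mult.right_neutral inf.absorb1)
  have "(\<lambda>n. measure P {x n<..y} - measure N {x n<..y}) \<longlonglongrightarrow> measure P {y} - measure N {y}"
    using PN by (intro tendsto_diff lim) (auto simp: decomposes_def)
  moreover have "measure P {x n<..y} - measure N {x n<..y} = f y - f (x n)" for n
    using mu[of "{x n<..y}"] deriv_measure_Ioc[OF d f x(1)] x[of n] y by (auto simp: less_imp_le subset_eq)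
  moreover have "(\<lambda>n. f y - f (x n)) \<longlonglongrightarrow> f y - f y"
  proof (intro tendsto_diff tendsto_const)
    have "isCont f y" using f y by (auto simp: continuous_on_eq_continuous_at)
    then show "(\<lambda>n. f (x n)) \<longlonglongrightarrow> f y" using xl isCont_tendsto_compose by blast
  qed
  ultimately have "measure P {y} - measure N {y} = 0"
    using LIMSEQ_unique by (metis (no_types, lifting) ext diff_self)
  then show ?thesis using mu[of "{y}"] y by auto
qed

lemma deriv_measure_jordan:
  fixes f :: "real \<Rightarrow> real"
  assumes d: "is_deriv_measure {0<..<L} f \<mu>" and f: "continuous_on {0<..<L} f"
  obtains P N Y where "decomposes {0<..<L} \<mu> P N" "Y \<in> sets borel" "Y \<subseteq> {0<..<L}"
    "measure P (- Y) = 0" "measure N Y = 0" "measure P (- {0<..<L}) = 0" "measure N (- {0<..<L}) = 0"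
    "\<And>x. measure P {x} = 0" "\<And>x. measure N {x} = 0"
proof -
  let ?I = "{0<..<L}"
  obtain P0 N0 where PN0: "decomposes ?I (\<lambda>B. \<mu> B \<bullet> 1) P0 N0"
    using is_deriv_measure_component[OF d, of 1] by auto
  then have "decomposes ?I \<mu> P0 N0" by simp
  then obtain P N Y where PN: "decomposes ?I \<mu> P N" "Y \<in> sets borel" "Y \<subseteq> ?I"
    "\<And>A. A \<in> sets borel \<Longrightarrow> measure P A = \<mu> (A \<inter> Y)"
    "\<And>A. A \<in> sets borel \<Longrightarrow> measure N A = - \<mu> (A \<inter> ?I - Y)"
    using hahn_jordan_decomposition[of ?I \<mu>] by (metis borel_open open_greaterThanLessThan)
  have e: "\<mu> {} = 0" using d by (auto simp: is_deriv_measure_def vector_measure_on_empty)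
  have atom: "\<mu> ({x} \<inter> Z) = 0" if "Z \<subseteq> ?I" for x Z
  proof (cases "x \<in> Z")
    case True
    then have "{x} \<inter> Z = {x}" by auto
    then show ?thesis using deriv_measure_atom[OF d f, of x] True that by auto
  qed (use e in auto)
  have I: "?I \<in> sets borel" by simp
  show ?thesis
  proof (rule that[OF PN(1-3)])
    have z: "- Y \<inter> Y = {}" "- ?I \<inter> Y = {}" "Y \<inter> ?I - Y = {}" "- ?I \<inter> ?I - Y = {}" using PN(3) by auto
    show "measure P (- Y) = 0" "measure P (- ?I) = 0"
      using PN(4)[of "- Y"] PN(4)[of "- ?I"] PN(2) I e unfolding z by (simp_all add: borel_comp)
    show "measure N Y = 0" "measure N (- ?I) = 0"
      using PN(5)[of Y] PN(5)[of "- ?I"] PN(2) I e unfolding z by (simp_all add: borel_comp)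
    show "measure P {x} = 0" for x using PN(3) by (simp add: PN(4) atom)
    have "{x} \<inter> ?I - Y = {x} \<inter> (?I - Y)" for x by auto
    then show "measure N {x} = 0" for x using atom[of "?I - Y" x] by (simp add: PN(5))
  qed
qed

text \<open>Applied to the entries of the frame, this continues them beyond the open
  interval.\<close>

lemma continuous_on_deriv_measure_atMost:
  fixes f :: "real \<Rightarrow> real"
  assumes d: "is_deriv_measure {0<..<L} f \<mu>" and f: "continuous_on {0<..<L} f"
  shows "continuous_on UNIV (\<lambda>x. \<mu> ({..x} \<inter> {0<..<L}))"
proof -
  obtain P N Y where PN: "decomposes {0<..<L} \<mu> P N" "\<And>x. measure P {x} = 0" "\<And>x. measure N {x} = 0"
    using deriv_measure_jordan[OF d f] by metis
  interpret P: finite_borel_measure P using PN(1) by (simp add: decomposes_def)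
  interpret N: finite_borel_measure N using PN(1) by (simp add: decomposes_def)
  have "(\<lambda>x. \<mu> ({..x} \<inter> {0<..<L})) = (\<lambda>x. cdf P x - cdf N x)"
    using PN(1) by (auto simp: decomposes_def cdf_def)
  moreover have "isCont (cdf P) x" "isCont (cdf N) x" for x
    using PN by (auto simp: P.isCont_cdf N.isCont_cdf)
  ultimately show ?thesis by (auto intro!: continuous_intros continuous_at_imp_continuous_on)
qed

section \<open>The frame equation\<close>

lemma has_signed_integral_uminus:
  assumes "has_signed_integral I \<mu> B f v"
  shows "has_signed_integral I (\<lambda>A. - \<mu> A) B f (- v)"
proof -
  from assms obtain P N where "finite_measure P" "sets P = sets (restrict_space borel I)"
    "finite_measure N" "sets N = sets (restrict_space borel I)"
    "\<forall>A \<in> sets (restrict_space borel I). \<mu> A = measure P A - measure N A"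
    "set_integrable P B f" "set_integrable N B f" "v = (LINT x:B|P. f x) - (LINT x:B|N. f x)"
    unfolding has_signed_integral_def by blast
  then show ?thesis unfolding has_signed_integral_def
    by (intro exI[of _ N] exI[of _ P]) auto
qed

text \<open>The zero measure is written as P - P with a measure for which \<open>f\<close> is
  already known to be integrable.\<close>

lemma has_signed_integral_zero:
  assumes "has_signed_integral I \<mu> B f v"
  shows "has_signed_integral I (\<lambda>A. 0) B f 0"
proof -
  from assms obtain P where "finite_measure P" "sets P = sets (restrict_space borel I)" "set_integrable P B f"
    unfolding has_signed_integral_def by blast
  then show ?thesis unfolding has_signed_integral_def
    by (intro exI[of _ P]) auto
qed

lemma decomposes_uminus: "decomposes I \<mu> P N \<Longrightarrow> decomposes I (\<lambda>A. - \<mu> A) N P"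
  by (auto simp: decomposes_def)

lemma decomposes_zero: "decomposes I \<mu> P N \<Longrightarrow> decomposes I (\<lambda>A. 0) P P"
  by (auto simp: decomposes_def)

text \<open>The pattern of \<open>Omega\<close> with numbers as arguments, so that it applies to the
  values of the two functions and to those of their derivative measures alike.\<close>

definition skew :: "real \<Rightarrow> real \<Rightarrow> real^3^3" where
  "skew x y = vector [vector [0, x, 0], vector [- x, 0, y], vector [0, - y, 0]]"

lemma Omega_eq_skew: "Omega \<theta> \<phi> s = skew (\<theta> s) (\<phi> s)"
  by (simp add: Omega_def skew_def)

lemma skew_nth [simp]:
  "skew x y $ 1 $ 1 = 0" "skew x y $ 1 $ 2 = x" "skew x y $ 1 $ 3 = 0"
  "skew x y $ 2 $ 1 = - x" "skew x y $ 2 $ 2 = 0" "skew x y $ 2 $ 3 = y"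
  "skew x y $ 3 $ 1 = 0" "skew x y $ 3 $ 2 = - y" "skew x y $ 3 $ 3 = 0"
  by (simp_all add: skew_def)

lemma skew_linear: "skew x y = x *\<^sub>R skew 1 0 + y *\<^sub>R skew 0 1"
  by (simp add: vec_eq_iff forall_3)

lemma Basis_matrix:
  assumes "e \<in> (Basis :: (real^3^3) set)"
  obtains i j where "\<And>A. A \<bullet> e = A $ i $ j"
proof -
  obtain i where i: "e \<in> (\<Union>u\<in>Basis. {axis i (u :: real^3)})" using assms by (auto simp: Basis_vec_def)
  then obtain u where u: "u \<in> Basis" "e = axis i u" by auto
  then obtain j where "u = axis j (1::real)" by (auto simp: Basis_vec_def)
  then show ?thesis using that[of i j] u by (simp add: inner_axis)
qed

lemma is_deriv_measure_Omega:
  assumes \<theta>: "is_deriv_measure I \<theta> \<mu>" and \<phi>: "is_deriv_measure I \<phi> \<nu>"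
  shows "is_deriv_measure I (Omega \<theta> \<phi>) (\<lambda>B. skew (\<mu> B) (\<nu> B))"
  unfolding is_deriv_measure_def
proof (intro conjI ballI allI impI)
  have "vector_measure_on I \<mu>" "vector_measure_on I \<nu>" using assms by (auto simp: is_deriv_measure_def)
  then show "vector_measure_on I (\<lambda>B. skew (\<mu> B) (\<nu> B))"
    unfolding vector_measure_on_def skew_linear[of "\<mu> _"]
    by (auto intro!: sums_add sums_scaleR_left)
  fix e :: "real^3^3" and \<psi> assume "e \<in> Basis" and \<psi>: "test_function I \<psi>"
  then obtain i j where e: "\<And>A. A \<bullet> e = A $ i $ j" using Basis_matrix by blast
  have h1: "has_signed_integral I \<mu> I \<psi> (- (LINT x:I|lborel. \<theta> x * deriv \<psi> x))"
    using \<theta> \<psi> unfolding is_deriv_measure_def by auto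
  have h2: "has_signed_integral I \<nu> I \<psi> (- (LINT x:I|lborel. \<phi> x * deriv \<psi> x))"
    using \<phi> \<psi> unfolding is_deriv_measure_def by auto
  note u1 = has_signed_integral_uminus[OF h1] and u2 = has_signed_integral_uminus[OF h2] and z = has_signed_integral_zero[OF h1]
  show "has_signed_integral I (\<lambda>B. skew (\<mu> B) (\<nu> B) \<bullet> e) I \<psi> (- (LINT x:I|lborel. Omega \<theta> \<phi> x \<bullet> e * deriv \<psi> x))"
    using exhaust_3[of i] exhaust_3[of j] h1 h2 u1 u2 z
    by (auto simp: e Omega_eq_skew set_lebesgue_integral_def)
qed

lemma continuous_on_matrix_entry:
  "continuous_on S G \<Longrightarrow> continuous_on S (\<lambda>x. G x $ i $ j)" for G :: "'a::topological_space \<Rightarrow> real^3^3"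
  by (intro continuous_on_component)

lemma closed_rotation_matrix: "closed {A :: real^3^3. rotation_matrix A}"
proof -
  have c: "continuous_on UNIV (\<lambda>A::real^3^3. A $ i $ j)" for i j by (intro continuous_on_component continuous_on_id)
  have "{A :: real^3^3. rotation_matrix A} = {A. \<forall>i j. (\<Sum>k\<in>UNIV. A $ k $ i * A $ k $ j) = (mat 1 :: real^3^3) $ i $ j} \<inter> {A. det A = 1}"
    by (auto simp: rotation_matrix_def orthogonal_matrix vec_eq_iff matrix_matrix_mult_def transpose_def)
  moreover have "closed {A :: real^3^3. \<forall>i j. (\<Sum>k\<in>UNIV. A $ k $ i * A $ k $ j) = (mat 1 :: real^3^3) $ i $ j}"
    by (intro closed_Collect_all closed_Collect_eq continuous_intros c)
  moreover have "closed {A :: real^3^3. det A = 1}"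
    unfolding det_3 by (intro closed_Collect_eq continuous_intros c)
  ultimately show ?thesis by auto
qed

text \<open>The set of exceptions is open and null, hence empty.\<close>

lemma continuous_AE_closed:
  fixes f :: "real \<Rightarrow> 'a::topological_space"
  assumes f: "continuous_on I f" and I: "open I" and X: "closed X"
    and ae: "AE x in lborel. x \<in> I \<longrightarrow> f x \<in> X" and x: "x \<in> I"
  shows "f x \<in> X"
proof -
  have "open (I \<inter> f -` (- X))"
    using f I X by (intro continuous_open_preimage) auto
  then have "closed (- (I \<inter> f -` (- X)))" by (rule closed_Compl)
  moreover have "AE x in lebesgue. x \<in> - (I \<inter> f -` (- X))"
    using AE_completion[OF ae] by eventually_elim auto
  ultimately have "x \<in> - (I \<inter> f -` (- X))" by (rule mem_closed_if_AE_lebesgue)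
  then show ?thesis using x by auto
qed

lemma matrix_inv_transpose_rotation:
  assumes "rotation_matrix (A :: real^3^3)"
  shows "matrix_inv (transpose A) = A"
proof -
  have o: "transpose A ** A = mat 1" "A ** transpose A = mat 1"
    using assms by (auto simp: rotation_matrix_def orthogonal_matrix_def)
  have "transpose A ** matrix_inv (transpose A) = mat 1"
    unfolding matrix_inv_def by (rule someI2[where a=A]) (use o in auto)
  then have "A ** (transpose A ** matrix_inv (transpose A)) = A ** mat 1" by simp
  then show ?thesis by (simp add: matrix_mul_assoc o)
qed

lemma precise_rep_continuous:
  fixes u :: "real \<Rightarrow> 'a::real_normed_vector"
  assumes "continuous_on {a<..<b} u" "s \<in> {a<..<b}"
  shows "precise_rep u s = u s"
proof -
  have "isCont u s" using assms by (auto simp: continuous_on_eq_continuous_at)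
  then have "(u \<longlongrightarrow> u s) (at_right s)" "(u \<longlongrightarrow> u s) (at_left s)"
    by (auto simp: isCont_def filterlim_at_split)
  then have "Lim (at_right s) u = u s" "Lim (at_left s) u = u s"
    by (auto intro!: tendsto_Lim simp: trivial_limit_at_right_real trivial_limit_at_left_real)
  then show ?thesis by (simp add: precise_rep_def scaleR_half_double flip: scaleR_2)
qed

lemma rotation_columns:
  assumes "rotation_matrix (A :: real^3^3)"
  shows "norm (A *v axis i 1) = 1" "cross3 (A *v axis 1 1) (A *v axis 2 1) = A *v axis 3 1"
proof -
  have "orthogonal_transformation ((*v) A)"
    using assms by (simp add: rotation_matrix_def orthogonal_transformation_matrix)
  then show "norm (A *v axis i 1) = 1" by (simp add: orthogonal_transformation_norm norm_axis_1)
  show "cross3 (A *v axis 1 1) (A *v axis 2 1) = A *v axis 3 1"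
    using cross_rotation_matrix[OF assms] cross_basis(1) by simp
qed

lemma matrix_axis_nth: "(A *v axis j 1) $ i = (A :: real^3^3) $ i $ j"
  by (simp add: matrix_vector_mult_def axis_def if_distrib cong: if_cong)

text \<open>On a fine grid the absolute increments nearly add up to P + N. For a monotone function
  they telescope to P - N, so the negative part is arbitrarily small on every closed interval
  inside.\<close>

lemma monotone_jordan_negative_part:
  fixes \<theta> :: "real \<Rightarrow> real"
  assumes d: "is_deriv_measure {0<..<L} \<theta> \<mu>" and \<theta>: "continuous_on {0<..<L} \<theta>" "mono_on {0<..<L} \<theta>"
    and PN: "decomposes {0<..<L} \<mu> P N" "Y \<in> sets borel" "measure P (- Y) = 0" "measure N Y = 0" "measure N (- {0<..<L}) = 0"
  shows "measure N UNIV = 0"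
proof -
  let ?I = "{0<..<L}"
  have fb: "finite_borel_measure P" "finite_borel_measure N" using PN(1) by (auto simp: decomposes_def)
  interpret P: finite_borel_measure P by fact
  interpret N: finite_borel_measure N by fact
  have J: "measure P {x<..y} - measure N {x<..y} = \<theta> y - \<theta> x" if "0 < x" "x \<le> y" "y < L" for x y
  proof -
    have "{x<..y} \<inter> ?I = {x<..y}" using that by auto
    then have "\<mu> {x<..y} = measure P {x<..y} - measure N {x<..y}"
      using PN(1) unfolding decomposes_def by (metis greaterThanAtMost_borel)
    then show ?thesis using deriv_measure_Ioc[OF d \<theta>(1) that] by simp
  qed
  have zero: "measure N {x<..y} = 0" if xy: "0 < x" "x \<le> y" "y < L" for x y
  proof -
    have "2 * measure N {x<..y} \<le> e" if e: "e > 0" for e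
    proof -
      obtain \<delta> where \<delta>: "\<delta> > 0" "\<forall>s n. (\<forall>k<n. s k \<le> s (Suc k) \<and> s (Suc k) - s k < \<delta>) \<longrightarrow>
         measure P {s 0<..s n} + measure N {s 0<..s n}
           \<le> (\<Sum>k<n. \<bar>measure P {s k<..s (Suc k)} - measure N {s k<..s (Suc k)}\<bar>) + e"
        using singular_measures_fine_variation[OF fb PN(2-4) e] by blast
      obtain K :: nat where K: "(y - x) / \<delta> < real K" using reals_Archimedean2 by blast
      define q where "q = real (Suc K)"
      have q: "q > 0" "(y - x) / q < \<delta>"
      proof -
        show "q > 0" by (simp add: q_def)
        have "y - x < real K * \<delta>" using K \<delta> by (simp add: field_simps)
        also have "\<dots> \<le> q * \<delta>" using \<delta> by (simp add: q_def)
        finally show "(y - x) / q < \<delta>" using \<open>q > 0\<close> by (simp add: pos_divide_less_eq mult.commute)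
      qed
      define s where "s k = x + real k * ((y - x) / q)" for k
      have s0: "s 0 = x" "s (Suc K) = y" using q by (simp_all add: s_def q_def)
      have mono: "s i \<le> s j" if "i \<le> j" for i j
        using that xy q unfolding s_def by (intro add_left_mono mult_right_mono) auto
      have gap: "s (Suc k) - s k = (y - x) / q" for k
        by (simp only: s_def of_nat_Suc distrib_right mult_1_left)
      have rng: "0 < s k \<and> s k < L" if "k \<le> Suc K" for k
        using mono[of 0 k] mono[of k "Suc K"] s0 xy that by auto
      have "measure P {s 0<..s (Suc K)} + measure N {s 0<..s (Suc K)}
           \<le> (\<Sum>k<Suc K. \<bar>measure P {s k<..s (Suc k)} - measure N {s k<..s (Suc k)}\<bar>) + e"
      proof (rule \<delta>(2)[rule_format])
        show "s k \<le> s (Suc k) \<and> s (Suc k) - s k < \<delta>" for k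
          using mono[of k "Suc k"] gap[of k] q(2) by simp
      qed
      also have "(\<Sum>k<Suc K. \<bar>measure P {s k<..s (Suc k)} - measure N {s k<..s (Suc k)}\<bar>) = (\<Sum>k<Suc K. \<theta> (s (Suc k)) - \<theta> (s k))"
      proof (rule sum.cong)
        fix k assume "k \<in> {..<Suc K}"
        then have k: "0 < s k" "s k \<le> s (Suc k)" "s (Suc k) < L" using rng[of k] rng[of "Suc k"] mono[of k "Suc k"] by auto
        then have "\<theta> (s k) \<le> \<theta> (s (Suc k))" by (intro mono_onD[OF \<theta>(2)]) auto
        then show "\<bar>measure P {s k<..s (Suc k)} - measure N {s k<..s (Suc k)}\<bar> = \<theta> (s (Suc k)) - \<theta> (s k)"
          using J[OF k] by simp
      qed simp
      also have "\<dots> = \<theta> y - \<theta> x" using s0 by (subst sum_lessThan_telescope) simp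
      also have "\<dots> = measure P {x<..y} - measure N {x<..y}" using J[OF xy] by simp
      finally show ?thesis using s0 by simp
    qed
    then have "2 * measure N {x<..y} \<le> 0" by (rule field_le_epsilon) simp
    then show ?thesis using measure_nonneg[of N "{x<..y}"] by linarith
  qed
  \<comment> \<open>Countably many inner intervals exhaust the open interval; the outside is null by
    assumption.\<close>
  have "(\<Union>n. {1 / real (Suc n)<..L - 1 / real (Suc n)}) \<in> null_sets N"
  proof (rule null_sets_UN)
    fix n
    have "measure N {1 / real (Suc n)<..L - 1 / real (Suc n)} = 0"
    proof (cases "1 / real (Suc n) \<le> L - 1 / real (Suc n)")
      case True
      have "0 < 1 / real (Suc n)" by simp
      with True show ?thesis by (intro zero) linarith+
    next
      case False
      then show ?thesis by simp
    qed
    then show "{1 / real (Suc n)<..L - 1 / real (Suc n)} \<in> null_sets N"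
      by (intro null_setsI) (auto simp: N.M_is_borel N.emeasure_eq_measure)
  qed
  moreover have "?I \<subseteq> (\<Union>n. {1 / real (Suc n)<..L - 1 / real (Suc n)})"
  proof
    fix z assume z: "z \<in> ?I"
    then obtain i where i: "inverse (real (Suc i)) < min z (L - z)"
      using reals_Archimedean[of "min z (L - z)"] by auto
    then have "z \<in> {1 / real (Suc i)<..L - 1 / real (Suc i)}" by (auto simp: inverse_eq_divide)
    then show "z \<in> (\<Union>n. {1 / real (Suc n)<..L - 1 / real (Suc n)})" by blast
  qed
  ultimately have "?I \<in> null_sets N"
    using null_sets_subset[of _ N ?I] by (simp add: N.M_is_borel)
  moreover have "- ?I \<in> null_sets N"
    using PN(5) by (intro null_setsI) (auto simp: N.M_is_borel N.emeasure_eq_measure borel_comp)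
  ultimately have "?I \<union> - ?I \<in> null_sets N" by (rule null_sets.Un)
  then show ?thesis by (auto simp: null_sets_def N.emeasure_eq_measure)
qed

section \<open>Columns of the frame equation\<close>

lemma has_signed_integral_value:
  assumes d: "decomposes {0<..<L} \<mu> P N" and B: "B \<in> sets borel" "B \<subseteq> {0<..<L}"
    and h: "has_signed_integral {0<..<L} \<mu> B f v"
    and g: "continuous_on {0<..<L} g" "\<And>x. x \<in> {0<..<L} \<Longrightarrow> \<bar>g x\<bar> \<le> C" and eq: "\<And>x. x \<in> {0<..<L} \<Longrightarrow> f x = g x"
  shows "v = (LINT x:B|P. g x) - (LINT x:B|N. g x)"
proof -
  have cong: "set_integrable Q B f = set_integrable Q B g \<and> (LINT x:B|Q. f x) = (LINT x:B|Q. g x)" for Q :: "real measure"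
  proof -
    have "(\<lambda>x. indicator B x *\<^sub>R f x) = (\<lambda>x. indicator B x *\<^sub>R g x)"
      using eq B by (intro ext) (auto split: split_indicator)
    then show ?thesis by (simp add: set_integrable_def set_lebesgue_integral_def)
  qed
  have "finite_borel_measure P" "finite_borel_measure N" using d by (auto simp: decomposes_def)
  then have "set_integrable P B g" "set_integrable N B g"
    using B g by (auto intro!: set_integrable_bounded_continuous[where I="{0<..<L}" and C=C])
  then have "v = (LINT x:B|P. f x) - (LINT x:B|N. f x)"
    using B by (intro has_signed_integral_eq[OF _ _ d h]) (auto simp: cong sets_restrict_Ioo)
  then show ?thesis by (simp add: cong)
qed


lemma rotation_entry_le_1: "rotation_matrix (A :: real^3^3) \<Longrightarrow> \<bar>A $ i $ j\<bar> \<le> 1"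
  using component_le_norm_cart[of "A *v axis j 1" i] rotation_columns(1)[of A j] by (simp add: matrix_axis_nth)

text \<open>For rotations the coefficient matrix is -G. Every entry of D Omega is 0 or, up to sign,
  one of the two scalar measures, so a decomposition is obtained by taking equal parts or exchanging
  them.\<close>

lemma frame_equation_entries:
  fixes G :: "real \<Rightarrow> real^3^3"
  assumes sol: "solves_frame_equation {0<..<L} \<Omega> G"
    and D\<Omega>: "deriv_measure {0<..<L} \<Omega> = (\<lambda>B. skew (\<mu> B) (\<nu> B))"
    and G: "continuous_on {0<..<L} G" "\<forall>s\<in>{0<..<L}. rotation_matrix (G s)"
    and \<mu>: "decomposes {0<..<L} \<mu> M M'" "measure M' UNIV = 0"
    and \<nu>: "decomposes {0<..<L} \<nu> P N"
    and B: "B \<in> sets borel" "B \<subseteq> {0<..<L}"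
  shows "deriv_measure {0<..<L} G B $ i $ 1 = (LINT x:B|M. G x $ i $ 2)"
    "deriv_measure {0<..<L} G B $ i $ 2 = (LINT x:B|P. G x $ i $ 3) - (LINT x:B|N. G x $ i $ 3) - (LINT x:B|M. G x $ i $ 1)"
    "deriv_measure {0<..<L} G B $ i $ 3 = (LINT x:B|N. G x $ i $ 2) - (LINT x:B|P. G x $ i $ 2)"
proof -
  let ?I = "{0<..<L}"
  let ?M = "\<lambda>s. - matrix_inv (transpose (precise_rep G s))"
  have Meq: "?M s $ i $ k = - G s $ i $ k" if "s \<in> ?I" for s i k
    using that G by (simp add: precise_rep_continuous[OF G(1) that] matrix_inv_transpose_rotation)
  have cG: "continuous_on ?I (\<lambda>s. - G s $ i $ k)" for i k
    by (intro continuous_intros continuous_on_matrix_entry G)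
  have bG: "\<bar>- G s $ i $ k\<bar> \<le> 1" if "s \<in> ?I" for s i k
    using rotation_entry_le_1[of "G s" i k] G(2) that by simp
  have Bs: "B \<in> sets (restrict_space borel ?I)" using B by (simp add: sets_restrict_Ioo)
  have val: "v = (LINT x:B|Q. - G x $ i $ k) - (LINT x:B|R. - G x $ i $ k)"
    if "decomposes ?I (\<lambda>A. skew (\<mu> A) (\<nu> A) $ k $ j) Q R"
      "has_signed_integral ?I (\<lambda>A. skew (\<mu> A) (\<nu> A) $ k $ j) B (\<lambda>s. ?M s $ i $ k) v" for v Q R k j
    by (rule has_signed_integral_value[OF that(1) B that(2) cG bG Meq])
  have eqj: "\<exists>v :: 3 \<Rightarrow> real. (\<forall>k. has_signed_integral ?I (\<lambda>A. skew (\<mu> A) (\<nu> A) $ k $ j) B (\<lambda>s. ?M s $ i $ k) (v k)) \<and>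
      deriv_measure ?I G B $ i $ j = v 1 + v 2 + v 3" for j
    using sol Bs unfolding solves_frame_equation_def is_matrix_times_measure_def D\<Omega> by (auto simp: sum_3)
  \<comment> \<open>The negative part of D theta is null, so only \<open>M\<close> survives
    below.\<close>
  have null: "(LINT x:B|M'. f x) = 0" for f :: "real \<Rightarrow> real"
  proof -
    interpret M': finite_borel_measure M' using \<mu> by (simp add: decomposes_def)
    have "emeasure M' (space M') = 0" using \<mu>(2) by (simp add: M'.emeasure_eq_measure M'.borel_UNIV)
    then have "AE x in M'. indicator B x *\<^sub>R f x = 0" by (rule emeasure_0_AE)
    then show ?thesis unfolding set_lebesgue_integral_def by (rule integral_eq_zero_AE)
  qed
  note u\<mu> = decomposes_uminus[OF \<mu>(1)] and u\<nu> = decomposes_uminus[OF \<nu>] and z = decomposes_zero[OF \<nu>]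
  have neg: "(LINT x:B|Q. - f x) = - (LINT x:B|Q. f x)" for Q and f :: "real \<Rightarrow> real"
    by (simp add: set_lebesgue_integral_def)
  show "deriv_measure ?I G B $ i $ 1 = (LINT x:B|M. G x $ i $ 2)"
  proof -
    obtain v where v: "\<And>k. has_signed_integral ?I (\<lambda>A. skew (\<mu> A) (\<nu> A) $ k $ 1) B (\<lambda>s. ?M s $ i $ k) (v k)"
      "deriv_measure ?I G B $ i $ 1 = v 1 + v 2 + v 3" using eqj[of 1] by blast
    have "v 1 = 0" using val[OF _ v(1)[of 1], of P P] z by simp
    moreover have "v 2 = (LINT x:B|M. G x $ i $ 2)" using val[OF _ v(1)[of 2], of M' M] u\<mu> by (simp add: null neg)
    moreover have "v 3 = 0" using val[OF _ v(1)[of 3], of P P] z by simp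
    ultimately show ?thesis using v(2) by simp
  qed
  show "deriv_measure ?I G B $ i $ 2 = (LINT x:B|P. G x $ i $ 3) - (LINT x:B|N. G x $ i $ 3) - (LINT x:B|M. G x $ i $ 1)"
  proof -
    obtain v where v: "\<And>k. has_signed_integral ?I (\<lambda>A. skew (\<mu> A) (\<nu> A) $ k $ 2) B (\<lambda>s. ?M s $ i $ k) (v k)"
      "deriv_measure ?I G B $ i $ 2 = v 1 + v 2 + v 3" using eqj[of 2] by blast
    have "v 1 = - (LINT x:B|M. G x $ i $ 1)" using val[OF _ v(1)[of 1], of M M'] \<mu> by (simp add: null neg)
    moreover have "v 2 = 0" using val[OF _ v(1)[of 2], of P P] z by simp
    moreover have "v 3 = (LINT x:B|P. G x $ i $ 3) - (LINT x:B|N. G x $ i $ 3)" using val[OF _ v(1)[of 3], of N P] u\<nu> by (simp add: neg)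
    ultimately show ?thesis using v(2) by simp
  qed
  show "deriv_measure ?I G B $ i $ 3 = (LINT x:B|N. G x $ i $ 2) - (LINT x:B|P. G x $ i $ 2)"
  proof -
    obtain v where v: "\<And>k. has_signed_integral ?I (\<lambda>A. skew (\<mu> A) (\<nu> A) $ k $ 3) B (\<lambda>s. ?M s $ i $ k) (v k)"
      "deriv_measure ?I G B $ i $ 3 = v 1 + v 2 + v 3" using eqj[of 3] by blast
    have "v 1 = 0" using val[OF _ v(1)[of 1], of P P] z by simp
    moreover have "v 2 = (LINT x:B|N. G x $ i $ 2) - (LINT x:B|P. G x $ i $ 2)" using val[OF _ v(1)[of 2], of P N] \<nu> by (simp add: neg)
    moreover have "v 3 = 0" using val[OF _ v(1)[of 3], of P P] z by simp
    ultimately show ?thesis using v(2) by simp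
  qed
qed

lemma set_integral_vec_nth:
  fixes F :: "real \<Rightarrow> real^3"
  assumes "set_integrable Q A F"
  shows "(LINT x:A|Q. F x) $ i = (LINT x:A|Q. F x $ i)"
  using integral_bounded_linear[OF bounded_linear_vec_nth assms[unfolded set_integrable_def], of i]
  by (simp add: set_lebesgue_integral_def)

text \<open>The measure does not charge the complement of \<open>I\<close>, so an integrand known on
  \<open>I\<close> may be replaced by a component of a continuous function on the whole
  line.\<close>

lemma set_integral_concentrated:
  fixes F :: "real \<Rightarrow> real^3"
  assumes Q: "finite_borel_measure Q" "measure Q (- I) = 0" and I: "I \<in> sets borel" and A: "A \<in> sets borel"
    and F: "continuous_on UNIV F" "set_integrable Q A F" and eq: "\<And>x. x \<in> I \<Longrightarrow> f x = F x $ i"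
  shows "(LINT x:A \<inter> I|Q. f x) = (LINT x:A|Q. F x) $ i"
proof -
  interpret Q: finite_borel_measure Q by fact
  have m: "(\<lambda>x. F x $ i) \<in> borel_measurable Q"
    by (subst measurable_cong_sets[OF Q.M_is_borel refl])
       (intro borel_measurable_continuous_onI continuous_on_component F)
  have "(LINT x:A \<inter> I|Q. f x) = (LINT x:A \<inter> I|Q. F x $ i)"
    using A I eq by (intro set_lebesgue_integral_cong) (auto simp: Q.M_is_borel)
  also have "\<dots> = (LINT x:A|Q. F x $ i)"
    unfolding set_lebesgue_integral_def
  proof (rule integral_cong_AE)
    have "- I \<in> null_sets Q"
      using Q(2) I by (intro null_setsI) (auto simp: Q.emeasure_eq_measure Q.M_is_borel borel_comp)
    then have "AE x in Q. x \<notin> - I" by (rule AE_not_in)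
    then show "AE x in Q. indicator (A \<inter> I) x *\<^sub>R F x $ i = indicator A x *\<^sub>R F x $ i"
      by eventually_elim (auto split: split_indicator)
    show "(\<lambda>x. indicator (A \<inter> I) x *\<^sub>R F x $ i) \<in> borel_measurable Q" "(\<lambda>x. indicator A x *\<^sub>R F x $ i) \<in> borel_measurable Q"
      using A I by (auto intro!: borel_measurable_scaleR borel_measurable_indicator m borel_measurable_times simp: Q.M_is_borel)
  qed
  also have "\<dots> = (LINT x:A|Q. F x) $ i" using F(2) by (rule set_integral_vec_nth[symmetric])
  finally show ?thesis .
qed

lemma norm_set_integral_unit_le:
  fixes F :: "real \<Rightarrow> real^3"
  assumes Q: "finite_borel_measure Q" and A: "A \<in> sets borel" and F: "continuous_on UNIV F" "\<And>x. norm (F x) = 1"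
  shows "set_integrable Q A F" "norm (LINT x:A|Q. F x) \<le> measure Q A"
proof -
  interpret Q: finite_borel_measure Q by fact
  show si: "set_integrable Q A F"
    using A F by (intro set_integrable_bounded_continuous[OF Q, where I=UNIV and C=1]) auto
  have "norm (LINT x:A|Q. F x) \<le> (LINT x:A|Q. norm (F x))"
    using si by (rule set_integral_norm_bound)
  also have "\<dots> = measure Q A"
    using A by (simp add: F set_lebesgue_integral_def Q.M_is_borel Q.borel_UNIV)
  finally show "norm (LINT x:A|Q. F x) \<le> measure Q A" .
qed

theorem theorem2p6:
  fixes L :: real
    and \<theta> \<phi> :: "real \<Rightarrow> real"
    and G :: "real \<Rightarrow> real^3^3"
    and c :: "real \<Rightarrow> real^3"
  assumes "L > 0"
    and "\<theta> \<in> BV {0<..<L} UNIV" and "continuous_on {0<..<L} \<theta>"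
    and "\<phi> \<in> BV {0<..<L} UNIV" and "continuous_on {0<..<L} \<phi>"
    and "strict_mono_on {0<..<L} \<theta>"
    and "G \<in> BV {0<..<L} {A. rotation_matrix A}" and "continuous_on {0<..<L} G"
    and "solves_frame_equation {0<..<L} (Omega \<theta> \<phi>) G"
    and "(G \<longlongrightarrow> mat 1) (at_right 0)"
    and "unit_speed_C1 0 L c"
    and "\<And>s. s \<in> {0<..<L} \<Longrightarrow> (c has_vector_derivative (G s *v axis 1 1)) (at s)"
  shows "TAT 0 L c = variation (deriv_measure {0<..<L} (\<lambda>s. G s *v axis 3 1)) {0<..<L} \<and>
         variation (deriv_measure {0<..<L} (\<lambda>s. G s *v axis 3 1)) {0<..<L} =
           variation (deriv_measure {0<..<L} \<phi>) {0<..<L} \<and>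
         variation (deriv_measure {0<..<L} \<phi>) {0<..<L} < \<infinity>"
proof -
  let ?I = "{0<..<L}"
  note L = assms(1) and \<theta>c = assms(3) and \<phi>c = assms(5) and Gc = assms(8)
  define DG where "DG = deriv_measure ?I G"
  define D\<theta> where "D\<theta> = deriv_measure ?I \<theta>"
  define D\<phi> where "D\<phi> = deriv_measure ?I \<phi>"
  have dG: "is_deriv_measure ?I G DG" and d\<theta>: "is_deriv_measure ?I \<theta> D\<theta>" and d\<phi>: "is_deriv_measure ?I \<phi> D\<phi>"
    unfolding DG_def D\<theta>_def D\<phi>_def using assms by (auto intro: is_deriv_measure_BV)
  have D\<Omega>: "deriv_measure ?I (Omega \<theta> \<phi>) = (\<lambda>B. skew (D\<theta> B) (D\<phi> B))"
  proof (rule deriv_measure_eqI[OF is_deriv_measure_Omega[OF d\<theta> d\<phi>]])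
    show "continuous_on ?I (Omega \<theta> \<phi>)"
      unfolding Omega_eq_skew[abs_def] skew_linear[of "\<theta> _"] by (intro continuous_intros \<theta>c \<phi>c)
  qed
  \<comment> \<open>Membership in \<open>BV\<close> gives rotations only almost everywhere;
    continuity and closedness give them everywhere on the interval.\<close>
  have rot: "rotation_matrix (G s)" if "s \<in> ?I" for s
    using continuous_AE_closed[OF Gc _ closed_rotation_matrix _ that] assms(7) by (auto simp: BV_def)
  obtain M M' Y' where M: "decomposes ?I D\<theta> M M'" "Y' \<in> sets borel" "measure M (- Y') = 0" "measure M' Y' = 0"
    "measure M (- ?I) = 0" "measure M' (- ?I) = 0" "\<And>x. measure M {x} = 0"
    using deriv_measure_jordan[OF d\<theta> \<theta>c] by metis
  have \<theta>m: "mono_on ?I \<theta>" using assms(6) by (rule strict_mono_on_imp_mono_on)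
  have M': "measure M' UNIV = 0"
    using monotone_jordan_negative_part[OF d\<theta> \<theta>c \<theta>m M(1-4,6)] .
  obtain P N Y where PN: "decomposes ?I D\<phi> P N" "Y \<in> sets borel" "Y \<subseteq> ?I" "measure P (- Y) = 0" "measure N Y = 0"
    "measure P (- ?I) = 0" "measure N (- ?I) = 0" "\<And>x. measure P {x} = 0" "\<And>x. measure N {x} = 0"
    using deriv_measure_jordan[OF d\<phi> \<phi>c] by metis
  have fb: "finite_borel_measure M" "finite_borel_measure M'" "finite_borel_measure P" "finite_borel_measure N"
    using M(1) PN(1) by (auto simp: decomposes_def)
  interpret M: finite_borel_measure M by (rule fb)
  interpret M': finite_borel_measure M' by (rule fb)
  interpret P: finite_borel_measure P by (rule fb)
  interpret N: finite_borel_measure N by (rule fb)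
  have vG: "vector_measure_on ?I DG" using dG by (simp add: is_deriv_measure_def)

  txt \<open>\<open>F\<close> extends \<open>G\<close> continuously to the real line, constantly outside \<open>I\<close>.\<close>
  define F where "F x = G (L / 2) - DG ({..L / 2} \<inter> ?I) + DG ({..x} \<inter> ?I)" for x
  have F_diff: "F y - F x = DG ({x<..y} \<inter> ?I)" if "x \<le> y" for x y
  proof -
    have "DG ({..y} \<inter> ?I - {..x} \<inter> ?I) = DG ({..y} \<inter> ?I) - DG ({..x} \<inter> ?I)"
      using that by (intro vector_measure_on_Diff[OF vG]) (auto simp: sets_restrict_Ioo)
    moreover have "{..y} \<inter> ?I - {..x} \<inter> ?I = {x<..y} \<inter> ?I" by auto
    ultimately show ?thesis by (simp add: F_def)
  qed
  have F_half: "F (L / 2) = G (L / 2)" by (simp add: F_def)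
  have F_incr: "F y - F x = G y - G x" if "0 < x" "x \<le> y" "y < L" for x y
  proof -
    have "{x<..y} \<inter> ?I = {x<..y}" using that by auto
    then show ?thesis using F_diff[OF that(2)] deriv_measure_Ioc[OF dG Gc that] by simp
  qed
  have FG: "F x = G x" if "x \<in> ?I" for x
    using F_incr[of x "L / 2"] F_incr[of "L / 2" x] F_half L that by (cases "x \<le> L / 2") auto
  have entry_basis: "axis i (axis j 1) \<in> (Basis :: (real^3^3) set)" for i j
    by (auto simp: Basis_vec_def)
  have entry_inner: "A \<bullet> axis i (axis j 1) = A $ i $ j" for A :: "real^3^3" and i j
    by (simp add: inner_axis)
  have d_entry: "is_deriv_measure ?I (\<lambda>s. G s $ i $ j) (\<lambda>B. DG B $ i $ j)" for i j
    using is_deriv_measure_inner[OF dG entry_basis[of i j]] by (simp add: entry_inner)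
  have F_entry: "continuous_on UNIV (\<lambda>x. F x $ i $ j)" for i j
  proof -
    have "continuous_on UNIV (\<lambda>x. DG ({..x} \<inter> ?I) $ i $ j)"
      by (rule continuous_on_deriv_measure_atMost[OF d_entry continuous_on_matrix_entry[OF Gc]])
    then show ?thesis unfolding F_def by (auto intro!: continuous_intros)
  qed
  have Fc: "continuous_on UNIV F"
  proof -
    have "continuous_on UNIV (\<lambda>x. \<chi> i j. F x $ i $ j)" by (intro continuous_on_vec_lambda F_entry)
    moreover have "(\<lambda>x. \<chi> i j. F x $ i $ j) = F" by (simp add: vec_eq_iff fun_eq_iff)
    ultimately show ?thesis by simp
  qed
  \<comment> \<open>Closedness carries the property to both end points, and outside the interval
    \<open>F\<close> is constant.\<close>
  have F_rot: "rotation_matrix (F x)" for x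
  proof -
    have cl: "closed (F -` {A. rotation_matrix A})"
      using closed_rotation_matrix Fc by (rule closed_vimage)
    have "?I \<subseteq> F -` {A. rotation_matrix A}" using rot FG by auto
    then have "closure ?I \<subseteq> F -` {A. rotation_matrix A}" using cl by (rule closure_minimal)
    moreover have "closure ?I = {0..L}" using L by simp
    ultimately have *: "rotation_matrix (F z)" if "z \<in> {0..L}" for z using that by blast
    consider "x \<in> {0..L}" | "x < 0" | "L < x" by fastforce
    then show ?thesis
    proof cases
      case 1
      then show ?thesis by (rule *)
    next
      case 2
      then have "{..x} \<inter> ?I = {..0} \<inter> ?I" by auto
      then have "F x = F 0" by (simp only: F_def)
      then show ?thesis using *[of 0] L by simp
    next
      case 3
      then have "{..x} \<inter> ?I = {..L} \<inter> ?I" by auto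
      then have "F x = F L" by (simp only: F_def)
      then show ?thesis using *[of L] L by simp
    qed
  qed
  define t where "t x = F x *v axis 1 1" for x
  define n where "n x = F x *v axis 2 1" for x
  define b where "b x = F x *v axis 3 1" for x
  have cols: "t x $ i = F x $ i $ 1" "n x $ i = F x $ i $ 2" "b x $ i = F x $ i $ 3" for x i
    by (simp_all only: t_def n_def b_def matrix_axis_nth)
  have cc: "continuous_on UNIV t" "continuous_on UNIV n" "continuous_on UNIV b"
  proof -
    have col: "continuous_on UNIV (\<lambda>x. F x *v axis j 1)" for j
    proof -
      have "continuous_on UNIV (\<lambda>x. \<chi> i. F x $ i $ j)" by (intro continuous_on_vec_lambda F_entry)
      moreover have "(\<lambda>x. \<chi> i. F x $ i $ j) = (\<lambda>x. F x *v axis j 1)"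
        by (simp only: vec_eq_iff fun_eq_iff matrix_axis_nth vec_lambda_beta simp_thms)
      ultimately show ?thesis by (simp only:)
    qed
    show "continuous_on UNIV t" "continuous_on UNIV n" "continuous_on UNIV b"
      unfolding t_def[abs_def] n_def[abs_def] b_def[abs_def] by (rule col)+
  qed
  have nrm: "norm (t x) = 1" "norm (n x) = 1" "norm (b x) = 1" for x
    unfolding t_def n_def b_def by (rule rotation_columns(1)[OF F_rot])+
  have rot': "\<forall>s\<in>?I. rotation_matrix (G s)" using rot by blast
  note ent = frame_equation_entries[OF assms(9) D\<Omega> Gc rot' M(1) M' PN(1), folded DG_def]
  have I: "?I \<in> sets borel" by simp
  have conc: "(LINT x:A \<inter> ?I|Q. G x $ i $ 1) = (LINT x:A|Q. t x) $ i"
     "(LINT x:A \<inter> ?I|Q. G x $ i $ 2) = (LINT x:A|Q. n x) $ i"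
     "(LINT x:A \<inter> ?I|Q. G x $ i $ 3) = (LINT x:A|Q. b x) $ i"
    if "finite_borel_measure Q" "measure Q (- ?I) = 0" "A \<in> sets borel" for Q A i
    using that cc nrm FG
    by (auto intro!: set_integral_concentrated[OF that(1,2) I that(3)] norm_set_integral_unit_le(1) simp: cols)
  have DG1: "DG (A \<inter> ?I) *v axis 1 1 = (LINT x:A|M. n x)"
    and DG2: "DG (A \<inter> ?I) *v axis 2 1 = (LINT x:A|P. b x) - (LINT x:A|N. b x) - (LINT x:A|M. t x)"
    and DG3: "DG (A \<inter> ?I) *v axis 3 1 = (LINT x:A|N. n x) - (LINT x:A|P. n x)"
    if A: "A \<in> sets borel" for A
  proof -
    have AI: "A \<inter> ?I \<in> sets borel" "A \<inter> ?I \<subseteq> ?I" using A by auto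
    note e = ent[OF AI] and cM = conc[OF fb(1) M(5) A] and cP = conc[OF fb(3) PN(6) A] and cN = conc[OF fb(4) PN(7) A]
    show "DG (A \<inter> ?I) *v axis 1 1 = (LINT x:A|M. n x)"
      unfolding vec_eq_iff by (simp only: matrix_axis_nth e cM simp_thms)
    show "DG (A \<inter> ?I) *v axis 2 1 = (LINT x:A|P. b x) - (LINT x:A|N. b x) - (LINT x:A|M. t x)"
      unfolding vec_eq_iff by (simp only: matrix_axis_nth e cM cP cN vector_minus_component simp_thms)
    show "DG (A \<inter> ?I) *v axis 3 1 = (LINT x:A|N. n x) - (LINT x:A|P. n x)"
      unfolding vec_eq_iff by (simp only: matrix_axis_nth e cP cN vector_minus_component simp_thms)
  qed
  have col_diff: "F y *v v - F x *v v = DG ({x<..y} \<inter> ?I) *v v" if "x \<le> y" for x y v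
    using F_diff[OF that] by (simp flip: matrix_vector_mult_diff_rdistrib)
  have deriv: "(c has_vector_derivative t x) (at x)" if "0 < x" "x < L" for x
    using assms(12)[of x] FG[of x] that by (simp add: t_def)

  interpret frame_curve L t n b c M P N Y
  proof
    show "L > 0" by (rule L)
    show "measure M {x} = 0" "measure P {x} = 0" "measure N {x} = 0" for x using M PN by auto
    show "0 < measure M {x<..y}" if xy: "0 \<le> x" "x < y" "y \<le> L" for x y
    proof -
      \<comment> \<open>Strict monotonicity is available only on the open interval, so the two inner
        third points replace \<open>x\<close> and \<open>y\<close>, which may be end points.\<close>
      define x' where "x' = (2 * x + y) / 3"
      define y' where "y' = (x + 2 * y) / 3"
      have o: "0 < x'" "x < x'" "x' < y'" "y' < y" "y' < L" using xy by (auto simp: x'_def y'_def)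
      have "D\<theta> ({x'<..y'} \<inter> ?I) = measure M {x'<..y'} - measure M' {x'<..y'}"
        using M(1) unfolding decomposes_def by auto
      moreover have "{x'<..y'} \<inter> ?I = {x'<..y'}" using o by auto
      moreover have "D\<theta> {x'<..y'} = \<theta> y' - \<theta> x'" using o by (intro deriv_measure_Ioc[OF d\<theta> \<theta>c]) auto
      moreover have "\<theta> x' < \<theta> y'" using strict_mono_onD[OF assms(6), of x' y'] o by simp
      ultimately have "0 < measure M {x'<..y'} - measure M' {x'<..y'}" by simp
      then have "0 < measure M {x'<..y'}" using measure_nonneg[of M' "{x'<..y'}"] by linarith
      also have "\<dots> \<le> measure M {x<..y}" using o by (intro M.finite_measure_mono) (auto simp: M.M_is_borel)
      finally show ?thesis .
    qed
    show "Y \<in> sets borel" "measure P (- Y) = 0" "measure N Y = 0" using PN by auto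
    show "continuous_on UNIV t" "continuous_on UNIV n" "continuous_on UNIV b" by (rule cc)+
    show "norm (t x) = 1" "norm (n x) = 1" "norm (b x) = 1" for x by (rule nrm)+
    show "cross3 (t x) (n x) = b x" for x unfolding t_def n_def b_def by (rule rotation_columns(2)[OF F_rot])
    show "t y - t x = (LINT u:{x<..y}|M. n u)" if "x \<le> y" for x y
      unfolding t_def col_diff[OF that] by (rule DG1) simp
    show "b y - b x = (LINT u:{x<..y}|N. n u) - (LINT u:{x<..y}|P. n u)" if "x \<le> y" for x y
      unfolding b_def col_diff[OF that] by (rule DG3) simp
    show "norm (n y - n x) \<le> measure M {x<..y} + measure P {x<..y} + measure N {x<..y}" if "x \<le> y" for x y
    proof -
      let ?A = "{x<..y}"
      have A: "?A \<in> sets borel" by simp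
      have "n y - n x = (LINT x:?A|P. b x) - (LINT x:?A|N. b x) - (LINT x:?A|M. t x)"
        unfolding n_def col_diff[OF that] by (rule DG2) simp
      also have "norm \<dots> \<le> norm (LINT x:?A|P. b x) + norm (LINT x:?A|N. b x) + norm (LINT x:?A|M. t x)"
        by (meson norm_triangle_ineq4 order_trans add_right_mono)
      finally show ?thesis
        using norm_set_integral_unit_le(2)[OF fb(3) A cc(3) nrm(3)] norm_set_integral_unit_le(2)[OF fb(4) A cc(3) nrm(3)]
          norm_set_integral_unit_le(2)[OF fb(1) A cc(1) nrm(1)] by linarith
    qed
    show "continuous_on {0..L} c"
      using assms(11) unfolding unit_speed_C1_def
      by (auto simp: continuous_on_eq_continuous_within intro: has_vector_derivative_continuous)
    show "(c has_vector_derivative t x) (at x)" if "0 < x" "x < L" for x by (rule deriv[OF that])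
  qed

  \<comment> \<open>The half-open interval contains \<open>L\<close>, which carries no mass.\<close>
  have tors_I: "tors 0 L = measure P ?I + measure N ?I"
  proof -
    have "{0<..L} = ?I \<union> {L}" using L by auto
    moreover have "measure P (?I \<union> {L}) = measure P ?I + measure P {L}"
      by (rule P.finite_measure_Union) (auto simp: P.M_is_borel)
    moreover have "measure N (?I \<union> {L}) = measure N ?I + measure N {L}"
      by (rule N.finite_measure_Union) (auto simp: N.M_is_borel)
    ultimately show ?thesis using PN(8,9) by (simp only: tors_def add_0_right)
  qed

  have var_\<phi>: "variation D\<phi> ?I = ennreal (tors 0 L)"
  proof (rule antisym)
    have val: "D\<phi> A = measure P A - measure N A" if "A \<in> sets borel" "A \<subseteq> ?I" for A
      using PN(1) that unfolding decomposes_def by (metis inf.absorb1)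
    show "variation D\<phi> ?I \<le> ennreal (tors 0 L)"
      unfolding tors_I by (intro variation_le_dominating fb I) (auto simp: val abs_le_iff add_increasing add_increasing2)
    have YI: "?I - Y \<in> sets borel" using PN(2) by auto
    \<comment> \<open>The Hahn partition attains the variation, because on each of its two pieces
      one of the Jordan parts vanishes.\<close>
    define A where "A k = (if k = 0 then Y else ?I - Y)" for k :: nat
    have "measure N (?I - Y) = measure N ?I"
      using PN(2,3,5) by (subst N.finite_measure_Diff) (auto simp: N.M_is_borel)
    moreover have "measure P (?I - Y) = 0"
      using P.finite_measure_mono[of "?I - Y" "- Y"] PN(2,4) measure_nonneg[of P "?I - Y"]
      by (simp add: P.M_is_borel borel_comp subset_eq)
    moreover have "measure P ?I = measure P Y + measure P (?I - Y)"
      using PN(2,3) by (subst P.finite_measure_Diff) (auto simp: P.M_is_borel)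
    ultimately have "tors 0 L = \<bar>D\<phi> Y\<bar> + \<bar>D\<phi> (?I - Y)\<bar>"
      using PN(2,3,5) YI val[of Y] val[of "?I - Y"] by (simp add: tors_I)
    also have "\<dots> = (\<Sum>k<2. norm (D\<phi> (A k)))" by (simp add: A_def numeral_2_eq_2)
    finally have "ennreal (tors 0 L) = ennreal (\<Sum>k<2. norm (D\<phi> (A k)))" by simp
    also have "\<dots> \<le> variation D\<phi> ?I"
      using PN(2,3) YI by (intro finite_sum_le_variation) (auto simp: A_def disjoint_family_on_def)
    finally show "ennreal (tors 0 L) \<le> variation D\<phi> ?I" .
  qed

  define Db where "Db B = DG B *v axis 3 1" for B
  have db: "is_deriv_measure ?I (\<lambda>s. G s *v axis 3 1) Db"
    unfolding is_deriv_measure_def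
  proof (intro conjI ballI allI impI)
    show "vector_measure_on ?I Db"
      unfolding Db_def
    proof (rule vector_measure_on_bounded_linear[OF vG])
      have "linear (\<lambda>A :: real^3^3. A *v axis 3 1)"
        by (rule linearI) (simp_all only: matrix_vector_mult_add_rdistrib scaleR_matrix_vector_assoc)
      then show "bounded_linear (\<lambda>A :: real^3^3. A *v axis 3 1)"
        by (simp only: linear_conv_bounded_linear)
    qed
    fix e :: "real^3" and \<psi> assume "e \<in> Basis" and \<psi>: "test_function ?I \<psi>"
    then obtain i where e: "e = axis i 1" by (auto simp: Basis_vec_def)
    have "v \<bullet> e = v $ i" for v by (simp add: e inner_axis)
    then show "has_signed_integral ?I (\<lambda>B. Db B \<bullet> e) ?I \<psi> (- (LINT x:?I|lborel. (G x *v axis 3 1) \<bullet> e * deriv \<psi> x))"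
      using d_entry[of i 3] \<psi> by (auto simp: is_deriv_measure_def Db_def matrix_axis_nth)
  qed
  have bc: "continuous_on ?I (\<lambda>s. G s *v axis 3 1)"
  proof -
    have "continuous_on ?I b" using cc(3) continuous_on_subset by blast
    then show ?thesis by (rule continuous_on_eq) (simp add: b_def FG)
  qed
  have Db: "deriv_measure ?I (\<lambda>s. G s *v axis 3 1) = Db"
    by (rule deriv_measure_eqI[OF db bc])
  have var_b: "variation Db ?I = ennreal (tors 0 L)"
  proof (rule antisym)
    show "variation Db ?I \<le> ennreal (tors 0 L)"
      unfolding tors_I
    proof (intro variation_le_dominating fb I)
      fix A assume A: "A \<in> sets borel" "A \<subseteq> ?I"
      then have "A \<inter> ?I = A" by auto
      then have DbA: "Db A = (LINT x:A|N. n x) - (LINT x:A|P. n x)" using DG3[OF A(1)] by (simp only: Db_def)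
      show "norm (Db A) \<le> measure P A + measure N A"
        using norm_triangle_ineq4[of "LINT x:A|N. n x" "LINT x:A|P. n x"]
          norm_set_integral_unit_le(2)[OF fb(4) A(1) cc(2) nrm(2)] norm_set_integral_unit_le(2)[OF fb(3) A(1) cc(2) nrm(2)]
        unfolding DbA by linarith
    qed
    show "ennreal (tors 0 L) \<le> variation Db ?I"
    \<comment> \<open>The increments of \<open>b\<close> over the inner cells of a fine grid are
      values of its derivative measure on disjoint intervals, so the grid estimate bounds the
      variation from below.\<close>
    proof (rule ennreal_le_epsilon)
      fix \<epsilon> :: real assume "0 < \<epsilon>"
      then obtain K where K: "tors 0 L \<le> (\<Sum>k<K. norm (b (real (k + 2) * L / real (K + 2)) - b (real (k + 1) * L / real (K + 2)))) + \<epsilon>"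
        using grid_variation by blast
      define s where "s k = real (k + 1) * L / real (K + 2)" for k
      have s_mono: "s i \<le> s j" if "i \<le> j" for i j
        unfolding s_def using that L by (intro divide_right_mono mult_right_mono) auto
      have s_rng: "0 < s k" "k \<le> K \<Longrightarrow> s k < L" for k
      proof -
        show "0 < s k" unfolding s_def using L by (intro divide_pos_pos mult_pos_pos) auto
        assume "k \<le> K"
        then have "real (k + 1) * L < real (K + 2) * L" using L by (intro mult_strict_right_mono) auto
        then show "s k < L" unfolding s_def by (simp add: pos_divide_less_eq mult.commute)
      qed
      have "b (real (k + 2) * L / real (K + 2)) - b (real (k + 1) * L / real (K + 2)) = Db {s k<..s (Suc k)}" if "k < K" for k
      proof -
        have "{s k<..s (Suc k)} \<inter> ?I = {s k<..s (Suc k)}" using s_rng[of k] s_rng[of "Suc k"] that by auto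
        then have "Db {s k<..s (Suc k)} = b (s (Suc k)) - b (s k)"
          using col_diff[OF s_mono[of k "Suc k"], of "axis 3 1"] by (simp add: Db_def b_def)
        then show ?thesis by (simp add: s_def add.commute)
      qed
      then have "tors 0 L \<le> (\<Sum>k<K. norm (Db {s k<..s (Suc k)})) + \<epsilon>" using K by simp
      then have "ennreal (tors 0 L) \<le> ennreal ((\<Sum>k<K. norm (Db {s k<..s (Suc k)})) + \<epsilon>)" by (rule ennreal_leI)
      also have "\<dots> = ennreal (\<Sum>k<K. norm (Db {s k<..s (Suc k)})) + ennreal \<epsilon>"
        using \<open>0 < \<epsilon>\<close> by (intro ennreal_plus sum_nonneg) auto
      also have "ennreal (\<Sum>k<K. norm (Db {s k<..s (Suc k)})) \<le> variation Db ?I"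
      proof (intro finite_sum_le_variation I)
        show "{s k<..s (Suc k)} \<in> sets borel \<and> {s k<..s (Suc k)} \<subseteq> ?I" if "k < K" for k
          using s_rng[of k] s_rng[of "Suc k"] that by auto
        show "disjoint_family_on (\<lambda>k. {s k<..s (Suc k)}) {..<K}"
          unfolding disjoint_family_on_def
        proof (intro ballI impI)
          fix i j :: nat assume "i \<noteq> j"
          then show "{s i<..s (Suc i)} \<inter> {s j<..s (Suc j)} = {}"
            using s_mono[of "Suc i" j] s_mono[of "Suc j" i] by (cases "i < j") auto
        qed
      qed
      finally show "ennreal (tors 0 L) \<le> variation Db ?I + ennreal \<epsilon>" by simp
    qed
  qed
  show ?thesis
    using TAT_eq_tors var_\<phi> var_b by (simp add: Db D\<phi>_def)
qed

end
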